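(* Let $-1\le q\le1$ and let $\varepsilon:\mathbb{N}\times\mathbb{N}\to\{\pm1\}$ (with $\mathbb{N}=\{1,2,3,\dots\}$) be a fixed choice of sign function, i.e. $\varepsilon(i,j)=\varepsilon(j,i)$ and $\varepsilon(i,i)=-1$ for all $i,j$, such that, with $X_{n,k},Y_{n,k}\in\Gamma_n$ as defined in the context, (a) $\tau_n^\varepsilon(Q(X_{n,1}))\to\tau_q(Q(G_q))$ as $n\to\infty$ for every polynomial $Q$; and (b) $\|X_{n,k}-Y_{n,k}\|_p\to0$ as $n\to\infty$ for all integers $k\ge1$ and all real $p\ge1$. Then for every integer $k\ge1$, $X_{n,k}\to H^q_k(G_q)$ in distribution as $n\to\infty$, i.e. for every polynomial $Q$ in one variable $$\tau_n^\varepsilon(Q(X_{n,k}))\to\tau_q\big(Q(H_k^q(G_q))\big).$$ Consequently, for every $k\ge 1$, $H_k^q(G_q)$ can be approximated in distribution by a sequence of weighted graphs on the distance $k$-graph of the $n$-cube $K_2^n$: there are weighted graphs on the distance $k$-graph of $K_2^n$ ($n\ge k$), with adjacency matrices $A_n$, such that $\langle Q(A_n)\delta_e,\delta_e\rangle\to\tau_q(Q(H_k^q(G_q)))$ for every polynomial $Q$, where $e=(0,\dots,0)$; namely, $A_n$ can be taken to be the matrix of $X_{n,k}$ in the basis $\{x_A\}$, with the identification of vertices of $K_2^n$ and basis vectors given in the context.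
   Context: Baby Fock model. For $n\ge1$ let $I=\{1,\dots,n\}$ and restrict $\varepsilon$ to $I\times I$; write $\varepsilon_{i,j}=\varepsilon(i,j)$. Let $\mathcal{A}(I,\varepsilon)$ be the unital complex $*$-algebra with generators $x_i=x_i^*$, $i\in I$, and relations $x_ix_j-\varepsilon(i,j)x_jx_i=2\delta_{i,j}$ (so $x_i^2=1$). For $A=\{i_1<\dots<i_m\}\subseteq I$ put $x_A=x_{i_1}\cdots x_{i_m}$, $x_\emptyset=1$; the $x_A$ form a basis of $\mathcal{A}(I,\varepsilon)$. Let $\phi^\varepsilon$ be the tracial state with $\phi^\varepsilon(x_A)=\delta_{A,\emptyset}$, let $\langle x,y\rangle=\phi^\varepsilon(y^*x)$, and let $H=L^2(\mathcal{A}(I,\varepsilon),\phi^\varepsilon)$, with orthonormal basis $\{x_A\}$. Let $\gamma_i\in B(H)$ be left multiplication by $x_i$, let $\Gamma_n\subset B(H)$ be the von Neumann algebra generated by $\gamma_1,\dots,\gamma_n$, and let $\tau_n^\varepsilon(T)=\langle T1,1\rangle$, a faithful tracial state on $\Gamma_n$. Put $\|T\|_p=(\tau_n^\varepsilon(|T|^p))^{1/p}$. Operators. With $[k]_q=\frac{1-q^k}{1-q}$ (and $[k]_1=k$), for $k\ge1$ set $$X_{n,k}=\frac{1}{n^{k/2}}\sum_{i_1,\dots,i_k}\gamma_{i_1}\cdots\gamma_{i_k},\qquad Y_{n,k}=\frac1{n^{k/2}}\sum_{i_1,\dots,i_k}[k+1]_q^{-1}Z(i_1,\dots,i_k)\,\gamma_{i_1}\cdots\gamma_{i_k},$$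 both sums over $k$-tuples of pairwise distinct elements of $\{1,\dots,n\}$, where $$Z(i_1,\dots,i_k)=\frac1n\sum_{i\in\{1,\dots,n\}\setminus\{i_1,\dots,i_k\}}\big(\varepsilon_{i,i_1}\varepsilon_{i,i_2}\cdots\varepsilon_{i,i_k}+\varepsilon_{i,i_2}\cdots\varepsilon_{i,i_k}+\dots+\varepsilon_{i,i_k}+1\big).$$ Choice of $\varepsilon$. The $\{\varepsilon(i,j):i<j\}$ are taken to be i.i.d. random variables with $P(\varepsilon(i,j)=-1)=\frac{1-q}2$ and $P(\varepsilon(i,j)=1)=\frac{1+q}2$; almost every realization $\varepsilon$ satisfies (a) and (b), and one such $\varepsilon$ is fixed. $q$-Hermite polynomials: $H^q_0(x)=1$, $H^q_1(x)=x$, $xH^q_k(x)=H^q_{k+1}(x)+[k]_qH^q_{k-1}(x)$ for $k\ge1$. $q$-gaussian variable $G_q$. For $-1<q<1$, let $\mathcal{H}$ be the complexification of a nonzero real Hilbert space $H_{\mathbb{R}}$ and let $\mathcal{F}_q(\mathcal{H})$ be the $q$-Fock space, i.e. $\mathbb{C}\Omega\oplus\bigoplus_{m\ge1}\mathcal{H}^{\otimes m}$ completed with respect to $\langle\xi,\eta\rangle_q=\langle\xi,P_m\eta\rangle$ on $\mathcal{H}^{\otimes m}$, where $P_m(f_1\otimes\cdots\otimes f_m)=\sum_{\pi\in S_m}q^{i(\pi)}f_{\pi(1)}\otimes\cdots\otimes f_{\pi(m)}$ and $i(\pi)$ is the number of inversions of $\pi$; $\Omega$ is the vacuum unit vector.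 The left creation operator is $\ell_q(h)\Omega=h$, $\ell_q(h)f_1\otimes\cdots\otimes f_m=h\otimes f_1\otimes\cdots\otimes f_m$. Then $G_q=\ell_q(h)+\ell_q(h)^*$ for a unit vector $h\in H_{\mathbb{R}}$, and $\tau_q(T)=\langle T\Omega,\Omega\rangle_q$ is the vacuum state. In the extreme cases $q=1$ and $q=-1$ one uses instead the Bosonic (symmetric) and Fermionic (antisymmetric) Fock spaces with their creation operators; in distribution, $G_1$ is a standard normal random variable and $G_{-1}$ is a random variable taking the values $\pm1$ with probability $\frac12$ each, $\tau_{\pm1}$ being expectation. Graphs. The $n$-cube $K_2^n$ has vertex set $\{0,1\}^n$, with an edge between two vertices that differ in exactly one coordinate. The distance $k$-graph of $K_2^n$ ($1\le k\le n$) has the same vertices, with an edge between two vertices that differ in exactly $k$ coordinates. A weighted graph on a graph $(V,E)$ is an assignment of real weights $a_{xy}$ to the pairs $(x,y)\in E$ (weights may be any real numbers); its adjacency matrix has entries $a_{xy}$ for $(x,y)\in E$ and $0$ otherwise. The vertex $(r_1,\dots,r_n)\in\{0,1\}^n$ is identified with the basis vector $x_1^{r_1}\cdots x_n^{r_n}=x_A$, $A=\{i:r_i=1\}$, of $H$. *)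

theory Defs
  imports
    "HOL-Probability.Probability"
    "HOL-Combinatorics.Permutations"
    "HOL-Library.Poly_Mapping"
    "Jordan_Normal_Form.Schur_Decomposition"
begin

section \<open>Free algebras\<close>

text \<open>
  Words form a monoid under concatenation, so \<^typ>\<open>'a list \<Rightarrow>\<^sub>0 complex\<close> with the library's
  convolution product is the free unital complex algebra on the letters \<^typ>\<open>'a\<close>
  (as a vector space: the tensor algebra of the space freely spanned by the letters).
\<close>

instantiation list :: (type) monoid_add
begin

definition zero_list :: "'a list" where "zero_list = []"
definition plus_list :: "'a list \<Rightarrow> 'a list \<Rightarrow> 'a list" where "plus_list u v = u @ v"

instance
  by standard (simp_all add: zero_list_def plus_list_def)

end

type_synonym 'a free_alg = "'a list \<Rightarrow>\<^sub>0 complex"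

definition scalar :: "complex \<Rightarrow> 'a free_alg" where
  "scalar c = Poly_Mapping.single [] c"

definition gen :: "'a \<Rightarrow> 'a free_alg" where
  "gen x = Poly_Mapping.single [x] 1"

definition star :: "'a free_alg \<Rightarrow> 'a free_alg" where
  "star a = (\<Sum>w\<in>Poly_Mapping.keys a. Poly_Mapping.single (rev w) (cnj (Poly_Mapping.lookup a w)))"


section \<open>The baby Fock model\<close>

definition sign_function :: "(nat \<Rightarrow> nat \<Rightarrow> real) \<Rightarrow> bool" where
  "sign_function \<epsilon> \<longleftrightarrow>
    (\<forall>i\<ge>1. \<forall>j\<ge>1. \<epsilon> i j \<in> {-1, 1} \<and> \<epsilon> i j = \<epsilon> j i) \<and> (\<forall>i\<ge>1. \<epsilon> i i = -1)"

definition relator :: "(nat \<Rightarrow> nat \<Rightarrow> real) \<Rightarrow> nat \<Rightarrow> nat \<Rightarrow> nat free_alg" where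
  "relator \<epsilon> i j =
     gen i * gen j - scalar (complex_of_real (\<epsilon> i j)) * gen j * gen i
       - scalar (if i = j then 2 else 0)"

text \<open>
  The two-sided ideal of the free algebra on \<open>x\<^sub>1, \<dots>, x\<^sub>n\<close> generated by the relators. The
  \<open>*\<close>-algebra \<open>\<A>(I,\<epsilon>)\<close>, \<open>I = {1..n}\<close>, is the quotient by this ideal; we calculate with
  representatives in the free algebra.
\<close>

inductive_set relation_ideal :: "(nat \<Rightarrow> nat \<Rightarrow> real) \<Rightarrow> nat \<Rightarrow> nat free_alg set"
  for \<epsilon> :: "nat \<Rightarrow> nat \<Rightarrow> real" and n :: nat where
  zero: "0 \<in> relation_ideal \<epsilon> n"
| add: "\<lbrakk>a \<in> relation_ideal \<epsilon> n; i \<in> {1..n}; j \<in> {1..n};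
         Poly_Mapping.keys u \<subseteq> lists {1..n}; Poly_Mapping.keys v \<subseteq> lists {1..n}\<rbrakk>
        \<Longrightarrow> a + u * relator \<epsilon> i j * v \<in> relation_ideal \<epsilon> n"

definition x_set :: "nat set \<Rightarrow> nat free_alg" where
  "x_set A = prod_list (map gen (sorted_list_of_set A))"

text \<open>
  The state \<open>\<phi>\<^sup>\<epsilon>\<close>, as a linear functional on the free algebra vanishing on the ideal. Since
  the \<open>x\<^sub>A\<close> form a basis of the quotient, these conditions determine it on all elements built
  from \<open>x\<^sub>1, \<dots>, x\<^sub>n\<close>; only such elements are used below.
\<close>

definition is_baby_state :: "(nat \<Rightarrow> nat \<Rightarrow> real) \<Rightarrow> nat \<Rightarrow> (nat free_alg \<Rightarrow> complex) \<Rightarrow> bool" where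
  "is_baby_state \<epsilon> n f \<longleftrightarrow>
    (\<forall>a b. f (a + b) = f a + f b) \<and> (\<forall>c a. f (scalar c * a) = c * f a) \<and>
    (\<forall>a\<in>relation_ideal \<epsilon> n. f a = 0) \<and>
    (\<forall>A\<subseteq>{1..n}. f (x_set A) = (if A = {} then 1 else 0))"

definition baby_state :: "(nat \<Rightarrow> nat \<Rightarrow> real) \<Rightarrow> nat \<Rightarrow> nat free_alg \<Rightarrow> complex" where
  "baby_state \<epsilon> n = (SOME f. is_baby_state \<epsilon> n f)"

definition baby_inner :: "(nat \<Rightarrow> nat \<Rightarrow> real) \<Rightarrow> nat \<Rightarrow> nat free_alg \<Rightarrow> nat free_alg \<Rightarrow> complex" where
  "baby_inner \<epsilon> n a b = baby_state \<epsilon> n (star b * a)"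

text \<open>
  The \<open>2\<^sup>n\<close> vertices \<open>r \<in> {0,1}\<^sup>n\<close> of the cube are numbered by binary expansion
  (\<open>r\<^sub>i\<close> is the bit of weight \<open>2\<^sup>i\<^sup>-\<^sup>1\<close>), and with them the orthonormal basis \<open>x\<^sub>A\<close>,
  \<open>A = {i. r\<^sub>i = 1}\<close>, of \<open>H = L\<^sup>2(\<A>(I,\<epsilon>), \<phi>\<^sup>\<epsilon>)\<close>. Operators on the \<open>2\<^sup>n\<close>-dimensional space \<open>H\<close>
  are identified with their matrices in this basis.
\<close>

definition cube :: "nat \<Rightarrow> (nat \<Rightarrow> nat) set" where
  "cube n = ({1..n} \<rightarrow>\<^sub>E {0, 1})"

definition vertex :: "nat \<Rightarrow> nat \<Rightarrow> nat \<Rightarrow> nat" where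
  "vertex n a = (\<lambda>i\<in>{1..n}. (a div 2 ^ (i - 1)) mod 2)"

definition vertex_set :: "nat \<Rightarrow> (nat \<Rightarrow> nat) \<Rightarrow> nat set" where
  "vertex_set n r = {i \<in> {1..n}. r i = 1}"

definition delta_vec :: "nat \<Rightarrow> (nat \<Rightarrow> nat) \<Rightarrow> complex vec" where
  "delta_vec n r = Matrix.vec (2 ^ n) (\<lambda>a. if vertex n a = r then 1 else 0)"

definition origin :: "nat \<Rightarrow> nat \<Rightarrow> nat" where
  "origin n = (\<lambda>i\<in>{1..n}. 0)"

text \<open>The matrix of left multiplication by \<open>x\<^sub>i\<close> in the orthonormal basis \<open>x\<^sub>A\<close>:
  its \<open>(A,B)\<close> entry is \<open>\<langle>x\<^sub>i x\<^sub>B, x\<^sub>A\<rangle>\<close>.\<close>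

definition gamma :: "(nat \<Rightarrow> nat \<Rightarrow> real) \<Rightarrow> nat \<Rightarrow> nat \<Rightarrow> complex mat" where
  "gamma \<epsilon> n i = Matrix.mat (2 ^ n) (2 ^ n) (\<lambda>(a, b).
     baby_inner \<epsilon> n (gen i * x_set (vertex_set n (vertex n b))) (x_set (vertex_set n (vertex n a))))"

text \<open>\<open>\<tau>(T) = \<langle>T 1, 1\<rangle>\<close>; the unit \<open>1 = x\<^sub>\<emptyset>\<close> corresponds to the vertex \<open>(0,\<dots>,0)\<close>.\<close>

definition tau :: "nat \<Rightarrow> complex mat \<Rightarrow> complex" where
  "tau n T = (T *\<^sub>v delta_vec n (origin n)) \<bullet>c delta_vec n (origin n)"

definition poly_mat :: "complex poly \<Rightarrow> complex mat \<Rightarrow> complex mat" where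
  "poly_mat Q M = Matrix.mat (dim_row M) (dim_row M)
     (\<lambda>(a, b). \<Sum>i\<le>Polynomial.degree Q. Polynomial.coeff Q i * (M ^\<^sub>m i) $$ (a, b))"

text \<open>Functional calculus of a Hermitian matrix, through a unitary diagonalization (the result
  does not depend on the diagonalization chosen).\<close>

definition herm_fun :: "(real \<Rightarrow> real) \<Rightarrow> complex mat \<Rightarrow> complex mat" where
  "herm_fun f S = (THE M. \<exists>U d. let N = dim_row S; D = (\<lambda>g. mat_diag N (\<lambda>i. complex_of_real (g (d i)))) in
      U \<in> carrier_mat N N \<and> mat_adjoint U * U = 1\<^sub>m N \<and>
      S = U * D (\<lambda>x. x) * mat_adjoint U \<and> M = U * D f * mat_adjoint U)"

definition abs_mat :: "complex mat \<Rightarrow> complex mat" where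
  "abs_mat T = herm_fun sqrt (mat_adjoint T * T)"

definition p_norm :: "nat \<Rightarrow> real \<Rightarrow> complex mat \<Rightarrow> real" where
  "p_norm n p T = Re (tau n (herm_fun (\<lambda>x. x powr p) (abs_mat T))) powr (1 / p)"


section \<open>The operators \<open>X\<^sub>n\<^sub>,\<^sub>k\<close> and \<open>Y\<^sub>n\<^sub>,\<^sub>k\<close>\<close>

definition q_number :: "real \<Rightarrow> nat \<Rightarrow> real" where
  "q_number q k = (if q = 1 then real k else (1 - q ^ k) / (1 - q))"

definition tuples :: "nat \<Rightarrow> nat \<Rightarrow> nat list set" where
  "tuples n k = {is. length is = k \<and> distinct is \<and> set is \<subseteq> {1..n}}"

definition gamma_prod :: "(nat \<Rightarrow> nat \<Rightarrow> real) \<Rightarrow> nat \<Rightarrow> nat list \<Rightarrow> complex mat" where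
  "gamma_prod \<epsilon> n is = foldr (\<lambda>i M. gamma \<epsilon> n i * M) is (1\<^sub>m (2 ^ n))"

definition weighted_sum ::
    "(nat \<Rightarrow> nat \<Rightarrow> real) \<Rightarrow> nat \<Rightarrow> nat \<Rightarrow> (nat list \<Rightarrow> real) \<Rightarrow> complex mat" where
  "weighted_sum \<epsilon> n k c = Matrix.mat (2 ^ n) (2 ^ n) (\<lambda>(a, b).
     complex_of_real (1 / real n powr (real k / 2)) *
       (\<Sum>is\<in>tuples n k. complex_of_real (c is) * gamma_prod \<epsilon> n is $$ (a, b)))"

definition X_op :: "(nat \<Rightarrow> nat \<Rightarrow> real) \<Rightarrow> nat \<Rightarrow> nat \<Rightarrow> complex mat" where
  "X_op \<epsilon> n k = weighted_sum \<epsilon> n k (\<lambda>_. 1)"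

text \<open>The summand with index \<open>j\<close> is the product of \<open>\<epsilon>\<^bsub>i,l\<^esub>\<close> over \<open>l = i\<^sub>j\<^sub>+\<^sub>1, \<dots>, i\<^sub>k\<close>.\<close>

definition Z_coeff :: "(nat \<Rightarrow> nat \<Rightarrow> real) \<Rightarrow> nat \<Rightarrow> nat list \<Rightarrow> real" where
  "Z_coeff \<epsilon> n is = 1 / real n *
     (\<Sum>i\<in>{1..n} - set is. \<Sum>j\<le>length is. prod_list (map (\<epsilon> i) (drop j is)))"

text \<open>Meaningful only if \<open>[k+1]\<^sub>q \<noteq> 0\<close>, which fails precisely for \<open>q = -1\<close> and odd \<open>k\<close>.\<close>

definition Y_op :: "(nat \<Rightarrow> nat \<Rightarrow> real) \<Rightarrow> real \<Rightarrow> nat \<Rightarrow> nat \<Rightarrow> complex mat" where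
  "Y_op \<epsilon> q n k = weighted_sum \<epsilon> n k (\<lambda>is. inverse (q_number q (k + 1)) * Z_coeff \<epsilon> n is)"

fun q_hermite :: "real \<Rightarrow> nat \<Rightarrow> real poly" where
  "q_hermite q 0 = 1"
| "q_hermite q (Suc 0) = [:0, 1:]"
| "q_hermite q (Suc (Suc k)) =
     [:0, 1:] * q_hermite q (Suc k) - Polynomial.smult (q_number q (Suc k)) (q_hermite q k)"


section \<open>The \<open>q\<close>-gaussian variable\<close>

text \<open>
  Let \<open>'h\<close> be the real Hilbert space \<open>H\<^sub>\<real>\<close>. The word \<open>[f\<^sub>1, \<dots>, f\<^sub>m]\<close> stands for the simple tensor
  \<open>f\<^sub>1 \<otimes> \<dots> \<otimes> f\<^sub>m\<close>, and complex combinations of such words represent the vectors of the algebraic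
  \<open>q\<close>-Fock space over the complexification of \<open>H\<^sub>\<real>\<close>: different combinations representing the same
  vector differ by an element of the kernel of \<open>\<langle>\<cdot>,\<cdot>\<rangle>\<^sub>q\<close>. This dense subspace of the (completed)
  \<open>q\<close>-Fock space contains \<open>\<Omega>\<close> and is invariant under the creation operators and their adjoints, so
  that it carries the vacuum moments of the \<open>q\<close>-gaussian variable.
\<close>

definition simple_inner :: "'h::real_inner list \<Rightarrow> 'h list \<Rightarrow> real" where
  "simple_inner u v = (if length u = length v then \<Prod>k<length u. inner (u ! k) (v ! k) else 0)"

definition tensor_inner :: "'h::real_inner free_alg \<Rightarrow> 'h free_alg \<Rightarrow> complex" where
  "tensor_inner \<xi> \<eta> = (\<Sum>u\<in>Poly_Mapping.keys \<xi>. \<Sum>v\<in>Poly_Mapping.keys \<eta>.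
     Poly_Mapping.lookup \<xi> u * cnj (Poly_Mapping.lookup \<eta> v) * complex_of_real (simple_inner u v))"

definition inversions :: "nat \<Rightarrow> (nat \<Rightarrow> nat) \<Rightarrow> nat" where
  "inversions m \<pi> = card {(i, j). i < j \<and> j < m \<and> \<pi> j < \<pi> i}"

definition P_op :: "real \<Rightarrow> 'h free_alg \<Rightarrow> 'h free_alg" where
  "P_op q \<eta> = (\<Sum>w\<in>Poly_Mapping.keys \<eta>. \<Sum>\<pi> | \<pi> permutes {..<length w}.
     Poly_Mapping.single (permute_list \<pi> w)
       (complex_of_real (q ^ inversions (length w) \<pi>) * Poly_Mapping.lookup \<eta> w))"

definition fock_inner :: "real \<Rightarrow> 'h::real_inner free_alg \<Rightarrow> 'h free_alg \<Rightarrow> complex" where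
  "fock_inner q \<xi> \<eta> = tensor_inner \<xi> (P_op q \<eta>)"

definition vacuum :: "'h free_alg" where
  "vacuum = Poly_Mapping.single [] 1"

text \<open>Multiplication by \<open>h\<close> in the tensor algebra: \<open>f\<^sub>1 \<otimes> \<dots> \<otimes> f\<^sub>m \<mapsto> h \<otimes> f\<^sub>1 \<otimes> \<dots> \<otimes> f\<^sub>m\<close>.\<close>

definition creation :: "'h \<Rightarrow> 'h free_alg \<Rightarrow> 'h free_alg" where
  "creation h \<xi> = gen h * \<xi>"

text \<open>The adjoint \<open>\<ell>\<^sub>q(h)\<^sup>*\<close>: it exists, namely as the operator
  \<open>f\<^sub>1 \<otimes> \<dots> \<otimes> f\<^sub>m \<mapsto> \<Sum>\<^sub>j q\<^sup>j\<^sup>-\<^sup>1 \<langle>f\<^sub>j, h\<rangle> f\<^sub>1 \<otimes> \<dots> \<otimes> f\<^sub>j\<^sub>-\<^sub>1 \<otimes> f\<^sub>j\<^sub>+\<^sub>1 \<otimes> \<dots> \<otimes> f\<^sub>m\<close>, and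
  \<open>S \<eta>\<close> is determined up to the kernel of \<open>\<langle>\<cdot>,\<cdot>\<rangle>\<^sub>q\<close>, i.e. as a vector of the Fock space.\<close>

definition annihilation :: "real \<Rightarrow> 'h::real_inner \<Rightarrow> 'h free_alg \<Rightarrow> 'h free_alg" where
  "annihilation q h = (SOME S. \<forall>\<xi> \<eta>. fock_inner q (creation h \<xi>) \<eta> = fock_inner q \<xi> (S \<eta>))"

definition q_gaussian :: "real \<Rightarrow> 'h::real_inner \<Rightarrow> 'h free_alg \<Rightarrow> 'h free_alg" where
  "q_gaussian q h \<xi> = creation h \<xi> + annihilation q h \<xi>"

text \<open>\<open>\<tau>\<^sub>q(P(G\<^sub>q))\<close>, with \<open>G\<^sub>1\<close> standard normal and \<open>G\<^sub>-\<^sub>1\<close> uniform on \<open>{1,-1}\<close>.\<close>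

definition q_gaussian_moment :: "real \<Rightarrow> 'h::real_inner \<Rightarrow> complex poly \<Rightarrow> complex" where
  "q_gaussian_moment q h P =
    (if q = 1 then LINT x|density lborel (\<lambda>x. ennreal (std_normal_density x)). poly P (complex_of_real x)
     else if q = -1 then measure_pmf.expectation (pmf_of_set {1, -1 :: real}) (\<lambda>x. poly P (complex_of_real x))
     else \<Sum>i\<le>Polynomial.degree P. Polynomial.coeff P i * fock_inner q ((q_gaussian q h ^^ i) vacuum) vacuum)"

text \<open>\<open>\<tau>\<^sub>q(Q(H\<^sub>k\<^sup>q(G\<^sub>q)))\<close>\<close>

definition hermite_moment :: "real \<Rightarrow> 'h::real_inner \<Rightarrow> nat \<Rightarrow> complex poly \<Rightarrow> complex" where
  "hermite_moment q h k Q =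
     q_gaussian_moment q h (pcompose Q (map_poly complex_of_real (q_hermite q k)))"


section \<open>Weighted graphs on the distance graphs of the cube\<close>

definition distance_edges :: "nat \<Rightarrow> nat \<Rightarrow> (nat \<Rightarrow> nat) set set" where
  "distance_edges n k =
     {{r, s} | r s. r \<in> cube n \<and> s \<in> cube n \<and> card {i \<in> {1..n}. r i \<noteq> s i} = k}"

definition adjacency_mat ::
    "nat \<Rightarrow> (nat \<Rightarrow> nat) set set \<Rightarrow> ((nat \<Rightarrow> nat) set \<Rightarrow> real) \<Rightarrow> complex mat" where
  "adjacency_mat n E w = Matrix.mat (2 ^ n) (2 ^ n) (\<lambda>(a, b).
     if {vertex n a, vertex n b} \<in> E then complex_of_real (w {vertex n a, vertex n b}) else 0)"

definition is_weighted_graph_on :: "nat \<Rightarrow> (nat \<Rightarrow> nat) set set \<Rightarrow> complex mat \<Rightarrow> bool" where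
  "is_weighted_graph_on n E M \<longleftrightarrow> (\<exists>w. M = adjacency_mat n E w)"

end

theory Submission
  imports Defs "Jordan_Normal_Form.Spectral_Radius"
begin

text \<open>
  Write \<open>X\<^sub>k\<close>, \<open>Y\<^sub>k\<close> for the operators on \<open>n\<close> generators. Multiply \<open>X\<^sub>k\<close> by \<open>X\<^sub>1\<close> from the right and sort the
  terms by whether the new index occurs already. If it does not, the term belongs to \<open>X\<^sub>k\<^sub>+\<^sub>1\<close>; if
  it does, the two equal generators meet and cancel after the last one has been moved past the
  letters between them, and the signs picked up on the way are the summands of \<open>Z\<close>. This gives the exact identity
  \<open>X\<^sub>k X\<^sub>1 = X\<^sub>k\<^sub>+\<^sub>1 + [k]\<^sub>q Y\<^sub>k\<^sub>-\<^sub>1\<close> (\<open>X_op_mult_X_op_1\<close>), in which the last term is to be read as the sum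
  with the coefficients \<open>Z\<close> if \<open>[k]\<^sub>q = 0\<close>. Since \<open>Y\<^sub>k\<^sub>-\<^sub>1\<close> is close to \<open>X\<^sub>k\<^sub>-\<^sub>1\<close>, the \<open>X\<^sub>k\<close>
  satisfy the recursion of the \<open>q\<close>-Hermite polynomials in \<open>X\<^sub>1\<close> up to an error, so
  \<open>X\<^sub>k - H\<^sub>k(X\<^sub>1)\<close> tends to \<open>0\<close> (\<open>negligible_X_op_minus_hermite\<close>), and the moments of \<open>H\<^sub>k(X\<^sub>1)\<close> are
  moments of \<open>X\<^sub>1\<close>, which converge by assumption.

  What has to be shown is that errors which are small in the norm \<open>T \<mapsto> \<parallel>T 1\<parallel>\<close>, the noncommutative
  2-norm, stay small when they are multiplied by other operators. For this consider the sequences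
  \<open>T\<^sub>n\<close> of matrices with two properties. First, \<open>T\<^sub>n\<close> commutes with the right multiplications by
  the generators; this makes the vacuum state a trace (\<open>tau_trace\<close>). Secondly, the entries of \<open>T\<^sub>n\<close> are
  \<open>O(n\<^sup>-\<^sup>d\<^sup>/\<^sup>2)\<close> at Hamming distance \<open>d\<close> and vanish beyond a fixed distance; this property is stable under
  products (\<open>decays_mult\<close>), and it bounds \<open>\<tau>(T\<^sub>n)\<close>. These sequences form
  a \<open>*\<close>-algebra that contains all \<open>X\<^sub>k\<close> and \<open>Y\<^sub>k\<close>, and by Cauchy--Schwarz its elements with
  \<open>\<parallel>T\<^sub>n 1\<parallel> \<rightarrow> 0\<close> form a two-sided ideal (\<open>negligible_mult_left\<close>, \<open>negligible_mult_right\<close>). Therefore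
  \<open>X\<^sub>k\<close> and \<open>H\<^sub>k(X\<^sub>1)\<close>, which agree modulo the ideal, have asymptotically equal moments. That the
  errors are small in the 2-norm is the case \<open>p = 2\<close> of the assumption on \<open>X\<^sub>k - Y\<^sub>k\<close>.

  If \<open>q = -1\<close>, then \<open>[k]\<^sub>q = 0\<close> for even \<open>k\<close>, and the recursion argument breaks down. In this case the
  convergence of \<open>X\<^sub>1\<close> to a symmetric sign forces \<open>X\<^sub>2 = X\<^sub>1\<^sup>2 - 1\<close> into the ideal. The norm of \<open>X\<^sub>2\<close>
  counts the commuting pairs of generators, so almost all pairs anticommute, and the antisymmetry
  of the products of generators makes all \<open>X\<^sub>k\<close> with \<open>k \<ge> 2\<close> negligible. The polynomials \<open>H\<^sub>k\<close> with
  \<open>k \<ge> 2\<close> are multiples of \<open>H\<^sub>2\<close>, so \<open>H\<^sub>k(X\<^sub>1)\<close> is negligible as well.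

  Finally, \<open>\<gamma>\<^sub>i\<close> maps a basis vector \<open>x\<^sub>B\<close> to \<open>\<plusminus>x\<^sub>B\<^sub>'\<close> with \<open>B'\<close> the symmetric difference of \<open>B\<close> and
  \<open>{i}\<close>. Hence the matrix of \<open>X\<^sub>k\<close> is real, symmetric and supported on the pairs of vertices at
  distance exactly \<open>k\<close>: it is the adjacency matrix of a weighted graph.
\<close>

section \<open>Functional calculus of Hermitian matrices\<close>

lemma mat_adjoint_carrier [simp]:
  "A \<in> carrier_mat n m \<Longrightarrow> mat_adjoint A \<in> carrier_mat m n"
  by (auto simp: mat_adjoint_def)

lemma mat_adjoint_dims [simp]:
  "dim_row (mat_adjoint A) = dim_col A" "dim_col (mat_adjoint A) = dim_row A"
  by (auto simp: mat_adjoint_def)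

lemma mat_adjoint_index [simp]:
  fixes A :: "complex mat"
  shows "i < dim_col A \<Longrightarrow> j < dim_row A \<Longrightarrow> mat_adjoint A $$ (i, j) = cnj (A $$ (j, i))"
  by (auto simp: mat_adjoint_def mat_of_rows_def)

lemma mult_index_sum:
  assumes "A \<in> carrier_mat n m" "B \<in> carrier_mat m l" "i < n" "j < l"
  shows "(A * B) $$ (i, j) = (\<Sum>k<m. A $$ (i, k) * B $$ (k, j))"
  using assms by (auto simp: scalar_prod_def lessThan_atLeast0 intro!: sum.cong)

lemma mat_adjoint_mult:
  fixes A B :: "complex mat"
  assumes "A \<in> carrier_mat n m" "B \<in> carrier_mat m l"
  shows "mat_adjoint (A * B) = mat_adjoint B * mat_adjoint A"
proof (rule eq_matI, goal_cases)
  case (1 i j)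
  then have ij: "i < l" "j < n" using assms by auto
  have "mat_adjoint (A * B) $$ (i, j) = cnj ((A * B) $$ (j, i))"
    using assms ij by auto
  also have "\<dots> = (\<Sum>k<m. cnj (A $$ (j, k)) * cnj (B $$ (k, i)))"
    using mult_index_sum[OF assms] ij by simp
  also have "\<dots> = (mat_adjoint B * mat_adjoint A) $$ (i, j)"
    using mult_index_sum[of "mat_adjoint B" l m "mat_adjoint A" n i j] assms ij
    by (simp add: mult.commute)
  finally show ?case .
qed (use assms in auto)

lemma mat_adjoint_adjoint [simp]: "mat_adjoint (mat_adjoint A) = (A :: complex mat)"
  by (rule eq_matI) auto

lemma mat_adjoint_one [simp]: "mat_adjoint (1\<^sub>m n) = (1\<^sub>m n :: complex mat)"
  by (rule eq_matI) auto

definition real_diag :: "nat \<Rightarrow> (nat \<Rightarrow> real) \<Rightarrow> complex mat" where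
  "real_diag n d = mat_diag n (\<lambda>i. complex_of_real (d i))"

lemma real_diag_carrier [simp]: "real_diag n d \<in> carrier_mat n n"
  by (simp add: real_diag_def mat_diag_def)

lemma real_diag_index:
  "i < n \<Longrightarrow> j < n \<Longrightarrow> real_diag n d $$ (i, j) = (if i = j then complex_of_real (d j) else 0)"
  by (auto simp: real_diag_def mat_diag_def)

text \<open>
  Gram--Schmidt turns a basis that starts with \<open>v\<close> into an orthogonal one without changing its
  first vector; what is left is to normalize the columns.
\<close>

lemma unitary_first_column:
  fixes v :: "complex vec"
  assumes v: "v \<in> carrier_vec n" and v0: "v \<noteq> 0\<^sub>v n" and n: "n > 0"
  obtains W c where "W \<in> carrier_mat n n" "mat_adjoint W * W = 1\<^sub>m n" "col W 0 = c \<cdot>\<^sub>v v"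
proof -
  interpret cof_vec_space n "TYPE(complex)" .
  define b where "b = basis_completion v"
  define ws where "ws = gram_schmidt n b"
  define W0 where "W0 = mat_of_cols n ws"
  from basis_completion[OF v v0, folded b_def]
  have dist_b: "distinct b" and indep: "\<not> lin_dep (set b)" and b: "set b \<subseteq> carrier_vec n"
    and hdb: "hd b = v" and len_b: "length b = n" by auto
  from hdb len_b n obtain vs where bv: "b = v # vs" by (cases b, auto)
  from gram_schmidt_result[OF b dist_b indep refl, folded ws_def]
  have ws: "set ws \<subseteq> carrier_vec n" "corthogonal ws" "length ws = n"
    by (auto simp: len_b)
  from gram_schmidt_hd[OF v, of vs, folded bv] have hdws: "hd ws = v" unfolding ws_def .
  have orth: "corthogonal_mat W0" using orthogonal_mat_of_cols ws unfolding W0_def by blast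
  have W0: "W0 \<in> carrier_mat n n"
    using ws unfolding W0_def using mat_of_cols_carrier(1)[of n ws] by auto
  have W0col: "col W0 0 = v"
    using hdws ws n unfolding W0_def by (metis col_mat_of_cols hd_conv_nth list.size(3) nth_mem subsetD not_less0)
  define s where "s j = (\<Sum>k<n. (cmod (W0 $$ (k, j)))\<^sup>2)" for j
  have inner: "(\<Sum>k<n. cnj (W0 $$ (k, i)) * W0 $$ (k, j)) = (if i = j then complex_of_real (s j) else 0)"
    "s j > 0" if "i < n" "j < n" for i j
  proof -
    have ip: "col W0 j' \<bullet>c col W0 i' = (\<Sum>k<n. cnj (W0 $$ (k, i')) * W0 $$ (k, j'))"
      if "i' < n" "j' < n" for i' j'
      using W0 that by (auto simp: scalar_prod_def lessThan_atLeast0 mult.commute intro!: sum.cong)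
    have eq: "(\<Sum>k<n. cnj (W0 $$ (k, j)) * W0 $$ (k, j)) = complex_of_real (s j)"
      by (simp add: s_def complex_norm_square mult.commute del: of_real_power)
    show "(\<Sum>k<n. cnj (W0 $$ (k, i)) * W0 $$ (k, j)) = (if i = j then complex_of_real (s j) else 0)"
      using corthogonal_matD[OF orth, of j i] W0 that ip[of i j] eq by auto
    have "s j \<noteq> 0"
      using corthogonal_matD[OF orth, of j j] W0 that ip[of j j] eq by auto
    moreover have "s j \<ge> 0" by (simp add: s_def sum_nonneg)
    ultimately show "s j > 0" by simp
  qed
  \<comment> \<open>the Gram--Schmidt columns are orthogonal, with squared norms \<open>s\<close>\<close>
  define W where "W = Matrix.mat n n (\<lambda>(k, j). W0 $$ (k, j) / complex_of_real (sqrt (s j)))"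
  have W: "W \<in> carrier_mat n n" by (simp add: W_def)
  have "mat_adjoint W * W = 1\<^sub>m n"
  proof (rule eq_matI, goal_cases)
    case (1 i j)
    then have ij: "i < n" "j < n" by auto
    have "(mat_adjoint W * W) $$ (i, j) = (\<Sum>k<n. cnj (W $$ (k, i)) * W $$ (k, j))"
      using mult_index_sum[of "mat_adjoint W" n n W n i j] W ij by simp
    also have "\<dots> = (\<Sum>k<n. cnj (W0 $$ (k, i)) * W0 $$ (k, j))
        / (complex_of_real (sqrt (s i)) * complex_of_real (sqrt (s j)))"
      using ij by (simp add: W_def sum_divide_distrib)
    also have "\<dots> = (if i = j then 1 else 0)"
      using inner[of i j] ij by (auto simp flip: of_real_mult)
    finally show ?case using ij by simp
  qed (use W in auto)
  moreover have "col W 0 = (1 / complex_of_real (sqrt (s 0))) \<cdot>\<^sub>v v"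
    unfolding W0col[symmetric] using W0 n by (intro eq_vecI) (auto simp: W_def)
  ultimately show ?thesis using that W by blast
qed

lemma mat_adjoint_four_block:
  fixes A B :: "complex mat"
  assumes "A \<in> carrier_mat 1 1" "B \<in> carrier_mat m m"
  shows "mat_adjoint (four_block_mat A (0\<^sub>m 1 m) (0\<^sub>m m 1) B)
    = four_block_mat (mat_adjoint A) (0\<^sub>m 1 m) (0\<^sub>m m 1) (mat_adjoint B)"
  using assms by (intro eq_matI) auto

lemma mult_diag_blocks:
  fixes A B C D :: "complex mat"
  assumes "A \<in> carrier_mat 1 1" "B \<in> carrier_mat m m" "C \<in> carrier_mat 1 1" "D \<in> carrier_mat m m"
  shows "four_block_mat A (0\<^sub>m 1 m) (0\<^sub>m m 1) B * four_block_mat C (0\<^sub>m 1 m) (0\<^sub>m m 1) D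
    = four_block_mat (A * C) (0\<^sub>m 1 m) (0\<^sub>m m 1) (B * D)"
  using assms by (subst mult_four_block_mat[of _ 1 1 _ m _ m _ _ 1 _ m]) auto

text \<open>
  The spectral theorem, by deflation: in an orthonormal basis whose first vector is an eigenvector,
  a Hermitian matrix is block diagonal with a real number as its first block, and the second block is
  Hermitian of smaller size.
\<close>

theorem hermitian_diagonalization:
  fixes A :: "complex mat"
  assumes "A \<in> carrier_mat n n" "mat_adjoint A = A"
  shows "\<exists>U d. U \<in> carrier_mat n n \<and> mat_adjoint U * U = 1\<^sub>m n \<and> A = U * real_diag n d * mat_adjoint U"
  using assms
proof (induction n arbitrary: A)
  case 0
  then show ?case by (intro exI[of _ "1\<^sub>m 0"] exI) (auto intro!: eq_matI)
next
  case (Suc m)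
  let ?n = "Suc m"
  note A = Suc.prems(1) and herm = Suc.prems(2)
  obtain e v where ev: "eigenvector A v e"
    using spectrum_non_empty[OF A] unfolding spectrum_def eigenvalue_def by auto
  then have v: "v \<in> carrier_vec ?n" "v \<noteq> 0\<^sub>v ?n" and Av: "A *\<^sub>v v = e \<cdot>\<^sub>v v"
    using A by (auto simp: eigenvector_def)
  obtain W c where W: "W \<in> carrier_mat ?n ?n" and WW: "mat_adjoint W * W = 1\<^sub>m ?n"
    and W0: "col W 0 = c \<cdot>\<^sub>v v"
    using unitary_first_column[OF v] by auto
  have WW': "W * mat_adjoint W = 1\<^sub>m ?n"
    using mat_mult_left_right_inverse[OF _ W WW] W by auto
  define B where "B = mat_adjoint W * (A * W)"
  have B: "B \<in> carrier_mat ?n ?n" using W A unfolding B_def by auto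
  have Bherm: "mat_adjoint B = B"
    unfolding B_def using W A herm
    by (simp add: mat_adjoint_mult[of _ ?n ?n _ ?n] assoc_mult_mat[of _ ?n ?n _ ?n _ ?n])
  have AW: "A = W * B * mat_adjoint W"
  proof -
    have "W * B * mat_adjoint W = (W * mat_adjoint W) * A * (W * mat_adjoint W)"
      unfolding B_def using W A by (simp add: assoc_mult_mat[of _ ?n ?n _ ?n _ ?n] mult_carrier_mat[of _ ?n ?n])
    then show ?thesis using A by (simp add: WW')
  qed
  have B0: "B $$ (i, 0) = (if i = 0 then e else 0)" if i: "i < ?n" for i
  proof -
    have col: "col (A * W) 0 = e \<cdot>\<^sub>v col W 0"
    proof -
      have "col (A * W) 0 = A *\<^sub>v col W 0" using A W by auto
      also have "\<dots> = e \<cdot>\<^sub>v col W 0"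
        unfolding W0 using A v Av by (simp add: mult_mat_vec[of _ ?n ?n] smult_smult_assoc mult.commute)
      finally show ?thesis .
    qed
    have "B $$ (i, 0) = row (mat_adjoint W) i \<bullet> (e \<cdot>\<^sub>v col W 0)"
      unfolding B_def using A W i by (simp add: col[symmetric])
    also have "\<dots> = e * (row (mat_adjoint W) i \<bullet> col W 0)"
      using W i by (intro scalar_prod_smult_distrib[of _ ?n]) (auto simp: row_def intro!: carrier_vecI)
    also have "row (mat_adjoint W) i \<bullet> col W 0 = (mat_adjoint W * W) $$ (i, 0)"
      using W i by auto
    finally show ?thesis using i by (simp add: WW)
  qed
  have B0': "B $$ (0, j) = cnj (B $$ (j, 0))" if "j < ?n" for j
    using mat_adjoint_index[of 0 B j] B that by (simp add: Bherm)
  have e_real: "e = complex_of_real (Re e)"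
    using B0'[of 0] B0[of 0] by (simp add: complex_eq_iff)
  define B3 where "B3 = Matrix.mat m m (\<lambda>(i, j). B $$ (Suc i, Suc j))"
  have B3: "B3 \<in> carrier_mat m m" by (simp add: B3_def)
  have "mat_adjoint B3 = B3"
  proof (rule eq_matI, goal_cases)
    case (1 i j)
    then have "i < m" "j < m" using B3 by auto
    then show ?case using mat_adjoint_index[of "Suc i" B "Suc j"] B by (simp add: B3_def Bherm)
  qed (use B3 in auto)
  from Suc.IH[OF B3 this] obtain U3 d3 where U3: "U3 \<in> carrier_mat m m"
    and UU3: "mat_adjoint U3 * U3 = 1\<^sub>m m" and B3eq: "B3 = U3 * real_diag m d3 * mat_adjoint U3"
    by auto
  define V where "V = four_block_mat (1\<^sub>m 1) (0\<^sub>m 1 m) (0\<^sub>m m 1) U3"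
  define d where "d i = (case i of 0 \<Rightarrow> Re e | Suc i \<Rightarrow> d3 i)" for i
  have V: "V \<in> carrier_mat ?n ?n" unfolding V_def using four_block_carrier_mat[OF _ U3, of "1\<^sub>m 1" 1 1] by simp
  have Vadj: "mat_adjoint V = four_block_mat (1\<^sub>m 1) (0\<^sub>m 1 m) (0\<^sub>m m 1) (mat_adjoint U3)"
    unfolding V_def using mat_adjoint_four_block[OF one_carrier_mat[of 1] U3] by (simp only: mat_adjoint_one)
  have VV: "mat_adjoint V * V = 1\<^sub>m ?n"
    unfolding Vadj unfolding V_def
    using mult_diag_blocks[OF one_carrier_mat[of 1] _ one_carrier_mat[of 1] U3, of "mat_adjoint U3"] U3
    by (auto simp: UU3 simp del: One_nat_def intro!: eq_matI)
  have D: "real_diag ?n d = four_block_mat (real_diag 1 (\<lambda>_. Re e)) (0\<^sub>m 1 m) (0\<^sub>m m 1) (real_diag m d3)"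
    by (intro eq_matI) (auto simp: real_diag_def mat_diag_def d_def split: nat.splits)
  have Bblock: "B = four_block_mat (real_diag 1 (\<lambda>_. Re e)) (0\<^sub>m 1 m) (0\<^sub>m m 1) B3"
  proof (rule eq_matI, goal_cases)
    case (1 i j)
    then show ?case
      using B3 B0[of i] B0'[of j] B0[of j] e_real
      by (cases i; cases j) (auto simp: real_diag_def mat_diag_def B3_def)
  qed (use B B3 in \<open>auto simp: real_diag_def mat_diag_def\<close>)
  have BV: "B = V * real_diag ?n d * mat_adjoint V"
    unfolding Bblock D Vadj unfolding V_def using U3
    by (simp add: mult_diag_blocks[where m = m] B3eq mult_carrier_mat[of _ m m]
      left_mult_one_mat[of _ 1 1] right_mult_one_mat[of _ 1 1] del: One_nat_def)
  show ?case
  proof (intro exI conjI)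
    show "W * V \<in> carrier_mat ?n ?n" using W V by auto
    have adj: "mat_adjoint (W * V) = mat_adjoint V * mat_adjoint W"
      using W V by (rule mat_adjoint_mult)
    have "mat_adjoint (W * V) * (W * V) = mat_adjoint V * (mat_adjoint W * W) * V"
      unfolding adj using W V by (simp add: assoc_mult_mat[of _ ?n ?n _ ?n _ ?n] mult_carrier_mat[of _ ?n ?n _ ?n])
    then show "mat_adjoint (W * V) * (W * V) = 1\<^sub>m ?n"
      using V by (simp add: WW VV right_mult_one_mat[of _ ?n ?n])
    show "A = W * V * real_diag ?n d * mat_adjoint (W * V)"
      unfolding adj by (subst AW, subst BV)
        (use W V in \<open>simp add: assoc_mult_mat[of _ ?n ?n _ ?n _ ?n] mult_carrier_mat[of _ ?n ?n]\<close>)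
  qed
qed

lemma unitary_right_inverse:
  fixes U :: "complex mat"
  assumes "U \<in> carrier_mat n n" "mat_adjoint U * U = 1\<^sub>m n"
  shows "U * mat_adjoint U = 1\<^sub>m n"
  using mat_mult_left_right_inverse[OF _ assms(1,2)] assms(1) by simp

text \<open>
  The unitary \<open>W = V\<^sup>* U\<close> intertwines the two diagonal matrices, so that \<open>W\<^sub>i\<^sub>j \<noteq> 0\<close> forces \<open>d\<^sub>j = e\<^sub>i\<close>.
  Hence \<open>W\<close> also intertwines their images under \<open>f\<close>.
\<close>

lemma diagonalization_functional_calculus_unique:
  assumes U: "U \<in> carrier_mat n n" "mat_adjoint U * U = 1\<^sub>m n"
    and V: "V \<in> carrier_mat n n" "mat_adjoint V * V = 1\<^sub>m n"
    and eq: "U * real_diag n d * mat_adjoint U = V * real_diag n e * mat_adjoint V"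
  shows "U * real_diag n (\<lambda>i. f (d i)) * mat_adjoint U = V * real_diag n (\<lambda>i. f (e i)) * mat_adjoint V"
proof -
  note assoc = assoc_mult_mat[of _ n n _ n _ n] mult_carrier_mat[of _ n n _ n]
  define W where "W = mat_adjoint V * U"
  have W: "W \<in> carrier_mat n n" using U V by (auto simp: W_def)
  have "W * real_diag n d = mat_adjoint V * (U * real_diag n d * mat_adjoint U) * U"
    using U V by (simp add: W_def assoc right_mult_one_mat[of _ n n])
  also have "\<dots> = (mat_adjoint V * V) * real_diag n e * W"
    unfolding eq using V(1) U(1) by (simp add: W_def assoc)
  also have "\<dots> = real_diag n e * W" using V by (simp add: left_mult_one_mat[of _ n n])
  finally have comm: "W * real_diag n d = real_diag n e * W" .
  have entry: "(W * real_diag n d') $$ (i, j) = W $$ (i, j) * complex_of_real (d' j)"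
    "(real_diag n d' * W) $$ (i, j) = complex_of_real (d' i) * W $$ (i, j)"
    if "i < n" "j < n" for i j d'
    using that W mult_index_sum[of W n n "real_diag n d'" n i j] mult_index_sum[of "real_diag n d'" n n W n i j]
    by (simp_all add: real_diag_index if_distrib[of "(*) _"] if_distrib[of "\<lambda>x. x * _"] cong: if_cong)
  have "W * real_diag n (\<lambda>i. f (d i)) = real_diag n (\<lambda>i. f (e i)) * W"
  proof (rule eq_matI, goal_cases)
    case (1 i j)
    then have ij: "i < n" "j < n" using W by (auto simp: real_diag_def mat_diag_def)
    have "W $$ (i, j) * complex_of_real (d j) = complex_of_real (e i) * W $$ (i, j)"
      using arg_cong[OF comm, of "\<lambda>M. M $$ (i, j)"] by (simp only: entry[OF ij])
    then have "W $$ (i, j) = 0 \<or> d j = e i" by auto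
    then show ?case unfolding entry[OF ij] by auto
  qed (use W in \<open>auto simp: real_diag_def mat_diag_def\<close>)
  then have "V * (W * real_diag n (\<lambda>i. f (d i))) * mat_adjoint U
      = V * (real_diag n (\<lambda>i. f (e i)) * W) * mat_adjoint U" by simp
  then have "(V * mat_adjoint V) * (U * real_diag n (\<lambda>i. f (d i)) * mat_adjoint U)
      = V * real_diag n (\<lambda>i. f (e i)) * mat_adjoint V * (U * mat_adjoint U)"
    using U V by (simp add: W_def assoc)
  then show ?thesis
    using U V by (simp add: unitary_right_inverse[of _ n] assoc left_mult_one_mat[of _ n n] right_mult_one_mat[of _ n n])
qed

lemma herm_fun_diagonalized:
  assumes U: "U \<in> carrier_mat n n" "mat_adjoint U * U = 1\<^sub>m n"
  shows "herm_fun f (U * real_diag n d * mat_adjoint U) = U * real_diag n (\<lambda>i. f (d i)) * mat_adjoint U"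
proof -
  have dim: "dim_row (U * real_diag n d * mat_adjoint U) = n" using U by simp
  show ?thesis
    unfolding herm_fun_def Let_def dim real_diag_def[symmetric]
  proof (rule the_equality, goal_cases)
    case 1
    then show ?case using U by blast
  next
    case (2 M)
    then obtain V e where "V \<in> carrier_mat n n" "mat_adjoint V * V = 1\<^sub>m n"
      "U * real_diag n d * mat_adjoint U = V * real_diag n e * mat_adjoint V"
      "M = V * real_diag n (\<lambda>i. f (e i)) * mat_adjoint V" by blast
    then show ?case using diagonalization_functional_calculus_unique[OF U, of V d e f] by simp
  qed
qed

text \<open>
  The functional calculus is multiplicative in the function, and \<open>(\<surd>x)\<^sup>2 = x\<close> on the eigenvalues of
  \<open>T\<^sup>* T\<close>, which are nonnegative.
\<close>

lemma square_abs_mat: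
  assumes T: "T \<in> carrier_mat n n"
  shows "herm_fun (\<lambda>x. x powr 2) (abs_mat T) = mat_adjoint T * T"
proof -
  note assoc = assoc_mult_mat[of _ n n _ n _ n] mult_carrier_mat[of _ n n _ n]
  have S: "mat_adjoint T * T \<in> carrier_mat n n" "mat_adjoint (mat_adjoint T * T) = mat_adjoint T * T"
    using T by (auto simp: mat_adjoint_mult[of _ n n _ n])
  obtain U d where U: "U \<in> carrier_mat n n" "mat_adjoint U * U = 1\<^sub>m n"
    and eq: "mat_adjoint T * T = U * real_diag n d * mat_adjoint U"
    using hermitian_diagonalization[OF S] by blast
  have nonneg: "d i \<ge> 0" if i: "i < n" for i
  proof -
    define R where "R = T * U"
    have R: "R \<in> carrier_mat n n" using T U by (simp add: R_def)
    have "mat_adjoint R * R = mat_adjoint U * (mat_adjoint T * T) * U"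
      using T U by (simp add: R_def mat_adjoint_mult[of _ n n _ n] assoc)
    also have "\<dots> = (mat_adjoint U * U) * real_diag n d * (mat_adjoint U * U)"
      unfolding eq using U(1) by (simp add: assoc)
    also have "\<dots> = real_diag n d"
      by (simp add: U left_mult_one_mat[of _ n n] right_mult_one_mat[of _ n n])
    finally have "complex_of_real (d i) = (mat_adjoint R * R) $$ (i, i)"
      using i by (simp add: real_diag_index)
    also have "\<dots> = (\<Sum>k<n. cnj (R $$ (k, i)) * R $$ (k, i))"
      using mult_index_sum[of "mat_adjoint R" n n R n i i] R i by simp
    also have "\<dots> = complex_of_real (\<Sum>k<n. (cmod (R $$ (k, i)))\<^sup>2)"
      by (simp add: complex_norm_square mult.commute del: of_real_power)
    finally have "d i = (\<Sum>k<n. (cmod (R $$ (k, i)))\<^sup>2)" using of_real_eq_iff by blast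
    then show ?thesis by (simp add: sum_nonneg)
  qed
  have "herm_fun (\<lambda>x. x powr 2) (abs_mat T) = U * real_diag n (\<lambda>i. sqrt (d i) powr 2) * mat_adjoint U"
    unfolding abs_mat_def eq herm_fun_diagonalized[OF U] ..
  also have "real_diag n (\<lambda>i. sqrt (d i) powr 2) = real_diag n d"
    using nonneg by (intro eq_matI) (auto simp: real_diag_def mat_diag_def powr_numeral)
  finally show ?thesis using eq by simp
qed

section \<open>Polynomials of a matrix\<close>

lemma poly_mat_carrier [simp]: "M \<in> carrier_mat N N \<Longrightarrow> poly_mat Q M \<in> carrier_mat N N"
  by (auto simp: poly_mat_def)

lemma poly_mat_dims [simp]: "dim_row (poly_mat Q M) = dim_row M" "dim_col (poly_mat Q M) = dim_row M"
  by (simp_all add: poly_mat_def)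

lemma poly_mat_index:
  assumes "M \<in> carrier_mat N N" "a < N" "b < N" "Polynomial.degree Q \<le> d"
  shows "poly_mat Q M $$ (a, b) = (\<Sum>i\<le>d. Polynomial.coeff Q i * (M ^\<^sub>m i) $$ (a, b))"
proof -
  have "poly_mat Q M $$ (a, b) = (\<Sum>i\<le>Polynomial.degree Q. Polynomial.coeff Q i * (M ^\<^sub>m i) $$ (a, b))"
    using assms by (auto simp: poly_mat_def)
  also have "\<dots> = (\<Sum>i\<le>d. Polynomial.coeff Q i * (M ^\<^sub>m i) $$ (a, b))"
    using assms(4) by (intro sum.mono_neutral_left) (auto simp: coeff_eq_0)
  finally show ?thesis .
qed

lemma poly_mat_zero: "M \<in> carrier_mat N N \<Longrightarrow> poly_mat 0 M = 0\<^sub>m N N"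
  by (rule eq_matI) (auto simp: poly_mat_def)

lemma poly_mat_add:
  assumes "M \<in> carrier_mat N N"
  shows "poly_mat (P + Q) M = poly_mat P M + poly_mat Q M"
proof (rule eq_matI, goal_cases)
  case (1 a b)
  then have ab: "a < N" "b < N" using assms poly_mat_carrier[OF assms, of Q] by auto
  let ?d = "max (Polynomial.degree P) (Polynomial.degree Q)"
  show ?case
    using ab carrier_matD[OF assms]
      poly_mat_index[OF assms ab, of P ?d] poly_mat_index[OF assms ab, of Q ?d]
      poly_mat_index[OF assms ab, of "P + Q" ?d] degree_add_le_max[of P Q]
    by (simp add: distrib_right sum.distrib)
qed (use assms poly_mat_carrier[OF assms, of Q] poly_mat_carrier[OF assms, of "P + Q"] in auto)

lemma poly_mat_smult:
  assumes "M \<in> carrier_mat N N"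
  shows "poly_mat (Polynomial.smult c P) M = c \<cdot>\<^sub>m poly_mat P M"
proof (rule eq_matI, goal_cases)
  case (1 a b)
  then have ab: "a < N" "b < N" using assms poly_mat_carrier[OF assms, of P] by auto
  show ?case
    using ab carrier_matD[OF assms] poly_mat_index[OF assms ab, of P "Polynomial.degree P"]
      poly_mat_index[OF assms ab, of "Polynomial.smult c P" "Polynomial.degree P"] degree_smult_le[of c P]
    by (simp add: sum_distrib_left mult.assoc)
qed (use assms poly_mat_carrier[OF assms, of P] poly_mat_carrier[OF assms, of "Polynomial.smult c P"] in auto)

lemma pow_mat_Suc_left:
  "M \<in> carrier_mat N N \<Longrightarrow> M ^\<^sub>m Suc i = M * M ^\<^sub>m i"
proof (induction i)
  case (Suc i)
  have "M ^\<^sub>m Suc (Suc i) = (M * M ^\<^sub>m i) * M" using Suc by simp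
  also have "\<dots> = M * M ^\<^sub>m Suc i"
    using Suc.prems pow_carrier_mat[OF Suc.prems, of i] by (simp add: assoc_mult_mat[of _ N N _ N _ N])
  finally show ?case .
qed (auto simp: left_mult_one_mat right_mult_one_mat)

lemma poly_mat_pCons:
  assumes M: "M \<in> carrier_mat N N"
  shows "poly_mat (pCons c P) M = c \<cdot>\<^sub>m 1\<^sub>m N + M * poly_mat P M"
proof (rule eq_matI, goal_cases)
  case (1 a b)
  then have ab: "a < N" "b < N" using assms poly_mat_carrier[OF assms, of P] by auto
  let ?d = "Polynomial.degree P"
  have "(M * poly_mat P M) $$ (a, b) = (\<Sum>k<N. M $$ (a, k) * (\<Sum>i\<le>?d. Polynomial.coeff P i * (M ^\<^sub>m i) $$ (k, b)))"
    using mult_index_sum[OF M poly_mat_carrier[OF M] ab] ab poly_mat_index[OF M, of _ b P ?d] by simp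
  also have "\<dots> = (\<Sum>i\<le>?d. Polynomial.coeff P i * (\<Sum>k<N. M $$ (a, k) * (M ^\<^sub>m i) $$ (k, b)))"
    unfolding sum_distrib_left by (subst sum.swap) (simp add: mult.left_commute)
  also have "\<dots> = (\<Sum>i\<le>?d. Polynomial.coeff P i * (M ^\<^sub>m Suc i) $$ (a, b))"
    using mult_index_sum[OF M pow_carrier_mat[OF M] ab] by (simp only: pow_mat_Suc_left[OF M])
  finally have *: "(M * poly_mat P M) $$ (a, b) = \<dots>" .
  have "poly_mat (pCons c P) M $$ (a, b)
      = (\<Sum>i\<le>Suc ?d. Polynomial.coeff (pCons c P) i * (M ^\<^sub>m i) $$ (a, b))"
    by (rule poly_mat_index[OF M ab]) (rule degree_pCons_le)
  also have "\<dots> = c * (1\<^sub>m N) $$ (a, b) + (\<Sum>i\<le>?d. Polynomial.coeff P i * (M ^\<^sub>m Suc i) $$ (a, b))"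
    using M by (subst sum.atMost_Suc_shift) simp
  finally show ?case
    using ab M * by (simp del: pow_mat.simps index_mult_mat(1))
qed (use assms poly_mat_carrier[OF assms, of P] poly_mat_carrier[OF assms, of "pCons c P"] in auto)

lemma poly_mat_mult:
  assumes M: "M \<in> carrier_mat N N"
  shows "poly_mat (P * Q) M = poly_mat P M * poly_mat Q M"
proof (induction P)
  case 0
  then show ?case using poly_mat_carrier[OF M, of Q] by (simp add: poly_mat_zero[OF M] left_mult_zero_mat)
next
  case (pCons c P)
  note carr = M poly_mat_carrier[OF M, of P] poly_mat_carrier[OF M, of Q]
  have "poly_mat (pCons c P * Q) M = c \<cdot>\<^sub>m poly_mat Q M + (0 \<cdot>\<^sub>m 1\<^sub>m N + M * (poly_mat P M * poly_mat Q M))"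
    by (simp add: mult_pCons_left poly_mat_add[OF M] poly_mat_smult[OF M] poly_mat_pCons[OF M] pCons.IH)
  also have "0 \<cdot>\<^sub>m 1\<^sub>m N + M * (poly_mat P M * poly_mat Q M) = M * (poly_mat P M * poly_mat Q M)"
    by (rule eq_matI) (use carr in auto)
  also have "c \<cdot>\<^sub>m poly_mat Q M + M * (poly_mat P M * poly_mat Q M)
      = (c \<cdot>\<^sub>m 1\<^sub>m N + M * poly_mat P M) * poly_mat Q M"
    using carr by (simp add: add_mult_distrib_mat[of _ N N _ _ N] mult_smult_assoc_mat[of _ N N _ N]
        left_mult_one_mat[of _ N N] assoc_mult_mat[of _ N N _ N _ N])
  finally show ?case by (simp add: poly_mat_pCons[OF M])
qed

text \<open>
  This turns moments of \<open>H\<^sub>k(X\<^sub>1)\<close> into moments of \<open>X\<^sub>1\<close>.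
\<close>

lemma poly_mat_pcompose:
  assumes M: "M \<in> carrier_mat N N"
  shows "poly_mat (pcompose P Q) M = poly_mat P (poly_mat Q M)"
proof (induction P)
  case 0
  then show ?case using poly_mat_carrier[OF M, of Q] by (simp add: poly_mat_zero[of _ N] M)
next
  case (pCons c P)
  note carr = M poly_mat_carrier[OF M, of Q]
  have "poly_mat [:c:] M = c \<cdot>\<^sub>m 1\<^sub>m N"
    using M by (subst poly_mat_pCons[OF M], subst poly_mat_zero[OF M]) (auto intro!: eq_matI)
  then show ?case
    using pCons.IH by (simp add: pcompose_pCons poly_mat_add[OF M] poly_mat_mult[OF M] poly_mat_pCons[of _ N] carr)
qed

lemma poly_mat_X: "M \<in> carrier_mat N N \<Longrightarrow> poly_mat [:0, 1:] M = M"
  and poly_mat_1: "M \<in> carrier_mat N N \<Longrightarrow> poly_mat 1 M = 1\<^sub>m N"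
proof -
  assume M: "M \<in> carrier_mat N N"
  have 1: "poly_mat [:c:] M = c \<cdot>\<^sub>m 1\<^sub>m N" for c
    using M by (subst poly_mat_pCons[OF M], subst poly_mat_zero[OF M]) (auto intro!: eq_matI)
  show "poly_mat 1 M = 1\<^sub>m N" using 1[of 1] by (auto simp: one_pCons intro!: eq_matI)
  show "poly_mat [:0, 1:] M = M"
    by (subst poly_mat_pCons[OF M], subst 1) (use M in \<open>auto intro!: eq_matI\<close>)
qed

section \<open>Signs of words in the generators\<close>

text \<open>
  The action of a generator on the basis, up to sign: \<open>x\<^sub>i x\<^sub>B = \<plusminus>x\<^sub>C\<close>, where \<open>C\<close> is the symmetric
  difference of \<open>B\<close> and \<open>{i}\<close>.
\<close>

definition toggle :: "nat \<Rightarrow> nat set \<Rightarrow> nat set" where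
  "toggle i B = (if i \<in> B then B - {i} else insert i B)"

text \<open>
  The sign in \<open>x\<^sub>i x\<^sub>B = \<plusminus>x\<^sub>C\<close>: to reach its place in the increasing product, \<open>x\<^sub>i\<close> has to pass the
  generators with smaller indices.
\<close>

definition left_sign :: "(nat \<Rightarrow> nat \<Rightarrow> real) \<Rightarrow> nat \<Rightarrow> nat set \<Rightarrow> real" where
  "left_sign \<epsilon> i B = (\<Prod>j\<in>{j\<in>B. j < i}. \<epsilon> i j)"

text \<open>
  The sign in \<open>x\<^sub>B x\<^sub>i = \<plusminus>x\<^sub>C\<close>, where \<open>x\<^sub>i\<close> passes the generators with larger indices.
\<close>

definition right_sign :: "(nat \<Rightarrow> nat \<Rightarrow> real) \<Rightarrow> nat \<Rightarrow> nat set \<Rightarrow> real" where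
  "right_sign \<epsilon> i B = (\<Prod>j\<in>{j\<in>B. i < j}. \<epsilon> i j)"

definition act :: "nat list \<Rightarrow> nat set \<Rightarrow> nat set" where
  "act w B = foldr toggle w B"

text \<open>
  The sign in \<open>x\<^sub>w x\<^sub>B = \<plusminus>x\<^sub>C\<close>, where the letters of \<open>w\<close> act from the last to the first.
\<close>

fun word_sign :: "(nat \<Rightarrow> nat \<Rightarrow> real) \<Rightarrow> nat list \<Rightarrow> nat set \<Rightarrow> real" where
  "word_sign \<epsilon> [] B = 1"
| "word_sign \<epsilon> (i # w) B = left_sign \<epsilon> i (act w B) * word_sign \<epsilon> w B"

lemma act_Nil [simp]: "act [] B = B"
  and act_Cons [simp]: "act (i # w) B = toggle i (act w B)"
  and act_append: "act (u @ v) B = act u (act v B)"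
  by (simp_all add: act_def)

lemma toggle_toggle [simp]: "toggle i (toggle i B) = B"
  by (auto simp: toggle_def)

lemma toggle_commute: "toggle i (toggle j B) = toggle j (toggle i B)"
  by (auto simp: toggle_def)

lemma toggle_subset: "i \<in> I \<Longrightarrow> B \<subseteq> I \<Longrightarrow> toggle i B \<subseteq> I"
  by (auto simp: toggle_def)

lemma act_subset: "set w \<subseteq> I \<Longrightarrow> B \<subseteq> I \<Longrightarrow> act w B \<subseteq> I"
  by (induction w) (auto simp: toggle_subset)

lemma act_toggle: "act w (toggle i B) = toggle i (act w B)"
  by (induction w) (auto simp: toggle_commute)

lemma act_rev_act [simp]: "act (rev w) (act w B) = B"
  by (induction w arbitrary: B) (auto simp: act_append)

lemma act_act_rev [simp]: "act w (act (rev w) B) = B"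
  using act_rev_act[of "rev w" B] by simp

lemma act_distinct: "distinct w \<Longrightarrow> act w {} = set w"
  by (induction w) (auto simp: toggle_def)

lemma word_sign_append: "word_sign \<epsilon> (u @ v) B = word_sign \<epsilon> u (act v B) * word_sign \<epsilon> v B"
  by (induction u) (auto simp: act_append)

lemma left_sign_toggle_self [simp]: "left_sign \<epsilon> i (toggle i B) = left_sign \<epsilon> i B"
  unfolding left_sign_def by (rule prod.cong) (auto simp: toggle_def)

locale signs =
  fixes \<epsilon> :: "nat \<Rightarrow> nat \<Rightarrow> real"
  assumes sign: "sign_function \<epsilon>"
begin

lemma eps_cases: "i \<ge> 1 \<Longrightarrow> j \<ge> 1 \<Longrightarrow> \<epsilon> i j = 1 \<or> \<epsilon> i j = -1"
  using sign unfolding sign_function_def by blast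

lemma eps_sq: "i \<ge> 1 \<Longrightarrow> j \<ge> 1 \<Longrightarrow> \<epsilon> i j * \<epsilon> i j = 1"
  using eps_cases[of i j] by auto

lemma eps_sym: "i \<ge> 1 \<Longrightarrow> j \<ge> 1 \<Longrightarrow> \<epsilon> i j = \<epsilon> j i"
  using sign unfolding sign_function_def by blast

lemma eps_diag: "i \<ge> 1 \<Longrightarrow> \<epsilon> i i = -1"
  using sign unfolding sign_function_def by blast

lemma prod_toggle:
  fixes f :: "nat \<Rightarrow> real"
  assumes "finite B" "f j * f j = 1" "P j"
  shows "prod f {k \<in> toggle j B. P k} = f j * prod f {k \<in> B. P k}"
proof (cases "j \<in> B")
  case True
  have fin: "finite {k \<in> B. P k}" using assms by auto
  have "prod f {k \<in> B. P k} = f j * prod f ({k \<in> B. P k} - {j})"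
    using True assms by (intro prod.remove) auto
  moreover have "{k \<in> toggle j B. P k} = {k \<in> B. P k} - {j}"
    using True by (auto simp: toggle_def)
  ultimately show ?thesis using assms(2) by (metis mult.assoc mult_1)
next
  case False
  then have "{k \<in> toggle j B. P k} = insert j {k \<in> B. P k}"
    using assms by (auto simp: toggle_def)
  then show ?thesis using False assms by (auto simp: prod.insert)
qed

lemma left_sign_toggle:
  assumes "finite B" "i \<ge> 1" "j \<ge> 1"
  shows "left_sign \<epsilon> i (toggle j B) = (if j < i then \<epsilon> i j else 1) * left_sign \<epsilon> i B"
proof (cases "j < i")
  case True
  then show ?thesis unfolding left_sign_def
    using prod_toggle[of B "\<epsilon> i" j "\<lambda>k. k < i"] assms eps_sq by auto
next
  case False
  then have "{k \<in> toggle j B. k < i} = {k \<in> B. k < i}" by (auto simp: toggle_def)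
  then show ?thesis using False by (simp add: left_sign_def)
qed

lemma right_sign_toggle:
  assumes "finite B" "i \<ge> 1" "j \<ge> 1"
  shows "right_sign \<epsilon> i (toggle j B) = (if i < j then \<epsilon> i j else 1) * right_sign \<epsilon> i B"
proof (cases "i < j")
  case True
  then show ?thesis unfolding right_sign_def
    using prod_toggle[of B "\<epsilon> i" j "\<lambda>k. i < k"] assms eps_sq by auto
next
  case False
  then have "{k \<in> toggle j B. i < k} = {k \<in> B. i < k}" by (auto simp: toggle_def)
  then show ?thesis using False by (simp add: right_sign_def)
qed

lemma left_sign_sq: "B \<subseteq> {1..} \<Longrightarrow> i \<ge> 1 \<Longrightarrow> left_sign \<epsilon> i B * left_sign \<epsilon> i B = 1"
  unfolding left_sign_def prod.distrib[symmetric] by (rule prod.neutral) (auto simp: eps_sq subset_eq)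

lemma right_sign_sq: "B \<subseteq> {1..} \<Longrightarrow> i \<ge> 1 \<Longrightarrow> right_sign \<epsilon> i B * right_sign \<epsilon> i B = 1"
  unfolding right_sign_def prod.distrib[symmetric] by (rule prod.neutral) (auto simp: eps_sq subset_eq)

lemma word_sign_sq:
  "set w \<subseteq> {1..} \<Longrightarrow> B \<subseteq> {1..} \<Longrightarrow> word_sign \<epsilon> w B * word_sign \<epsilon> w B = 1"
proof (induction w)
  case (Cons i w)
  have "left_sign \<epsilon> i (act w B) * left_sign \<epsilon> i (act w B) = 1"
    using Cons.prems act_subset[of w "{1..}" B] by (intro left_sign_sq) auto
  with Cons show ?case by (simp add: mult.assoc mult.left_commute)
qed simp

text \<open>
  The relation \<open>x\<^sub>i x\<^sub>j = \<epsilon>(i,j) x\<^sub>j x\<^sub>i\<close> for the action by left multiplication.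
\<close>

lemma left_sign_exchange:
  assumes "finite B" "i \<ge> 1" "j \<ge> 1" "i \<noteq> j"
  shows "left_sign \<epsilon> i (toggle j B) * left_sign \<epsilon> j B
    = \<epsilon> i j * (left_sign \<epsilon> j (toggle i B) * left_sign \<epsilon> i B)"
  using assms eps_sq[of i j] eps_sym[of i j] by (auto simp: left_sign_toggle)

text \<open>
  Left and right multiplications commute. This compatibility of the two sign rules is what makes the
  state a trace.
\<close>

lemma left_right_commute:
  assumes "finite B" "i \<ge> 1" "j \<ge> 1"
  shows "left_sign \<epsilon> i (toggle j B) * right_sign \<epsilon> j B
    = right_sign \<epsilon> j (toggle i B) * left_sign \<epsilon> i B"
  using assms eps_sym[of i j] by (auto simp: left_sign_toggle right_sign_toggle)

lemma word_sign_swap: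
  assumes "finite B" "i \<ge> 1" "j \<ge> 1" "i \<noteq> j"
  shows "word_sign \<epsilon> (u @ i # j # v) B = \<epsilon> i j * word_sign \<epsilon> (u @ j # i # v) B"
proof -
  have fin: "finite (act v B)" using assms(1) by (induction v) (auto simp: toggle_def)
  show ?thesis
    using left_sign_exchange[OF fin assms(2-4)]
    by (simp add: word_sign_append toggle_commute[of i j] mult.assoc[symmetric])
qed

lemma word_sign_cancel:
  assumes "set v \<subseteq> {1..}" "B \<subseteq> {1..}" "i \<ge> 1"
  shows "word_sign \<epsilon> (u @ i # i # v) B = word_sign \<epsilon> (u @ v) B"
  using left_sign_sq[OF act_subset[OF assms(1,2)] assms(3)]
  by (simp add: word_sign_append mult.assoc[symmetric])

text \<open>
  The reversed word is the inverse of the word, and signs are their own inverses.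
\<close>

lemma word_sign_rev:
  assumes "set w \<subseteq> {1..}" "B \<subseteq> {1..}"
  shows "word_sign \<epsilon> (rev w) (act w B) = word_sign \<epsilon> w B"
proof -
  have "word_sign \<epsilon> (rev w @ w) B = 1"
    using assms
  proof (induction w)
    case (Cons i w)
    then show ?case using word_sign_cancel[of w B i "rev w"] by simp
  qed simp
  then have "word_sign \<epsilon> (rev w) (act w B) * word_sign \<epsilon> w B = 1"
    by (simp add: word_sign_append)
  with word_sign_sq[OF assms] show ?thesis by (metis mult.assoc mult_1 mult_1_right)
qed

lemma word_sign_sorted:
  "sorted_wrt (<) w \<Longrightarrow> word_sign \<epsilon> w {} = 1"
proof (induction w)
  case (Cons i w)
  then have "act w {} = set w" by (intro act_distinct) (auto simp: strict_sorted_iff)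
  moreover have "left_sign \<epsilon> i (set w) = 1"
    unfolding left_sign_def using Cons.prems by (intro prod.neutral) auto
  ultimately show ?case using Cons by simp
qed simp

end

section \<open>The state of the baby Fock model\<close>

abbreviation word :: "'a list \<Rightarrow> 'a free_alg" where
  "word w \<equiv> Poly_Mapping.single w 1"

lemma word_mult: "word u * word v = word (u @ v)"
  by (simp add: mult_single plus_list_def)

lemma scalar_mult_single: "scalar c * Poly_Mapping.single w d = Poly_Mapping.single w (c * d)"
  by (simp add: scalar_def mult_single plus_list_def)

lemma lookup_scalar_mult: "Poly_Mapping.lookup (scalar c * a) w = c * Poly_Mapping.lookup a w"
proof -
  have "scalar c * a = Poly_Mapping.map ((*) c) a"
    using mult_map_scale_conv_mult[of c a] by (simp add: scalar_def zero_list_def)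
  then show ?thesis by (simp add: Poly_Mapping.map.rep_eq when_def)
qed

lemma x_set_word: "x_set A = word (sorted_list_of_set A)"
proof -
  have "prod_list (map gen l) = word l" for l :: "nat list"
  proof (induction l)
    case Nil
    then show ?case using single_one[where 'a = "nat list" and 'b = complex] by (simp add: zero_list_def)
  qed (simp add: gen_def word_mult)
  then show ?thesis by (simp add: x_set_def)
qed

lemma star_word: "star (word w) = word (rev w)"
  by (simp add: star_def)

lemma monomial_expansion:
  "a = (\<Sum>w\<in>Poly_Mapping.keys a. scalar (Poly_Mapping.lookup a w) * word w)"
proof (rule poly_mapping_eqI)
  fix w
  show "Poly_Mapping.lookup a w
    = Poly_Mapping.lookup (\<Sum>w\<in>Poly_Mapping.keys a. scalar (Poly_Mapping.lookup a w) * word w) w"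
    by (simp add: lookup_sum scalar_mult_single lookup_single when_def in_keys_iff)
qed

definition linear_functional :: "('a free_alg \<Rightarrow> complex) \<Rightarrow> bool" where
  "linear_functional f \<longleftrightarrow> (\<forall>a b. f (a + b) = f a + f b) \<and> (\<forall>c a. f (scalar c * a) = c * f a)"

lemma linear_functional_sum:
  assumes "linear_functional f" shows "f (sum g S) = (\<Sum>x\<in>S. f (g x))"
proof -
  have "f 0 = 0" using assms unfolding linear_functional_def by (metis add_cancel_right_right)
  then show ?thesis using assms
    by (induction S rule: infinite_finite_induct) (auto simp: linear_functional_def)
qed

lemma scalar_commute: "scalar c * a = a * scalar c"
proof -
  have "word w * scalar d = scalar d * word w" for w :: "'a list" and d
    by (simp add: scalar_def mult_single plus_list_def)
  moreover have "scalar c * scalar d = scalar d * (scalar c :: 'a free_alg)" for d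
    by (simp add: scalar_def mult_single plus_list_def mult.commute)
  ultimately have "scalar c * (scalar d * word w) = (scalar d * word w) * scalar c" for d and w :: "'a list"
    by (metis mult.assoc)
  then show ?thesis
    by (subst (1 2) monomial_expansion[of a]) (simp only: sum_distrib_left sum_distrib_right)
qed

text \<open>
  By bilinearity it suffices to test a two-sided ideal on words.
\<close>

lemma linear_functional_sandwich:
  assumes f: "linear_functional f"
    and zero: "\<And>u v. u \<in> lists S \<Longrightarrow> v \<in> lists S \<Longrightarrow> f (word u * r * word v) = 0"
    and a: "Poly_Mapping.keys a \<subseteq> lists S" and b: "Poly_Mapping.keys b \<subseteq> lists S"
  shows "f (a * r * b) = 0"
proof -
  have "a * r * b = (\<Sum>u\<in>Poly_Mapping.keys a. \<Sum>v\<in>Poly_Mapping.keys b.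
      (scalar (Poly_Mapping.lookup a u) * word u) * r * (scalar (Poly_Mapping.lookup b v) * word v))"
    by (subst monomial_expansion[of a], subst monomial_expansion[of b])
       (simp only: sum_distrib_left sum_distrib_right, rule sum.swap)
  also have "\<dots> = (\<Sum>u\<in>Poly_Mapping.keys a. \<Sum>v\<in>Poly_Mapping.keys b.
      scalar (Poly_Mapping.lookup a u) * (scalar (Poly_Mapping.lookup b v) * (word u * r * word v)))"
  proof (intro sum.cong refl)
    fix u v
    show "(scalar (Poly_Mapping.lookup a u) * word u) * r * (scalar (Poly_Mapping.lookup b v) * word v)
      = scalar (Poly_Mapping.lookup a u) * (scalar (Poly_Mapping.lookup b v) * (word u * r * word v))"
    proof -
      have "(scalar (Poly_Mapping.lookup a u) * word u) * r * (scalar (Poly_Mapping.lookup b v) * word v)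
        = scalar (Poly_Mapping.lookup a u) * (((word u * r) * scalar (Poly_Mapping.lookup b v)) * word v)"
        by (simp only: mult.assoc)
      also have "(word u * r) * scalar (Poly_Mapping.lookup b v) = scalar (Poly_Mapping.lookup b v) * (word u * r)"
        by (rule scalar_commute[symmetric])
      finally show ?thesis by (simp only: mult.assoc)
    qed
  qed
  finally have eq: "a * r * b = \<dots>" .
  show ?thesis
    unfolding eq linear_functional_sum[OF f]
  proof (intro sum.neutral ballI)
    fix u v assume "u \<in> Poly_Mapping.keys a" "v \<in> Poly_Mapping.keys b"
    then have "f (word u * r * word v) = 0" using zero a b by blast
    then show "f (scalar (Poly_Mapping.lookup a u) * (scalar (Poly_Mapping.lookup b v) * (word u * r * word v))) = 0"
      using f by (simp add: linear_functional_def)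
  qed
qed

lemma word_relator_word:
  "word u * relator \<epsilon> i j * word v = word (u @ i # j # v)
     - scalar (complex_of_real (\<epsilon> i j)) * word (u @ j # i # v)
     - scalar (if i = j then 2 else 0) * word (u @ v)"
  by (simp add: relator_def gen_def scalar_def mult_single plus_list_def algebra_simps)

text \<open>
  The value of the state on a word: the coefficient of \<open>1\<close> in the signed basis vector to which the
  word reduces.
\<close>

definition word_value :: "(nat \<Rightarrow> nat \<Rightarrow> real) \<Rightarrow> nat list \<Rightarrow> complex" where
  "word_value \<epsilon> w = (if act w {} = {} then complex_of_real (word_sign \<epsilon> w {}) else 0)"

definition word_state :: "(nat \<Rightarrow> nat \<Rightarrow> real) \<Rightarrow> nat free_alg \<Rightarrow> complex" where
  "word_state \<epsilon> a = (\<Sum>w\<in>Poly_Mapping.keys a. Poly_Mapping.lookup a w * word_value \<epsilon> w)"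

lemma word_state_superset:
  "finite S \<Longrightarrow> Poly_Mapping.keys a \<subseteq> S \<Longrightarrow>
    word_state \<epsilon> a = (\<Sum>w\<in>S. Poly_Mapping.lookup a w * word_value \<epsilon> w)"
  unfolding word_state_def by (rule sum.mono_neutral_left) (auto simp: in_keys_iff)

lemma word_state_word [simp]: "word_state \<epsilon> (word w) = word_value \<epsilon> w"
  by (simp add: word_state_def)

lemma linear_word_state: "linear_functional (word_state \<epsilon>)"
  unfolding linear_functional_def
proof (intro conjI allI)
  fix a b :: "nat free_alg" and c
  let ?S = "Poly_Mapping.keys a \<union> Poly_Mapping.keys b"
  show "word_state \<epsilon> (a + b) = word_state \<epsilon> a + word_state \<epsilon> b"
    using keys_add[of a b]
    by (simp add: word_state_superset[of ?S] lookup_add distrib_right sum.distrib)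
  have "Poly_Mapping.keys (scalar c * a) \<subseteq> Poly_Mapping.keys a"
    by (auto simp: in_keys_iff lookup_scalar_mult)
  then show "word_state \<epsilon> (scalar c * a) = c * word_state \<epsilon> a"
    by (simp add: word_state_superset[of "Poly_Mapping.keys a"] lookup_scalar_mult sum_distrib_left mult.assoc)
qed

context signs
begin

text \<open>
  The sign rules define an action of the algebra on the span of the \<open>x\<^sub>B\<close>, and the functional maps
  \<open>a\<close> to the coefficient of \<open>x\<^sub>\<emptyset>\<close> in \<open>a x\<^sub>\<emptyset>\<close>; it vanishes on the ideal because the action respects
  the relators. This shows in particular that the relations do not collapse.
\<close>

lemma is_baby_state_word_state: "is_baby_state \<epsilon> n (word_state \<epsilon>)"
proof -
  have diff: "word_state \<epsilon> (a - b) = word_state \<epsilon> a - word_state \<epsilon> b" for a b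
    using linear_word_state[of \<epsilon>] unfolding linear_functional_def by (metis diff_add_cancel eq_diff_eq)
  have rel: "word_state \<epsilon> (word u * relator \<epsilon> i j * word v) = 0"
    if ij: "i \<in> {1..n}" "j \<in> {1..n}" and uv: "u \<in> lists {1..n}" "v \<in> lists {1..n}" for i j u v
  proof -
    have v: "set v \<subseteq> {1..}" using uv by auto
    have "word_state \<epsilon> (word u * relator \<epsilon> i j * word v) = word_value \<epsilon> (u @ i # j # v)
        - complex_of_real (\<epsilon> i j) * word_value \<epsilon> (u @ j # i # v) - (if i = j then 2 else 0) * word_value \<epsilon> (u @ v)"
      using linear_word_state[of \<epsilon>]
      by (simp add: word_relator_word diff linear_functional_def)
    also have "\<dots> = 0"
    proof (cases "i = j")
      case True
      then show ?thesis using ij v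
        by (simp add: word_value_def act_append word_sign_cancel eps_diag)
    next
      case False
      then show ?thesis using ij word_sign_swap[of "{}" i j u v]
        by (simp add: word_value_def act_append toggle_commute[of i j])
    qed
    finally show ?thesis .
  qed
  have "word_state \<epsilon> a = 0" if "a \<in> relation_ideal \<epsilon> n" for a
    using that
  proof induction
    case zero
    then show ?case by (simp add: word_state_def)
  next
    case (add a i j u v)
    have "word_state \<epsilon> (u * relator \<epsilon> i j * v) = 0"
      by (rule linear_functional_sandwich[OF linear_word_state _ add(4,5)])
        (rule rel[OF add(2,3)])
    then show ?case using add.IH linear_word_state[of \<epsilon>] by (simp add: linear_functional_def)
  qed
  moreover have "word_state \<epsilon> (x_set A) = (if A = {} then 1 else 0)" if "A \<subseteq> {1..n}" for A
  proof -
    have "act (sorted_list_of_set A) {} = A"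
      using that by (subst act_distinct) (auto dest: finite_subset)
    then show ?thesis by (auto simp: x_set_word word_value_def)
  qed
  ultimately show ?thesis using linear_word_state[of \<epsilon>]
    unfolding is_baby_state_def linear_functional_def by blast
qed

text \<open>
  Modulo the ideal every word over \<open>{1..n}\<close> is plus or minus some \<open>x\<^sub>A\<close>: inserting the letters one by one, from
  the last to the first, into an increasing product produces exactly the signs of the action.
  So every functional with the defining properties of the state takes the same values on words.
\<close>

lemma baby_state_unique_on_words:
  assumes f: "is_baby_state \<epsilon> n f" and w: "w \<in> lists {1..n}"
  shows "f (word w) = word_value \<epsilon> w"
proof -
  have lin: "linear_functional f" using f by (simp add: is_baby_state_def linear_functional_def)
  have diff: "f (a - b) = f a - f b" for a b
    using lin unfolding linear_functional_def by (metis diff_add_cancel eq_diff_eq)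
  have rel: "f (word (u @ i # j # v)) = complex_of_real (\<epsilon> i j) * f (word (u @ j # i # v))
      + (if i = j then 2 else 0) * f (word (u @ v))"
    if "i \<in> {1..n}" "j \<in> {1..n}" "u \<in> lists {1..n}" "v \<in> lists {1..n}" for i j u v
  proof -
    have "0 + word u * relator \<epsilon> i j * word v \<in> relation_ideal \<epsilon> n"
      using that by (intro relation_ideal.add relation_ideal.zero) auto
    then have "f (word u * relator \<epsilon> i j * word v) = 0"
      using f unfolding is_baby_state_def by (metis add_0)
    then have "f (word (u @ i # j # v)) - complex_of_real (\<epsilon> i j) * f (word (u @ j # i # v))
        - (if i = j then 2 else 0) * f (word (u @ v)) = 0"
      by (simp only: word_relator_word diff lin[unfolded linear_functional_def])
    then show ?thesis by (auto simp: diff_eq_eq add.commute)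
  qed
  have cancel: "f (word (u @ i # i # v)) = f (word (u @ v))"
    if "i \<in> {1..n}" "u \<in> lists {1..n}" "v \<in> lists {1..n}" for i u v
    using rel[OF that(1,1,2,3)] that by (simp add: eps_diag)
  have cons: "sorted_list_of_set (insert j A) = j # sorted_list_of_set A"
    if "finite A" "\<forall>k\<in>A. j < k" for j :: nat and A
    using sorted_list_of_set.idem_if_sorted_distinct[of "j # sorted_list_of_set A"] that
    by (auto simp: less_imp_le)
  \<comment> \<open>insertion of a letter into an increasing product, after an arbitrary prefix\<close>
  have insertion: "f (word (u @ i # l))
      = complex_of_real (left_sign \<epsilon> i (set l)) * f (word (u @ sorted_list_of_set (toggle i (set l))))"
    if "sorted_wrt (<) l" "l \<in> lists {1..n}" "i \<in> {1..n}" "u \<in> lists {1..n}" for l u i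
    using that
  proof (induction l arbitrary: u)
    case Nil
    then show ?case by (simp add: toggle_def left_sign_def)
  next
    case (Cons j l)
    have sl: "sorted_list_of_set (set l) = l" "sorted_list_of_set (insert j (set l)) = j # l"
      using Cons.prems cons[of "set l" j] sorted_list_of_set.idem_if_sorted_distinct[of l]
      by (auto simp: strict_sorted_iff)
    consider "i < j" | "i = j" | "j < i" by linarith
    then show ?case
    proof cases
      case 1
      then have "toggle i (set (j # l)) = insert i (insert j (set l))"
        and e: "{k \<in> set (j # l). k < i} = {}" using Cons.prems by (auto simp: toggle_def)
      then have "sorted_list_of_set (toggle i (set (j # l))) = i # j # l"
        using cons[of "insert j (set l)" i] 1 Cons.prems sl by auto
      then show ?thesis unfolding left_sign_def e by simp
    next
      case 2
      then have "toggle i (set (j # l)) = set l"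
        and e: "{k \<in> set (j # l). k < i} = {}" using Cons.prems by (auto simp: toggle_def)
      then show ?thesis using 2 cancel[of j u l] Cons.prems sl unfolding left_sign_def e by simp
    next
      case 3
      have "left_sign \<epsilon> i (set (j # l)) = \<epsilon> i j * left_sign \<epsilon> i (set l)"
      proof -
        have e: "{k \<in> set (j # l). k < i} = insert j {k \<in> set l. k < i}" using 3 by auto
        show ?thesis unfolding left_sign_def e using Cons.prems by (subst prod.insert) auto
      qed
      moreover have "sorted_list_of_set (toggle i (set (j # l))) = j # sorted_list_of_set (toggle i (set l))"
      proof -
        have "toggle i (set (j # l)) = insert j (toggle i (set l))"
          using 3 by (auto simp: toggle_def)
        moreover have "\<forall>k\<in>toggle i (set l). j < k" using 3 Cons.prems by (auto simp: toggle_def)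
        ultimately show ?thesis using cons[of "toggle i (set l)" j] by (simp add: toggle_def)
      qed
      moreover have "f (word (u @ i # j # l)) = complex_of_real (\<epsilon> i j) * f (word ((u @ [j]) @ i # l))"
        using rel[of i j u l] 3 Cons.prems by auto
      ultimately show ?thesis using Cons.IH[of "u @ [j]"] Cons.prems by simp
    qed
  qed
  have "f (word (u @ w))
      = complex_of_real (word_sign \<epsilon> w {}) * f (word (u @ sorted_list_of_set (act w {})))"
    if "u \<in> lists {1..n}" for u
    using w that
  proof (induction w arbitrary: u rule: list.induct)
    case (Cons i w)
    let ?A = "act w {}"
    have A: "?A \<subseteq> {1..n}" using Cons.prems by (intro act_subset) auto
    then have fin: "finite ?A" by (rule finite_subset) simp
    have "f (word (u @ i # w)) = complex_of_real (word_sign \<epsilon> w {}) * f (word (u @ i # sorted_list_of_set ?A))"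
      using Cons.IH[of "u @ [i]"] Cons.prems by simp
    also have "f (word (u @ i # sorted_list_of_set ?A))
        = complex_of_real (left_sign \<epsilon> i ?A) * f (word (u @ sorted_list_of_set (toggle i ?A)))"
    proof -
      have "sorted_list_of_set ?A \<in> lists {1..n}" using fin A by (simp add: lists_eq_set)
      then show ?thesis
        using insertion[of "sorted_list_of_set ?A" i u] fin Cons.prems by simp
    qed
    finally show ?case by simp
  qed simp
  from this[of "[]"] have "f (word w)
      = complex_of_real (word_sign \<epsilon> w {}) * f (x_set (act w {}))" by (simp add: x_set_word)
  moreover have "act w {} \<subseteq> {1..n}" using w by (intro act_subset) auto
  then have "f (x_set (act w {})) = (if act w {} = {} then 1 else 0)"
    using f unfolding is_baby_state_def by blast
  ultimately show ?thesis by (simp add: word_value_def)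
qed

lemma baby_state_word:
  assumes "w \<in> lists {1..n}"
  shows "baby_state \<epsilon> n (word w) = word_value \<epsilon> w"
  unfolding baby_state_def
  using baby_state_unique_on_words[OF someI[of "is_baby_state \<epsilon> n", OF is_baby_state_word_state] assms] .

lemma baby_inner_gen:
  assumes "A \<subseteq> {1..n}" "B \<subseteq> {1..n}" "i \<in> {1..n}"
  shows "baby_inner \<epsilon> n (gen i * x_set B) (x_set A)
    = (if A = toggle i B then complex_of_real (left_sign \<epsilon> i B) else 0)"
proof -
  have fin: "finite A" "finite B" using assms by (auto dest: finite_subset)
  let ?a = "sorted_list_of_set A" and ?b = "sorted_list_of_set B"
  have ab: "act ?a {} = A" "act ?b {} = B" using fin by (auto simp: act_distinct)
  have lists: "?a \<in> lists {1..n}" "?b \<in> lists {1..n}" using fin assms by auto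
  have "baby_inner \<epsilon> n (gen i * x_set B) (x_set A) = baby_state \<epsilon> n (word (rev ?a @ i # ?b))"
    by (simp add: baby_inner_def x_set_word star_word gen_def word_mult)
  also have "\<dots> = word_value \<epsilon> (rev ?a @ i # ?b)"
    using lists assms by (intro baby_state_word) auto
  also have "\<dots> = (if A = toggle i B then complex_of_real (left_sign \<epsilon> i B) else 0)"
  proof (cases "A = toggle i B")
    case True
    have "act (rev ?a) A = {}" using act_rev_act[of ?a "{}"] ab by simp
    moreover have "word_sign \<epsilon> (rev ?a) A = 1"
      using word_sign_rev[of ?a "{}"] fin ab word_sign_sorted[of ?a] assms(1) by (auto simp: subset_eq)
    moreover have "word_sign \<epsilon> ?b {} = 1" using word_sign_sorted[of ?b] by auto
    ultimately show ?thesis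
      using True ab by (simp add: word_value_def act_append word_sign_append)
  next
    case False
    have "act (rev ?a) (toggle i B) \<noteq> {}"
    proof
      assume "act (rev ?a) (toggle i B) = {}"
      then have "act ?a (act (rev ?a) (toggle i B)) = A" using ab by simp
      then show False using False by simp
    qed
    then show ?thesis using False ab by (simp add: word_value_def act_append)
  qed
  finally show ?thesis .
qed

end

section \<open>Matrices on the cube and the trace property\<close>

text \<open>
  The index set \<open>A\<close> of the basis vector \<open>x\<^sub>A\<close> with number \<open>a\<close>.
\<close>

definition bits :: "nat \<Rightarrow> nat \<Rightarrow> nat set" where
  "bits n a = vertex_set n (vertex n a)"

definition flip :: "nat \<Rightarrow> nat \<Rightarrow> nat" where
  "flip i a = flip_bit (i - 1) a"

lemma bits_iff: "i \<in> bits n a \<longleftrightarrow> i \<in> {1..n} \<and> bit a (i - 1)"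
  by (auto simp: bits_def vertex_set_def vertex_def bit_iff_odd odd_iff_mod_2_eq_one)

lemma bits_subset: "bits n a \<subseteq> {1..n}"
  by (auto simp: bits_iff)

lemma finite_bits [simp]: "finite (bits n a)"
  using bits_subset by (rule finite_subset) simp

lemma bits_0 [simp]: "bits n 0 = {}"
  by (auto simp: bits_iff)

lemma bits_flip: "i \<in> {1..n} \<Longrightarrow> bits n (flip i a) = toggle i (bits n a)"
  by (auto simp: bits_iff flip_def toggle_def bit_flip_bit_iff split: if_splits)

lemma flip_flip [simp]: "flip i (flip i a) = a"
  unfolding flip_def by (rule bit_eqI) (auto simp: bit_flip_bit_iff)

lemma flip_less: "i \<in> {1..n} \<Longrightarrow> a < 2 ^ n \<Longrightarrow> flip i a < 2 ^ n"
proof -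
  assume *: "i \<in> {1..n}" "a < 2 ^ n"
  then have "take_bit n (flip i a) = flip i a"
    using take_bit_nat_eq_self[OF *(2)] by (auto simp: flip_def take_bit_flip_bit_eq)
  then show ?thesis by (simp add: take_bit_nat_eq_self_iff)
qed

lemma bits_inj:
  assumes "a < 2 ^ n" "b < 2 ^ n" "bits n a = bits n b"
  shows "a = b"
proof (rule bit_eqI)
  fix m
  show "bit a m \<longleftrightarrow> bit b m"
  proof (cases "m < n")
    case True
    then have "Suc m \<in> bits n a \<longleftrightarrow> Suc m \<in> bits n b" using assms by simp
    then show ?thesis using True by (simp add: bits_iff)
  next
    case False
    then have "\<not> bit (take_bit n a) m" "\<not> bit (take_bit n b) m" by (simp_all add: bit_take_bit_iff)
    then show ?thesis using assms by (simp add: take_bit_nat_eq_self)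
  qed
qed

lemma bij_betw_bits: "bij_betw (bits n) {..<2 ^ n} (Pow {1..n})"
proof -
  have inj: "inj_on (bits n) {..<2 ^ n}" using bits_inj by (auto simp: inj_on_def)
  moreover have "bits n ` {..<2 ^ n} = Pow {1..n}"
  proof (rule card_subset_eq)
    show "bits n ` {..<2 ^ n} \<subseteq> Pow {1..n}" using bits_subset by auto
    show "card (bits n ` {..<2 ^ n}) = card (Pow {1..n})"
      using inj by (simp add: card_image card_Pow)
  qed simp
  ultimately show ?thesis by (simp add: bij_betw_def)
qed

lemma bits_toggle_iff:
  assumes "i \<in> {1..n}" "a < 2 ^ n" "c < 2 ^ n"
  shows "bits n a = toggle i (bits n c) \<longleftrightarrow> c = flip i a"
  using assms bits_inj[of c n "flip i a"] by (auto simp: bits_flip flip_less)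

lemma delta_origin: "delta_vec n (origin n) = unit_vec (2 ^ n) 0"
proof -
  have "vertex n a = origin n \<longleftrightarrow> a = 0" if "a < 2 ^ n" for a
  proof
    assume "vertex n a = origin n"
    then have "bits n a = {}" by (auto simp: bits_def vertex_set_def origin_def)
    then show "a = 0" using bits_inj[OF that, of 0] by simp
  qed (auto simp: vertex_def origin_def)
  then show ?thesis by (auto simp: delta_vec_def)
qed

lemma tau_index:
  assumes "T \<in> carrier_mat (2 ^ n) (2 ^ n)"
  shows "tau n T = T $$ (0, 0)"
proof -
  have "conjugate (unit_vec (2 ^ n) 0) = (unit_vec (2 ^ n) 0 :: complex vec)"
    by (rule eq_vecI) (auto simp: unit_vec_def)
  then have "tau n T = (T *\<^sub>v unit_vec (2 ^ n) 0) \<bullet> unit_vec (2 ^ n) 0"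
    by (simp add: tau_def delta_origin)
  also have "\<dots> = (T *\<^sub>v unit_vec (2 ^ n) 0) $ 0"
    using assms by (intro scalar_prod_right_unit) auto
  also have "\<dots> = T $$ (0, 0)" using assms by simp
  finally show ?thesis .
qed

text \<open>
  \<open>\<parallel>T 1\<parallel>\<close>, the Hilbert space norm of the first column of \<open>T\<close>. It is equal to \<open>\<tau>(T\<^sup>* T)\<^sup>1\<^sup>/\<^sup>2\<close>.
\<close>

definition vacuum_norm :: "nat \<Rightarrow> complex mat \<Rightarrow> real" where
  "vacuum_norm n T = L2_set (\<lambda>a. cmod (T $$ (a, 0))) {..<2 ^ n}"

lemma vacuum_norm_nonneg [simp]: "vacuum_norm n T \<ge> 0"
  by (simp add: vacuum_norm_def)

lemma vacuum_norm_sq: "(vacuum_norm n T)\<^sup>2 = (\<Sum>a<2 ^ n. (cmod (T $$ (a, 0)))\<^sup>2)"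
  by (simp add: vacuum_norm_def L2_set_def sum_nonneg)

lemma tau_adjoint_mult:
  assumes "S \<in> carrier_mat (2 ^ n) (2 ^ n)" "T \<in> carrier_mat (2 ^ n) (2 ^ n)"
  shows "tau n (mat_adjoint S * T) = (\<Sum>a<2 ^ n. cnj (S $$ (a, 0)) * T $$ (a, 0))"
  using assms mult_index_sum[of "mat_adjoint S" "2 ^ n" "2 ^ n" T "2 ^ n" 0 0]
  by (subst tau_index[of _ n]) (auto intro!: mult_carrier_mat)

lemma tau_adjoint_self:
  assumes "T \<in> carrier_mat (2 ^ n) (2 ^ n)"
  shows "tau n (mat_adjoint T * T) = complex_of_real ((vacuum_norm n T)\<^sup>2)"
  unfolding tau_adjoint_mult[OF assms assms] vacuum_norm_sq
  by (simp add: complex_norm_square mult.commute del: of_real_power)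

lemma tau_cauchy_schwarz:
  assumes "S \<in> carrier_mat (2 ^ n) (2 ^ n)" "T \<in> carrier_mat (2 ^ n) (2 ^ n)"
  shows "cmod (tau n (mat_adjoint S * T)) \<le> vacuum_norm n S * vacuum_norm n T"
proof -
  have "cmod (tau n (mat_adjoint S * T)) \<le> (\<Sum>a<2 ^ n. \<bar>cmod (S $$ (a, 0))\<bar> * \<bar>cmod (T $$ (a, 0))\<bar>)"
    unfolding tau_adjoint_mult[OF assms]
    by (rule order.trans[OF norm_sum]) (simp add: norm_mult)
  also have "\<dots> \<le> vacuum_norm n S * vacuum_norm n T"
    unfolding vacuum_norm_def by (rule L2_set_mult_ineq)
  finally show ?thesis .
qed

lemma cmod_tau_le:
  assumes "T \<in> carrier_mat (2 ^ n) (2 ^ n)"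
  shows "cmod (tau n T) \<le> vacuum_norm n T"
  unfolding tau_index[OF assms] vacuum_norm_def
  by (rule member_le_L2_set) auto

lemma vacuum_norm_add:
  assumes "S \<in> carrier_mat (2 ^ n) (2 ^ n)" "T \<in> carrier_mat (2 ^ n) (2 ^ n)"
  shows "vacuum_norm n (S + T) \<le> vacuum_norm n S + vacuum_norm n T"
proof -
  have "vacuum_norm n (S + T) \<le> L2_set (\<lambda>a. cmod (S $$ (a, 0)) + cmod (T $$ (a, 0))) {..<2 ^ n}"
    unfolding vacuum_norm_def using assms by (intro L2_set_mono) (auto intro: norm_triangle_ineq)
  also have "\<dots> \<le> vacuum_norm n S + vacuum_norm n T"
    unfolding vacuum_norm_def by (rule L2_set_triangle_ineq)
  finally show ?thesis .
qed

lemma vacuum_norm_smult: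
  assumes "T \<in> carrier_mat (2 ^ n) (2 ^ n)"
  shows "vacuum_norm n (c \<cdot>\<^sub>m T) = cmod c * vacuum_norm n T"
proof -
  have "vacuum_norm n (c \<cdot>\<^sub>m T) = L2_set (\<lambda>a. cmod c * cmod (T $$ (a, 0))) {..<2 ^ n}"
    unfolding vacuum_norm_def using assms by (intro L2_set_cong) (auto simp: norm_mult)
  then show ?thesis by (simp add: vacuum_norm_def L2_set_right_distrib)
qed

lemma p_norm_2:
  assumes "T \<in> carrier_mat (2 ^ n) (2 ^ n)"
  shows "p_norm n 2 T = vacuum_norm n T"
  using vacuum_norm_nonneg[of n T]
  by (simp add: p_norm_def square_abs_mat[OF assms] tau_adjoint_self[OF assms] powr_half_sqrt del: of_real_power)

context signs
begin

text \<open>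
  \<open>T\<close> commutes with the right multiplications by \<open>x\<^sub>1, \<dots>, x\<^sub>n\<close>, expressed by its entries: right multiplication by
  \<open>x\<^sub>i\<close> maps the basis vector with number \<open>a\<close> to the one with number \<open>flip i a\<close>, with the sign given by
  \<open>right_sign\<close>.
\<close>

definition equivariant :: "nat \<Rightarrow> complex mat \<Rightarrow> bool" where
  "equivariant n T \<longleftrightarrow> T \<in> carrier_mat (2 ^ n) (2 ^ n) \<and>
    (\<forall>i\<in>{1..n}. \<forall>a<2 ^ n. \<forall>b<2 ^ n. T $$ (flip i a, flip i b)
      = complex_of_real (right_sign \<epsilon> i (bits n a) * right_sign \<epsilon> i (bits n b)) * T $$ (a, b))"

lemma equivariant_carrier: "equivariant n T \<Longrightarrow> T \<in> carrier_mat (2 ^ n) (2 ^ n)"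
  by (simp add: equivariant_def)

lemma equivariantD:
  "equivariant n T \<Longrightarrow> i \<in> {1..n} \<Longrightarrow> a < 2 ^ n \<Longrightarrow> b < 2 ^ n \<Longrightarrow> T $$ (flip i a, flip i b)
      = complex_of_real (right_sign \<epsilon> i (bits n a) * right_sign \<epsilon> i (bits n b)) * T $$ (a, b)"
  by (simp add: equivariant_def)

lemma right_sign_bits_sq:
  "i \<in> {1..n} \<Longrightarrow> right_sign \<epsilon> i (bits n a) * right_sign \<epsilon> i (bits n a) = 1"
  using bits_subset by (intro right_sign_sq) (auto simp: bits_iff)

lemma equivariant_mult:
  assumes S: "equivariant n S" and T: "equivariant n T"
  shows "equivariant n (S * T)"
proof -
  note carr = S[THEN equivariant_carrier] T[THEN equivariant_carrier]
  have "(S * T) $$ (flip i a, flip i b)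
      = complex_of_real (right_sign \<epsilon> i (bits n a) * right_sign \<epsilon> i (bits n b)) * (S * T) $$ (a, b)"
    if i: "i \<in> {1..n}" and ab: "a < 2 ^ n" "b < 2 ^ n" for i a b
  proof -
    let ?r = "\<lambda>a. complex_of_real (right_sign \<epsilon> i (bits n a))"
    have "(S * T) $$ (flip i a, flip i b) = (\<Sum>c<2 ^ n. S $$ (flip i a, c) * T $$ (c, flip i b))"
      using carr i ab by (intro mult_index_sum) (auto simp: flip_less)
    also have "\<dots> = (\<Sum>c<2 ^ n. S $$ (flip i a, flip i c) * T $$ (flip i c, flip i b))"
      by (rule sum.reindex_bij_witness[of _ "flip i" "flip i"]) (use i in \<open>auto simp: flip_less\<close>)
    also have "\<dots> = (\<Sum>c<2 ^ n. (?r a * ?r b) * (S $$ (a, c) * T $$ (c, b)))"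
    proof (rule sum.cong)
      fix c :: nat assume c: "c \<in> {..<2 ^ n}"
      have "?r c * ?r c = 1" using right_sign_bits_sq[OF i, of c] by (simp flip: of_real_mult)
      moreover have "(?r a * ?r c * S $$ (a, c)) * (?r c * ?r b * T $$ (c, b))
          = (?r c * ?r c) * ((?r a * ?r b) * (S $$ (a, c) * T $$ (c, b)))"
        by (simp only: mult_ac)
      ultimately show "S $$ (flip i a, flip i c) * T $$ (flip i c, flip i b) = (?r a * ?r b) * (S $$ (a, c) * T $$ (c, b))"
        using equivariantD[OF S i, of a c] equivariantD[OF T i, of c b] ab c by simp
    qed simp
    also have "\<dots> = (?r a * ?r b) * (S * T) $$ (a, b)"
      using mult_index_sum[OF carr ab] by (simp add: sum_distrib_left)
    finally show ?thesis by simp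
  qed
  then show ?thesis unfolding equivariant_def using carr by auto
qed

lemma equivariant_one: "equivariant n (1\<^sub>m (2 ^ n))"
proof -
  have "flip i a = flip i b \<longleftrightarrow> a = b" for i a b by (metis flip_flip)
  then show ?thesis
    unfolding equivariant_def
    by (auto simp: flip_less right_sign_bits_sq simp flip: of_real_mult)
qed

lemma equivariant_add: "equivariant n S \<Longrightarrow> equivariant n T \<Longrightarrow> equivariant n (S + T)"
  unfolding equivariant_def by (auto simp: flip_less distrib_left)

lemma equivariant_smult: "equivariant n T \<Longrightarrow> equivariant n (c \<cdot>\<^sub>m T)"
  unfolding equivariant_def by (auto simp: flip_less)

lemma equivariant_adjoint: "equivariant n T \<Longrightarrow> equivariant n (mat_adjoint T)"
  unfolding equivariant_def by (auto simp: flip_less)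

text \<open>
  Moving from \<open>a\<close> to \<open>flip i a\<close> multiplies a diagonal entry by the square of a sign, and every index
  can be reached from \<open>0\<close> in this way.
\<close>

lemma equivariant_diagonal:
  assumes T: "equivariant n T" and a: "a < 2 ^ n"
  shows "T $$ (a, a) = T $$ (0, 0)"
proof -
  have "T $$ (a, a) = T $$ (0, 0)" if "finite A" "a < 2 ^ n" "bits n a = A" for A a
    using that
  proof (induction A arbitrary: a rule: finite_induct)
    case empty
    then show ?case using bits_inj[of a n 0] by simp
  next
    case (insert i A)
    have i: "i \<in> {1..n}" using insert.prems bits_subset by blast
    have "bits n (flip i a) = A" using i insert by (auto simp: bits_flip toggle_def)
    then have "T $$ (flip i a, flip i a) = T $$ (0, 0)"
      using insert i by (intro insert.IH) (auto simp: flip_less)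
    then show ?case
      using equivariantD[OF T i insert.prems(1) insert.prems(1)] by (simp only: right_sign_bits_sq[OF i]) simp
  qed
  then show ?thesis using a finite_bits by blast
qed

text \<open>
  The diagonal being constant, \<open>\<tau>\<close> is the normalized trace of matrices.
\<close>

lemma tau_trace:
  assumes S: "equivariant n S" and T: "equivariant n T"
  shows "tau n (S * T) = tau n (T * S)"
proof -
  have eq: "of_nat (2 ^ n) * tau n (S * T) = (\<Sum>a<2 ^ n. \<Sum>b<2 ^ n. S $$ (a, b) * T $$ (b, a))"
    if S: "equivariant n S" and T: "equivariant n T" for S T
  proof -
    note carr = S[THEN equivariant_carrier] T[THEN equivariant_carrier]
    have "of_nat (2 ^ n) * tau n (S * T) = (\<Sum>a<(2::nat) ^ n. (S * T) $$ (0, 0))"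
      using carr by (simp add: tau_index[OF mult_carrier_mat[OF carr]])
    also have "\<dots> = (\<Sum>a<2 ^ n. (S * T) $$ (a, a))"
      by (rule sum.cong[OF refl], rule equivariant_diagonal[OF equivariant_mult[OF S T], symmetric]) simp
    also have "\<dots> = (\<Sum>a<2 ^ n. \<Sum>b<2 ^ n. S $$ (a, b) * T $$ (b, a))"
      by (rule sum.cong[OF refl], rule mult_index_sum[OF carr]) auto
    finally show ?thesis .
  qed
  have "of_nat (2 ^ n) * tau n (S * T) = of_nat (2 ^ n) * tau n (T * S)"
    unfolding eq[OF S T] eq[OF T S] by (subst sum.swap) (simp add: mult.commute)
  then show ?thesis by simp
qed

lemma gamma_carrier [simp]: "gamma \<epsilon> n i \<in> carrier_mat (2 ^ n) (2 ^ n)"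
  by (simp add: gamma_def)

lemma gamma_index:
  assumes "a < 2 ^ n" "b < 2 ^ n" "i \<in> {1..n}"
  shows "gamma \<epsilon> n i $$ (a, b)
    = (if bits n a = toggle i (bits n b) then complex_of_real (left_sign \<epsilon> i (bits n b)) else 0)"
  using baby_inner_gen[OF bits_subset bits_subset assms(3)] assms by (simp add: gamma_def bits_def)

text \<open>
  Left multiplications commute with right multiplications.
\<close>

lemma equivariant_gamma:
  assumes j: "j \<in> {1..n}"
  shows "equivariant n (gamma \<epsilon> n j)"
proof -
  have "gamma \<epsilon> n j $$ (flip i a, flip i b)
      = complex_of_real (right_sign \<epsilon> i (bits n a) * right_sign \<epsilon> i (bits n b)) * gamma \<epsilon> n j $$ (a, b)"
    if i: "i \<in> {1..n}" and ab: "a < 2 ^ n" "b < 2 ^ n" for i a b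
  proof (cases "bits n a = toggle j (bits n b)")
    case True
    have "left_sign \<epsilon> j (toggle i (bits n b)) * right_sign \<epsilon> i (bits n b)
        = right_sign \<epsilon> i (bits n a) * left_sign \<epsilon> j (bits n b)"
      unfolding True using i j by (intro left_right_commute) auto
    moreover have "right_sign \<epsilon> i (bits n b) * right_sign \<epsilon> i (bits n b) = 1"
      using i by (rule right_sign_bits_sq)
    ultimately have "left_sign \<epsilon> j (toggle i (bits n b))
        = right_sign \<epsilon> i (bits n a) * right_sign \<epsilon> i (bits n b) * left_sign \<epsilon> j (bits n b)"
      by (metis mult.assoc mult.commute mult_1)
    then show ?thesis
      using True i j ab by (simp add: gamma_index flip_less bits_flip toggle_commute[of j i])
  next
    case False
    then have "toggle i (bits n a) \<noteq> toggle j (toggle i (bits n b))"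
      by (metis toggle_commute toggle_toggle)
    then show ?thesis using False i j ab by (simp add: gamma_index flip_less bits_flip)
  qed
  then show ?thesis by (simp add: equivariant_def)
qed

lemma gamma_prod_Nil [simp]: "gamma_prod \<epsilon> n [] = 1\<^sub>m (2 ^ n)"
  and gamma_prod_Cons [simp]: "gamma_prod \<epsilon> n (i # w) = gamma \<epsilon> n i * gamma_prod \<epsilon> n w"
  by (simp_all add: gamma_prod_def)

lemma gamma_prod_carrier [simp]: "gamma_prod \<epsilon> n w \<in> carrier_mat (2 ^ n) (2 ^ n)"
  by (induction w) (auto intro!: mult_carrier_mat)

lemma gamma_prod_append: "gamma_prod \<epsilon> n (u @ v) = gamma_prod \<epsilon> n u * gamma_prod \<epsilon> n v"
  by (induction u) (auto simp: assoc_mult_mat[of _ "2 ^ n" "2 ^ n" _ "2 ^ n" _ "2 ^ n"] left_mult_one_mat[of _ "2 ^ n" "2 ^ n"])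

lemma equivariant_gamma_prod: "set w \<subseteq> {1..n} \<Longrightarrow> equivariant n (gamma_prod \<epsilon> n w)"
  by (induction w) (auto intro!: equivariant_mult equivariant_gamma equivariant_one)

lemma gamma_prod_index:
  assumes "a < 2 ^ n" "b < 2 ^ n" "set w \<subseteq> {1..n}"
  shows "gamma_prod \<epsilon> n w $$ (a, b)
    = (if bits n a = act w (bits n b) then complex_of_real (word_sign \<epsilon> w (bits n b)) else 0)"
  using assms
proof (induction w arbitrary: a)
  case Nil
  then show ?case using bits_inj[of a n b] by auto
next
  case (Cons i w)
  have i: "i \<in> {1..n}" using Cons.prems by simp
  have "gamma_prod \<epsilon> n (i # w) $$ (a, b) = (\<Sum>c<2 ^ n. gamma \<epsilon> n i $$ (a, c) * gamma_prod \<epsilon> n w $$ (c, b))"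
    using Cons.prems by (simp add: mult_index_sum[of _ "2 ^ n" "2 ^ n" _ "2 ^ n"])
  also have "\<dots> = (\<Sum>c<2 ^ n. if c = flip i a
      then complex_of_real (left_sign \<epsilon> i (bits n c)) * gamma_prod \<epsilon> n w $$ (c, b) else 0)"
    using Cons.prems i by (intro sum.cong) (auto simp: gamma_index bits_toggle_iff)
  also have "\<dots> = complex_of_real (left_sign \<epsilon> i (bits n (flip i a))) * gamma_prod \<epsilon> n w $$ (flip i a, b)"
    using Cons.prems i by (simp add: flip_less)
  also have "gamma_prod \<epsilon> n w $$ (flip i a, b)
      = (if bits n (flip i a) = act w (bits n b) then complex_of_real (word_sign \<epsilon> w (bits n b)) else 0)"
    using Cons.prems i by (intro Cons.IH) (auto simp: flip_less)
  also have "bits n (flip i a) = act w (bits n b) \<longleftrightarrow> bits n a = act (i # w) (bits n b)"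
    using i by (metis act_Cons bits_flip toggle_toggle)
  finally show ?case using i by (auto simp: bits_flip)
qed

lemma weighted_sum_carrier [simp]: "weighted_sum \<epsilon> n k c \<in> carrier_mat (2 ^ n) (2 ^ n)"
  by (simp add: weighted_sum_def)

lemma finite_tuples [simp]: "finite (tuples n k)"
proof -
  have "tuples n k \<subseteq> {w. set w \<subseteq> {1..n} \<and> length w = k}" by (auto simp: tuples_def)
  then show ?thesis by (rule finite_subset) (rule finite_lists_length_eq, simp)
qed

lemma weighted_sum_index:
  assumes n: "n \<ge> 1" and "a < 2 ^ n" "b < 2 ^ n"
  shows "weighted_sum \<epsilon> n k c $$ (a, b) = complex_of_real ((1 / sqrt (real n)) ^ k) *
    (\<Sum>w\<in>tuples n k. complex_of_real (c w) * gamma_prod \<epsilon> n w $$ (a, b))"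
proof -
  have "sqrt (real n) ^ k = (real n powr (1 / 2)) powr real k"
    using n by (simp add: powr_half_sqrt powr_realpow)
  also have "\<dots> = real n powr (real k / 2)" by (simp add: powr_powr)
  finally have "1 / real n powr (real k / 2) = (1 / sqrt (real n)) ^ k"
    by (simp add: power_one_over)
  then show ?thesis using assms by (simp add: weighted_sum_def)
qed

lemma equivariant_weighted_sum: "equivariant n (weighted_sum \<epsilon> n k c)"
proof -
  have "gamma_prod \<epsilon> n w $$ (flip i a, flip i b)
      = complex_of_real (right_sign \<epsilon> i (bits n a) * right_sign \<epsilon> i (bits n b)) * gamma_prod \<epsilon> n w $$ (a, b)"
    if "w \<in> tuples n k" "i \<in> {1..n}" "a < 2 ^ n" "b < 2 ^ n" for w i a b
    using that by (intro equivariantD equivariant_gamma_prod) (auto simp: tuples_def)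
  then show ?thesis
    using weighted_sum_carrier[of n k c]
    by (cases "n = 0")
      (auto simp: equivariant_def weighted_sum_index flip_less sum_distrib_left mult_ac intro!: sum.cong)
qed

end

section \<open>Matrices that decay with the Hamming distance\<close>

definition sym_difference :: "nat set \<Rightarrow> nat set \<Rightarrow> nat set" where
  "sym_difference A B = (A - B) \<union> (B - A)"

definition hamming :: "nat \<Rightarrow> nat \<Rightarrow> nat \<Rightarrow> nat" where
  "hamming n a b = card (sym_difference (bits n a) (bits n b))"

lemma hamming_self [simp]: "hamming n a a = 0"
  by (simp add: hamming_def sym_difference_def)

lemma hamming_commute: "hamming n a b = hamming n b a"
  by (simp add: hamming_def sym_difference_def Un_commute)

lemma hamming_triangle: "hamming n a b \<le> hamming n a c + hamming n c b"
proof -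
  have "hamming n a b \<le> card (sym_difference (bits n a) (bits n c) \<union> sym_difference (bits n c) (bits n b))"
    unfolding hamming_def by (rule card_mono) (auto simp: sym_difference_def)
  also have "\<dots> \<le> hamming n a c + hamming n c b"
    unfolding hamming_def by (rule card_Un_le)
  finally show ?thesis .
qed

text \<open>
  The sum factorizes over the elements of \<open>{1..n}\<close>: those of \<open>D\<close> contribute a factor \<open>2\<close> each and the
  others a factor \<open>1 + 1/n\<close> each, where \<open>(1 + 1/n)\<^sup>n \<le> 3\<close>.
\<close>

lemma sum_pow_card_Diff_le:
  fixes n :: nat
  assumes "n \<ge> 1" "D \<subseteq> {1..n}"
  shows "(\<Sum>F\<in>Pow {1..n}. (1 / real n) ^ card (F - D)) \<le> 3 * 2 ^ card D"
proof -
  let ?w = "\<lambda>i. if i \<in> D then 1 else 1 / real n"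
  have "(\<Sum>F\<in>Pow {1..n}. (1 / real n) ^ card (F - D)) = (\<Sum>F\<in>Pow {1..n}. (\<Prod>i\<in>F. ?w i) * (\<Prod>i\<in>{1..n} - F. 1))"
  proof (rule sum.cong)
    fix F assume "F \<in> Pow {1..n}"
    then have fin: "finite F" by (auto dest: finite_subset)
    have "F - D = F \<inter> - {i. i \<in> D}" by auto
    then show "(1 / real n) ^ card (F - D) = (\<Prod>i\<in>F. ?w i) * (\<Prod>i\<in>{1..n} - F. 1)"
      using fin by (simp add: prod.If_cases)
  qed simp
  also have "\<dots> = (\<Prod>i\<in>{1..n}. ?w i + 1)"
    by (rule prod_add[symmetric]) simp
  also have "\<dots> \<le> (\<Prod>i\<in>{1..n}. (if i \<in> D then 2 else 1) * (1 + 1 / real n))"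
    by (rule prod_mono) auto
  also have "\<dots> = 2 ^ card D * (1 + 1 / real n) ^ n"
  proof -
    have "{1..n} \<inter> {i. i \<in> D} = D" using assms by auto
    then show ?thesis by (simp add: prod.distrib prod.If_cases)
  qed
  also have "(1 + 1 / real n) ^ n \<le> 3"
    using exp_ge_one_plus_x_over_n_power_n[of n 1] exp_le assms by simp
  finally show ?thesis by simp
qed

text \<open>
  A detour from \<open>a\<close> to \<open>b\<close> that leaves the set \<open>D\<close> of differing coordinates in \<open>t\<close> places has length
  \<open>d + 2 t\<close> with \<open>d\<close> the size of \<open>D\<close>. It costs a factor \<open>n\<^sup>-\<^sup>t\<close>, which balances the number of such
  detours.
\<close>

lemma sum_pow_hamming_le:
  assumes n: "n \<ge> 1"
  shows "(\<Sum>c<2 ^ n. (1 / sqrt (real n)) ^ (hamming n a c + hamming n c b))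
    \<le> 3 * 2 ^ hamming n a b * (1 / sqrt (real n)) ^ hamming n a b"
proof -
  let ?r = "1 / sqrt (real n)" and ?I = "{1..n}"
  let ?A = "bits n a" and ?B = "bits n b"
  let ?D = "sym_difference ?A ?B"
  have D: "?D \<subseteq> ?I" using bits_subset by (auto simp: sym_difference_def)
  have "(\<Sum>c<2 ^ n. ?r ^ (hamming n a c + hamming n c b))
      = (\<Sum>C\<in>Pow ?I. ?r ^ (card (sym_difference ?A C) + card (sym_difference C ?B)))"
    unfolding hamming_def by (rule sum.reindex_bij_betw[OF bij_betw_bits])
  also have "\<dots> = (\<Sum>F\<in>Pow ?I. ?r ^ (card F + card (sym_difference F ?D)))"
  \<comment> \<open>measure the intermediate point relative to \<open>a\<close>\<close>
  proof (rule sum.reindex_bij_witness[of _ "\<lambda>F. sym_difference ?A F" "\<lambda>C. sym_difference ?A C"], goal_cases)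
    case (5 C)
    have "sym_difference (sym_difference ?A C) ?D = sym_difference C ?B"
      by (auto simp: sym_difference_def)
    then show ?case by simp
  qed (use bits_subset in \<open>auto simp: sym_difference_def\<close>)
  also have "\<dots> = (\<Sum>F\<in>Pow ?I. ?r ^ card ?D * (1 / real n) ^ card (F - ?D))"
  proof (rule sum.cong)
    fix F assume "F \<in> Pow ?I"
    then have fin: "finite F" "finite ?D" using D by (auto dest: finite_subset)
    have "card F = card (F \<inter> ?D) + card (F - ?D)" using fin by (simp add: card_Int_Diff)
    moreover have "card ?D = card (F \<inter> ?D) + card (?D - F)" using fin by (metis card_Int_Diff Int_commute)
    moreover have "card (sym_difference F ?D) = card (F - ?D) + card (?D - F)"
      using fin by (subst sym_difference_def, intro card_Un_disjoint) auto
    ultimately have "card F + card (sym_difference F ?D) = card ?D + 2 * card (F - ?D)" by simp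
    moreover have "?r ^ 2 = 1 / real n" by (simp add: power_divide)
    ultimately show "?r ^ (card F + card (sym_difference F ?D)) = ?r ^ card ?D * (1 / real n) ^ card (F - ?D)"
      by (simp add: power_add power_mult)
  qed simp
  also have "\<dots> = ?r ^ card ?D * (\<Sum>F\<in>Pow ?I. (1 / real n) ^ card (F - ?D))"
    by (simp add: sum_distrib_left)
  also have "\<dots> \<le> ?r ^ card ?D * (3 * 2 ^ card ?D)"
    by (rule mult_left_mono[OF sum_pow_card_Diff_le[OF n D]]) simp
  finally show ?thesis by (simp add: hamming_def mult_ac)
qed

text \<open>
  The entry at Hamming distance \<open>d\<close> is \<open>O(n\<^sup>-\<^sup>d\<^sup>/\<^sup>2)\<close>, and the entries beyond a fixed distance \<open>M\<close>
  vanish. This is the size of the entries of the \<open>X\<^sub>n\<^sub>,\<^sub>k\<close>: a sum of \<open>k!\<close> signs times \<open>n\<^sup>-\<^sup>k\<^sup>/\<^sup>2\<close> at distance \<open>k\<close>.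
\<close>

definition decays :: "(nat \<Rightarrow> complex mat) \<Rightarrow> bool" where
  "decays T \<longleftrightarrow> (\<exists>C\<ge>0. \<exists>M. \<forall>n\<ge>1. \<forall>a<2 ^ n. \<forall>b<2 ^ n. cmod (T n $$ (a, b))
     \<le> (if hamming n a b \<le> M then C * (1 / sqrt (real n)) ^ hamming n a b else 0))"

lemma decaysI:
  assumes "C \<ge> 0"
    and "\<And>n a b. n \<ge> 1 \<Longrightarrow> a < 2 ^ n \<Longrightarrow> b < 2 ^ n \<Longrightarrow> hamming n a b \<le> M \<Longrightarrow>
      cmod (T n $$ (a, b)) \<le> C * (1 / sqrt (real n)) ^ hamming n a b"
    and "\<And>n a b. n \<ge> 1 \<Longrightarrow> a < 2 ^ n \<Longrightarrow> b < 2 ^ n \<Longrightarrow> hamming n a b > M \<Longrightarrow> T n $$ (a, b) = 0"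
  shows "decays T"
  unfolding decays_def using assms by (intro exI[of _ C] conjI exI[of _ M]) auto

lemma decaysE:
  assumes "decays T"
  obtains C M where "C \<ge> 0"
    and "\<And>n a b. n \<ge> 1 \<Longrightarrow> a < 2 ^ n \<Longrightarrow> b < 2 ^ n \<Longrightarrow>
      cmod (T n $$ (a, b)) \<le> C * (1 / sqrt (real n)) ^ hamming n a b"
    and "\<And>n a b. n \<ge> 1 \<Longrightarrow> a < 2 ^ n \<Longrightarrow> b < 2 ^ n \<Longrightarrow> hamming n a b > M \<Longrightarrow> T n $$ (a, b) = 0"
proof -
  from assms obtain C M where C: "C \<ge> 0" and *: "\<And>n a b. n \<ge> 1 \<Longrightarrow> a < 2 ^ n \<Longrightarrow> b < 2 ^ n \<Longrightarrow> cmod (T n $$ (a, b))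
     \<le> (if hamming n a b \<le> M then C * (1 / sqrt (real n)) ^ hamming n a b else 0)"
    unfolding decays_def by blast
  show ?thesis
  proof (rule that[of C M])
    show "cmod (T n $$ (a, b)) \<le> C * (1 / sqrt (real n)) ^ hamming n a b"
      if "n \<ge> 1" "a < 2 ^ n" "b < 2 ^ n" for n a b
      using *[OF that] C by (auto split: if_splits intro: order.trans)
    show "T n $$ (a, b) = 0" if "n \<ge> 1" "a < 2 ^ n" "b < 2 ^ n" "hamming n a b > M" for n a b
      using *[OF that(1-3)] that(4) by simp
  qed (rule C)
qed

lemma decays_mult:
  assumes S: "decays S" and T: "decays T"
    and carr: "\<And>n. S n \<in> carrier_mat (2 ^ n) (2 ^ n)" "\<And>n. T n \<in> carrier_mat (2 ^ n) (2 ^ n)"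
  shows "decays (\<lambda>n. S n * T n)"
proof -
  obtain C M where C: "C \<ge> 0"
    and S1: "\<And>n a b. n \<ge> 1 \<Longrightarrow> a < 2 ^ n \<Longrightarrow> b < 2 ^ n \<Longrightarrow> cmod (S n $$ (a, b)) \<le> C * (1 / sqrt (real n)) ^ hamming n a b"
    and S0: "\<And>n a b. n \<ge> 1 \<Longrightarrow> a < 2 ^ n \<Longrightarrow> b < 2 ^ n \<Longrightarrow> hamming n a b > M \<Longrightarrow> S n $$ (a, b) = 0"
    by (rule decaysE[OF S]) blast
  obtain C' M' where C': "C' \<ge> 0"
    and T1: "\<And>n a b. n \<ge> 1 \<Longrightarrow> a < 2 ^ n \<Longrightarrow> b < 2 ^ n \<Longrightarrow> cmod (T n $$ (a, b)) \<le> C' * (1 / sqrt (real n)) ^ hamming n a b"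
    and T0: "\<And>n a b. n \<ge> 1 \<Longrightarrow> a < 2 ^ n \<Longrightarrow> b < 2 ^ n \<Longrightarrow> hamming n a b > M' \<Longrightarrow> T n $$ (a, b) = 0"
    by (rule decaysE[OF T]) blast
  show ?thesis
  proof (rule decaysI[of "C * C' * (3 * 2 ^ (M + M'))" "M + M'"], goal_cases)
    case 1
    then show ?case using C C' by simp
  next
    case (2 n a b)
    let ?r = "1 / sqrt (real n)" and ?h = "hamming n a b"
    have "cmod ((S n * T n) $$ (a, b)) \<le> (\<Sum>c<2 ^ n. cmod (S n $$ (a, c)) * cmod (T n $$ (c, b)))"
      using mult_index_sum[OF carr 2(2,3)] by (simp add: norm_mult[symmetric] norm_sum)
    also have "\<dots> \<le> (\<Sum>c<2 ^ n. (C * ?r ^ hamming n a c) * (C' * ?r ^ hamming n c b))"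
      using S1[OF 2(1,2)] T1[OF 2(1) _ 2(3)] C by (intro sum_mono mult_mono) auto
    also have "\<dots> = C * C' * (\<Sum>c<2 ^ n. ?r ^ (hamming n a c + hamming n c b))"
      by (simp add: sum_distrib_left power_add mult_ac)
    also have "\<dots> \<le> C * C' * (3 * 2 ^ ?h * ?r ^ ?h)"
      by (intro mult_left_mono sum_pow_hamming_le) (use C C' 2 in auto)
    also have "\<dots> \<le> C * C' * (3 * 2 ^ (M + M') * ?r ^ ?h)"
      by (intro mult_left_mono mult_right_mono power_increasing) (use C C' 2 in auto)
    finally show ?case by (simp add: mult_ac)
  next
    case (3 n a b)
    have "S n $$ (a, c) * T n $$ (c, b) = 0" if c: "c < 2 ^ n" for c
    proof -
      have "hamming n a c > M \<or> hamming n c b > M'"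
        using 3(4) hamming_triangle[of n a b c] by linarith
      then show ?thesis using S0[OF 3(1,2) c] T0[OF 3(1) c 3(3)] by auto
    qed
    then show ?case unfolding mult_index_sum[OF carr 3(2,3)] by (intro sum.neutral) simp
  qed
qed

lemma decays_add:
  assumes S: "decays S" and T: "decays T"
    and carr: "\<And>n. S n \<in> carrier_mat (2 ^ n) (2 ^ n)" "\<And>n. T n \<in> carrier_mat (2 ^ n) (2 ^ n)"
  shows "decays (\<lambda>n. S n + T n)"
proof -
  obtain C M where C: "C \<ge> 0"
    and S1: "\<And>n a b. n \<ge> 1 \<Longrightarrow> a < 2 ^ n \<Longrightarrow> b < 2 ^ n \<Longrightarrow> cmod (S n $$ (a, b)) \<le> C * (1 / sqrt (real n)) ^ hamming n a b"
    and S0: "\<And>n a b. n \<ge> 1 \<Longrightarrow> a < 2 ^ n \<Longrightarrow> b < 2 ^ n \<Longrightarrow> hamming n a b > M \<Longrightarrow> S n $$ (a, b) = 0"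
    by (rule decaysE[OF S]) blast
  obtain C' M' where C': "C' \<ge> 0"
    and T1: "\<And>n a b. n \<ge> 1 \<Longrightarrow> a < 2 ^ n \<Longrightarrow> b < 2 ^ n \<Longrightarrow> cmod (T n $$ (a, b)) \<le> C' * (1 / sqrt (real n)) ^ hamming n a b"
    and T0: "\<And>n a b. n \<ge> 1 \<Longrightarrow> a < 2 ^ n \<Longrightarrow> b < 2 ^ n \<Longrightarrow> hamming n a b > M' \<Longrightarrow> T n $$ (a, b) = 0"
    by (rule decaysE[OF T]) blast
  show ?thesis
  proof (rule decaysI[of "C + C'" "max M M'"], goal_cases)
    case (2 n a b)
    have "cmod ((S n + T n) $$ (a, b)) \<le> cmod (S n $$ (a, b)) + cmod (T n $$ (a, b))"
      using carr[of n] 2 by (simp add: norm_triangle_ineq)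
    also have "\<dots> \<le> (C + C') * (1 / sqrt (real n)) ^ hamming n a b"
      using S1[OF 2(1-3)] T1[OF 2(1-3)] by (simp add: distrib_right)
    finally show ?case .
  qed (use C C' S0 T0 carr[THEN carrier_matD(1)] carr[THEN carrier_matD(2)] in auto)
qed

lemma decays_smult:
  assumes T: "decays T" and carr: "\<And>n. T n \<in> carrier_mat (2 ^ n) (2 ^ n)"
  shows "decays (\<lambda>n. c \<cdot>\<^sub>m T n)"
proof -
  obtain C M where C: "C \<ge> 0"
    and T1: "\<And>n a b. n \<ge> 1 \<Longrightarrow> a < 2 ^ n \<Longrightarrow> b < 2 ^ n \<Longrightarrow> cmod (T n $$ (a, b)) \<le> C * (1 / sqrt (real n)) ^ hamming n a b"
    and T0: "\<And>n a b. n \<ge> 1 \<Longrightarrow> a < 2 ^ n \<Longrightarrow> b < 2 ^ n \<Longrightarrow> hamming n a b > M \<Longrightarrow> T n $$ (a, b) = 0"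
    by (rule decaysE[OF T]) blast
  show ?thesis
  proof (rule decaysI[of "cmod c * C" M], goal_cases)
    case (2 n a b)
    then show ?case using carr[of n] mult_left_mono[OF T1[OF 2(1-3)], of "cmod c"]
      by (simp add: norm_mult mult.assoc)
  qed (use C T0 carr[THEN carrier_matD(1)] carr[THEN carrier_matD(2)] in auto)
qed

lemma decays_adjoint:
  assumes T: "decays T" and carr: "\<And>n. T n \<in> carrier_mat (2 ^ n) (2 ^ n)"
  shows "decays (\<lambda>n. mat_adjoint (T n))"
proof -
  obtain C M where C: "C \<ge> 0"
    and T1: "\<And>n a b. n \<ge> 1 \<Longrightarrow> a < 2 ^ n \<Longrightarrow> b < 2 ^ n \<Longrightarrow> cmod (T n $$ (a, b)) \<le> C * (1 / sqrt (real n)) ^ hamming n a b"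
    and T0: "\<And>n a b. n \<ge> 1 \<Longrightarrow> a < 2 ^ n \<Longrightarrow> b < 2 ^ n \<Longrightarrow> hamming n a b > M \<Longrightarrow> T n $$ (a, b) = 0"
    by (rule decaysE[OF T]) blast
  show ?thesis
  proof (rule decaysI[of C M], goal_cases)
    case (2 n a b)
    then show ?case using carr[of n] T1[of n b a] by (simp add: hamming_commute)
  next
    case (3 n a b)
    then show ?case using carr[of n] T0[of n b a] by (simp add: hamming_commute)
  qed (rule C)
qed

lemma decays_one: "decays (\<lambda>n. 1\<^sub>m (2 ^ n))"
proof (rule decaysI[of 1 0])
  fix n a b :: nat
  assume "a < 2 ^ n" "b < 2 ^ n" "0 < hamming n a b"
  then show "1\<^sub>m (2 ^ n) $$ (a, b) = (0::complex)" by auto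
qed auto

section \<open>The algebra of admissible sequences and its negligible ideal\<close>

context signs
begin

definition admissible :: "(nat \<Rightarrow> complex mat) \<Rightarrow> bool" where
  "admissible T \<longleftrightarrow> (\<forall>n. equivariant n (T n)) \<and> decays T"

definition negligible :: "(nat \<Rightarrow> complex mat) \<Rightarrow> bool" where
  "negligible T \<longleftrightarrow> admissible T \<and> (\<lambda>n. vacuum_norm n (T n)) \<longlonglongrightarrow> 0"

lemma admissible_carrier: "admissible T \<Longrightarrow> T n \<in> carrier_mat (2 ^ n) (2 ^ n)"
  by (simp add: admissible_def equivariant_def)

lemma admissible_mult: "admissible S \<Longrightarrow> admissible T \<Longrightarrow> admissible (\<lambda>n. S n * T n)"
  using admissible_carrier[of S] admissible_carrier[of T]
  by (simp add: admissible_def equivariant_mult decays_mult)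

lemma admissible_add: "admissible S \<Longrightarrow> admissible T \<Longrightarrow> admissible (\<lambda>n. S n + T n)"
  using admissible_carrier[of S] admissible_carrier[of T]
  by (simp add: admissible_def equivariant_add decays_add)

lemma admissible_smult: "admissible T \<Longrightarrow> admissible (\<lambda>n. c \<cdot>\<^sub>m T n)"
  using admissible_carrier[of T] by (simp add: admissible_def equivariant_smult decays_smult)

lemma admissible_adjoint: "admissible T \<Longrightarrow> admissible (\<lambda>n. mat_adjoint (T n))"
  using admissible_carrier[of T] by (simp add: admissible_def equivariant_adjoint decays_adjoint)

lemma admissible_one: "admissible (\<lambda>n. 1\<^sub>m (2 ^ n))"
  by (simp add: admissible_def equivariant_one decays_one)

lemma minus_as_smult:
  assumes "S \<in> carrier_mat N N" "T \<in> carrier_mat N N"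
  shows "S - T = S + (-1 :: complex) \<cdot>\<^sub>m T"
  using assms by (intro eq_matI) auto

lemma admissible_minus: "admissible S \<Longrightarrow> admissible T \<Longrightarrow> admissible (\<lambda>n. S n - T n)"
  using admissible_add[OF _ admissible_smult, of S T "-1"]
  by (simp add: minus_as_smult[OF admissible_carrier admissible_carrier])

text \<open>
  \<open>\<parallel>T 1\<parallel>\<^sup>2\<close> is the entry at \<open>(0, 0)\<close> of \<open>T\<^sup>* T\<close>, hence at distance \<open>0\<close> of a matrix that decays again.
\<close>

lemma vacuum_norm_bounded:
  assumes T: "admissible T"
  obtains K where "\<And>n. n \<ge> 1 \<Longrightarrow> vacuum_norm n (T n) \<le> K"
proof -
  have "decays (\<lambda>n. mat_adjoint (T n) * T n)"
    using admissible_mult[OF admissible_adjoint[OF T] T] by (simp add: admissible_def)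
  then obtain C M where C: "\<And>n a b. n \<ge> 1 \<Longrightarrow> a < 2 ^ n \<Longrightarrow> b < 2 ^ n \<Longrightarrow>
      cmod ((mat_adjoint (T n) * T n) $$ (a, b)) \<le> C * (1 / sqrt (real n)) ^ hamming n a b"
    by (rule decaysE) blast
  have "vacuum_norm n (T n) \<le> sqrt C" if n: "n \<ge> 1" for n
  proof (rule real_le_rsqrt)
    note carr = admissible_carrier[OF T, of n]
    have "cmod (tau n (mat_adjoint (T n) * T n)) = (vacuum_norm n (T n))\<^sup>2"
      by (simp add: tau_adjoint_self[OF carr] norm_power)
    moreover have "cmod (tau n (mat_adjoint (T n) * T n)) \<le> C"
      using C[OF n, of 0 0] carr by (simp add: tau_index[of _ n] mult_carrier_mat[of _ "2 ^ n" "2 ^ n"])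
    ultimately show "(vacuum_norm n (T n))\<^sup>2 \<le> C" by simp
  qed
  then show ?thesis using that by blast
qed

lemma negligible_admissible: "negligible T \<Longrightarrow> admissible T"
  by (simp add: negligible_def)

lemma vacuum_norm_tendsto_0:
  assumes T: "negligible T" and W: "admissible W"
    and le: "\<And>n. (vacuum_norm n (S n))\<^sup>2 \<le> vacuum_norm n (T n) * vacuum_norm n (W n)"
  shows "(\<lambda>n. vacuum_norm n (S n)) \<longlonglongrightarrow> 0"
proof -
  obtain K where K: "\<And>n. n \<ge> 1 \<Longrightarrow> vacuum_norm n (W n) \<le> K"
    using vacuum_norm_bounded[OF W] by blast
  have lim: "(\<lambda>n. vacuum_norm n (T n) * K) \<longlonglongrightarrow> 0"
    using T by (intro tendsto_mult_left_zero) (simp add: negligible_def)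
  have "\<forall>\<^sub>F n in sequentially. (vacuum_norm n (S n))\<^sup>2 \<le> vacuum_norm n (T n) * K"
    using eventually_ge_at_top[of 1]
    by eventually_elim (rule order.trans[OF le mult_left_mono[OF K]], auto)
  then have "(\<lambda>n. (vacuum_norm n (S n))\<^sup>2) \<longlonglongrightarrow> 0"
    by (intro tendsto_sandwich[OF _ _ tendsto_const lim]) auto
  then have "(\<lambda>n. sqrt ((vacuum_norm n (S n))\<^sup>2)) \<longlonglongrightarrow> sqrt 0"
    by (rule tendsto_real_sqrt)
  then show ?thesis by simp
qed

text \<open>
  \<open>\<parallel>S T 1\<parallel>\<^sup>2 = \<tau>(T\<^sup>* (S\<^sup>* S T)) \<le> \<parallel>T 1\<parallel> \<parallel>S\<^sup>* S T 1\<parallel>\<close>, and the second factor is bounded.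
\<close>

lemma negligible_mult_left:
  assumes S: "admissible S" and T: "negligible T"
  shows "negligible (\<lambda>n. S n * T n)"
proof -
  have T': "admissible T" using T by (rule negligible_admissible)
  let ?W = "\<lambda>n. mat_adjoint (S n) * (S n * T n)"
  have W: "admissible ?W" by (intro admissible_mult admissible_adjoint S T')
  have "(vacuum_norm n (S n * T n))\<^sup>2 \<le> vacuum_norm n (T n) * vacuum_norm n (?W n)" for n
  proof -
    note c = admissible_carrier[OF S, of n] admissible_carrier[OF T', of n]
    have "complex_of_real ((vacuum_norm n (S n * T n))\<^sup>2) = tau n (mat_adjoint (S n * T n) * (S n * T n))"
      by (rule tau_adjoint_self[symmetric]) (use c in simp)
    also have "mat_adjoint (S n * T n) * (S n * T n) = mat_adjoint (T n) * ?W n"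
      using c by (simp add: mat_adjoint_mult[OF c] assoc_mult_mat[of _ "2 ^ n" "2 ^ n" _ "2 ^ n" _ "2 ^ n"]
          mult_carrier_mat[of _ "2 ^ n" "2 ^ n" _ "2 ^ n"])
    finally have "(vacuum_norm n (S n * T n))\<^sup>2 = cmod (tau n (mat_adjoint (T n) * ?W n))"
      by (metis norm_of_real abs_power2)
    then show ?thesis using tau_cauchy_schwarz[OF c(2) admissible_carrier[OF W, of n]] by simp
  qed
  from vacuum_norm_tendsto_0[OF T W this] show ?thesis
    by (simp add: negligible_def admissible_mult S T')
qed

text \<open>
  By the trace property, \<open>\<parallel>T S 1\<parallel>\<^sup>2 = \<tau>(S\<^sup>* T\<^sup>* T S) = \<tau>(T\<^sup>* (T S S\<^sup>*)) \<le> \<parallel>T 1\<parallel> \<parallel>T S S\<^sup>* 1\<parallel>\<close>.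
\<close>

lemma negligible_mult_right:
  assumes S: "admissible S" and T: "negligible T"
  shows "negligible (\<lambda>n. T n * S n)"
proof -
  have T': "admissible T" using T by (rule negligible_admissible)
  let ?W = "\<lambda>n. T n * S n * mat_adjoint (S n)"
  have W: "admissible ?W" by (intro admissible_mult admissible_adjoint S T')
  have "(vacuum_norm n (T n * S n))\<^sup>2 \<le> vacuum_norm n (T n) * vacuum_norm n (?W n)" for n
  proof -
    note c = admissible_carrier[OF T', of n] admissible_carrier[OF S, of n]
    note e = T' S admissible_adjoint[OF T'] admissible_adjoint[OF S]
    have "complex_of_real ((vacuum_norm n (T n * S n))\<^sup>2) = tau n (mat_adjoint (T n * S n) * (T n * S n))"
      by (rule tau_adjoint_self[symmetric]) (use c in simp)
    also have "mat_adjoint (T n * S n) * (T n * S n) = mat_adjoint (S n) * (mat_adjoint (T n) * (T n * S n))"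
      using c by (simp add: mat_adjoint_mult[OF c] assoc_mult_mat[of _ "2 ^ n" "2 ^ n" _ "2 ^ n" _ "2 ^ n"]
          mult_carrier_mat[of _ "2 ^ n" "2 ^ n" _ "2 ^ n"])
    also have "tau n \<dots> = tau n ((mat_adjoint (T n) * (T n * S n)) * mat_adjoint (S n))"
      by (rule tau_trace) (use e in \<open>simp_all add: admissible_def equivariant_mult\<close>)
    also have "(mat_adjoint (T n) * (T n * S n)) * mat_adjoint (S n) = mat_adjoint (T n) * ?W n"
      using c by (simp add: assoc_mult_mat[of _ "2 ^ n" "2 ^ n" _ "2 ^ n" _ "2 ^ n"]
          mult_carrier_mat[of _ "2 ^ n" "2 ^ n" _ "2 ^ n"])
    finally have "(vacuum_norm n (T n * S n))\<^sup>2 = cmod (tau n (mat_adjoint (T n) * ?W n))"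
      by (metis norm_of_real abs_power2)
    then show ?thesis using tau_cauchy_schwarz[OF c(1) admissible_carrier[OF W, of n]] by simp
  qed
  from vacuum_norm_tendsto_0[OF T W this] show ?thesis
    by (simp add: negligible_def admissible_mult S T')
qed

lemma negligible_add:
  assumes S: "negligible S" and T: "negligible T"
  shows "negligible (\<lambda>n. S n + T n)"
proof -
  have lim: "(\<lambda>n. vacuum_norm n (S n) + vacuum_norm n (T n)) \<longlonglongrightarrow> 0"
    using S T by (intro tendsto_add_zero) (auto simp: negligible_def)
  have "vacuum_norm n (S n + T n) \<le> vacuum_norm n (S n) + vacuum_norm n (T n)" for n
    using S T by (intro vacuum_norm_add admissible_carrier negligible_admissible)
  then have "(\<lambda>n. vacuum_norm n (S n + T n)) \<longlonglongrightarrow> 0"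
    by (intro tendsto_sandwich[OF _ _ tendsto_const lim]) auto
  then show ?thesis using S T by (simp add: negligible_def admissible_add)
qed

lemma negligible_smult:
  assumes T: "negligible T"
  shows "negligible (\<lambda>n. c \<cdot>\<^sub>m T n)"
proof -
  have "(\<lambda>n. cmod c * vacuum_norm n (T n)) \<longlonglongrightarrow> cmod c * 0"
    using T by (intro tendsto_intros) (auto simp: negligible_def)
  then show ?thesis using T
    by (simp add: negligible_def admissible_smult vacuum_norm_smult admissible_carrier)
qed

lemma negligible_minus:
  assumes S: "negligible S" and T: "negligible T"
  shows "negligible (\<lambda>n. S n - T n)"
  using negligible_add[OF S negligible_smult[OF T, of "-1"]]
  by (simp add: minus_as_smult[OF admissible_carrier[OF negligible_admissible[OF S]]
        admissible_carrier[OF negligible_admissible[OF T]]])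

lemma negligible_zero: "negligible (\<lambda>n. 0\<^sub>m (2 ^ n) (2 ^ n))"
proof -
  have "admissible (\<lambda>n. 0\<^sub>m (2 ^ n) (2 ^ n))"
    unfolding admissible_def equivariant_def
    by (auto simp: flip_less intro!: decaysI[of 0 0])
  moreover have "vacuum_norm n (0\<^sub>m (2 ^ n) (2 ^ n)) = 0" for n
    by (simp add: vacuum_norm_def L2_set_def)
  ultimately show ?thesis by (simp add: negligible_def)
qed

lemma tau_negligible:
  assumes T: "negligible T"
  shows "(\<lambda>n. tau n (T n)) \<longlonglongrightarrow> 0"
proof (rule tendsto_norm_zero_cancel, rule tendsto_sandwich[OF _ _ tendsto_const])
  show "(\<lambda>n. vacuum_norm n (T n)) \<longlonglongrightarrow> 0" using T by (simp add: negligible_def)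
  show "\<forall>\<^sub>F n in sequentially. cmod (tau n (T n)) \<le> vacuum_norm n (T n)"
    using T by (intro always_eventually allI cmod_tau_le admissible_carrier negligible_admissible)
qed auto

lemma admissible_poly_mat:
  assumes X: "admissible X" shows "admissible (\<lambda>n. poly_mat Q (X n))"
proof (induction Q)
  case 0
  then show ?case using negligible_zero
    by (simp add: poly_mat_zero[OF admissible_carrier[OF X]] negligible_def)
next
  case (pCons c Q)
  then show ?case
    by (simp add: poly_mat_pCons[OF admissible_carrier[OF X]] admissible_add admissible_smult
        admissible_one admissible_mult X)
qed

text \<open>
  Polynomials respect congruence modulo a two-sided ideal, because
  \<open>X P(X) - Y P(Y) = X (P(X) - P(Y)) + (X - Y) P(Y)\<close>.
\<close>

lemma negligible_poly_mat_diff: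
  assumes X: "admissible X" and Y: "admissible Y" and XY: "negligible (\<lambda>n. X n - Y n)"
  shows "negligible (\<lambda>n. poly_mat Q (X n) - poly_mat Q (Y n))"
proof (induction Q)
  case 0
  then show ?case using negligible_zero negligible_minus[OF negligible_zero negligible_zero]
    by (simp add: poly_mat_zero[OF admissible_carrier[OF X]] poly_mat_zero[OF admissible_carrier[OF Y]])
next
  case (pCons c Q)
  have "poly_mat (pCons c Q) (X n) - poly_mat (pCons c Q) (Y n)
      = X n * (poly_mat Q (X n) - poly_mat Q (Y n)) + (X n - Y n) * poly_mat Q (Y n)" for n
  proof -
    let ?N = "2 ^ n :: nat"
    note c = admissible_carrier[OF X, of n] admissible_carrier[OF Y, of n]
    note c' = c poly_mat_carrier[OF c(1), of Q] poly_mat_carrier[OF c(2), of Q]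
    have "X n * (poly_mat Q (X n) - poly_mat Q (Y n)) + (X n - Y n) * poly_mat Q (Y n)
      = (X n * poly_mat Q (X n) - X n * poly_mat Q (Y n)) + (X n * poly_mat Q (Y n) - Y n * poly_mat Q (Y n))"
      using c' by (simp add: mult_minus_distrib_mat[of _ ?N ?N _ ?N] minus_mult_distrib_mat[of _ ?N ?N _ _ ?N])
    also have "\<dots> = poly_mat (pCons c Q) (X n) - poly_mat (pCons c Q) (Y n)"
      using c' by (intro eq_matI) (auto simp: poly_mat_pCons[OF c(1)] poly_mat_pCons[OF c(2)])
    finally show ?thesis by simp
  qed
  then show ?case
    using negligible_add[OF negligible_mult_left[OF X pCons.IH]
        negligible_mult_right[OF admissible_poly_mat[OF Y, of Q] XY]] by simp
qed

end

section \<open>The product formula and the Hermite recursion\<close>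

lemma act_distinct_sym_difference: "distinct w \<Longrightarrow> act w B = sym_difference (set w) B"
proof (induction w)
  case (Cons i w)
  then show ?case by (auto simp: toggle_def sym_difference_def)
qed (simp add: sym_difference_def)

lemma tuplesD:
  assumes "w \<in> tuples n k"
  shows "length w = k" "distinct w" "set w \<subseteq> {1..n}"
  using assms by (auto simp: tuples_def)

lemma card_tuples_same_set: "card {w \<in> tuples n k. set w = D} \<le> fact k"
proof (cases "finite D \<and> card D = k")
  case True
  have "{w \<in> tuples n k. set w = D} \<subseteq> permutations_of_set D"
    by (auto simp: tuples_def permutations_of_set_def)
  then have "card {w \<in> tuples n k. set w = D} \<le> card (permutations_of_set D)"
    by (intro card_mono) auto
  also have "\<dots> = fact k" using True by simp
  finally show ?thesis .
next
  case False
  then have e: "{w \<in> tuples n k. set w = D} = {}"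
    by (auto simp: tuples_def distinct_card)
  show ?thesis unfolding e by simp
qed

context signs
begin

text \<open>
  Negligibility concerns the limit \<open>n \<rightarrow> \<infinity>\<close>. The index \<open>n = 0\<close> has to be excluded from most
  identities below, since the normalizing factor \<open>0 powr 0 = 0\<close> makes \<open>X\<^sub>0\<^sub>,\<^sub>0\<close> vanish.
\<close>

lemma negligible_cong:
  assumes T: "negligible T" and S: "admissible S" and eq: "\<And>n. n \<ge> 1 \<Longrightarrow> S n = T n"
  shows "negligible S"
proof -
  have "(\<lambda>n. vacuum_norm n (S n)) \<longlonglongrightarrow> 0"
  proof (rule Lim_transform_eventually)
    show "(\<lambda>n. vacuum_norm n (T n)) \<longlonglongrightarrow> 0" using T by (simp add: negligible_def)
    show "\<forall>\<^sub>F n in sequentially. vacuum_norm n (T n) = vacuum_norm n (S n)"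
      using eventually_ge_at_top[of 1] by eventually_elim (simp add: eq)
  qed
  then show ?thesis using S by (simp add: negligible_def)
qed

lemma gamma_prod_index_tuple:
  assumes w: "w \<in> tuples n k" and ab: "a < 2 ^ n" "b < 2 ^ n"
  shows "gamma_prod \<epsilon> n w $$ (a, b)
    = (if set w = sym_difference (bits n a) (bits n b) then complex_of_real (word_sign \<epsilon> w (bits n b)) else 0)"
proof -
  have "bits n a = act w (bits n b) \<longleftrightarrow> set w = sym_difference (bits n a) (bits n b)"
    unfolding act_distinct_sym_difference[OF tuplesD(2)[OF w]]
    by (auto simp: sym_difference_def)
  then show ?thesis using gamma_prod_index[OF ab tuplesD(3)[OF w]] by simp
qed

lemma abs_word_sign: "set w \<subseteq> {1..} \<Longrightarrow> B \<subseteq> {1..} \<Longrightarrow> \<bar>word_sign \<epsilon> w B\<bar> = 1"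
  using word_sign_sq[of w B] by (metis abs_mult_self_eq abs_1 abs_square_eq_1 power2_eq_square)

lemma abs_word_sign_tuple: "w \<in> tuples n k \<Longrightarrow> \<bar>word_sign \<epsilon> w (bits n b)\<bar> = 1"
  using bits_subset[of n b] by (intro abs_word_sign) (auto simp: tuples_def)

text \<open>
  A product of generators with pairwise distinct indices connects exactly the pairs of basis vectors
  whose index sets differ in the set of these indices.
\<close>

lemma weighted_sum_entry:
  assumes n: "n \<ge> 1" and ab: "a < 2 ^ n" "b < 2 ^ n"
  shows "weighted_sum \<epsilon> n k c $$ (a, b) = complex_of_real ((1 / sqrt (real n)) ^ k *
    (\<Sum>w | w \<in> tuples n k \<and> set w = sym_difference (bits n a) (bits n b). c w * word_sign \<epsilon> w (bits n b)))"
proof -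
  have "(\<Sum>w\<in>tuples n k. complex_of_real (c w) * gamma_prod \<epsilon> n w $$ (a, b))
    = (\<Sum>w\<in>tuples n k. if set w = sym_difference (bits n a) (bits n b)
        then complex_of_real (c w * word_sign \<epsilon> w (bits n b)) else 0)"
    using ab by (intro sum.cong) (auto simp: gamma_prod_index_tuple)
  also have "\<dots> = complex_of_real (\<Sum>w | w \<in> tuples n k \<and> set w = sym_difference (bits n a) (bits n b).
      c w * word_sign \<epsilon> w (bits n b))"
    by (subst sum.inter_filter[symmetric]) simp_all
  finally show ?thesis unfolding weighted_sum_index[OF n ab] by simp
qed

lemma decays_weighted_sum:
  assumes K: "K \<ge> 0" and c: "\<And>n w. n \<ge> 1 \<Longrightarrow> w \<in> tuples n k \<Longrightarrow> \<bar>c n w\<bar> \<le> K"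
  shows "decays (\<lambda>n. weighted_sum \<epsilon> n k (c n))"
proof -
  have zero: "weighted_sum \<epsilon> n k (c n) $$ (a, b) = 0"
    if "n \<ge> 1" "a < 2 ^ n" "b < 2 ^ n" "hamming n a b \<noteq> k" for n a b
  proof -
    have e: "{w. w \<in> tuples n k \<and> set w = sym_difference (bits n a) (bits n b)} = {}"
      using that(4) distinct_card by (fastforce simp: tuples_def hamming_def)
    show ?thesis unfolding weighted_sum_entry[OF that(1-3)] e by simp
  qed
  show ?thesis
  proof (rule decaysI[of "K * fact k" k])
    fix n a b :: nat assume *: "n \<ge> 1" "a < 2 ^ n" "b < 2 ^ n"
    let ?S = "{w \<in> tuples n k. set w = sym_difference (bits n a) (bits n b)}"
    show "cmod (weighted_sum \<epsilon> n k (c n) $$ (a, b)) \<le> K * fact k * (1 / sqrt (real n)) ^ hamming n a b"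
    proof (cases "hamming n a b = k")
      case True
      have "\<bar>\<Sum>w\<in>?S. c n w * word_sign \<epsilon> w (bits n b)\<bar> \<le> (\<Sum>w\<in>?S. K)"
        using c[OF *(1)] by (intro order.trans[OF sum_abs] sum_mono) (auto simp: abs_mult abs_word_sign_tuple)
      also have "\<dots> = real (card ?S) * K" by simp
      also have "real (card ?S) \<le> fact k"
        using card_tuples_same_set[of n k] by (metis of_nat_fact of_nat_le_iff)
      then have "real (card ?S) * K \<le> fact k * K" using K by (rule mult_right_mono)
      finally have "(1 / sqrt (real n)) ^ k * \<bar>\<Sum>w\<in>?S. c n w * word_sign \<epsilon> w (bits n b)\<bar>
          \<le> (1 / sqrt (real n)) ^ k * (fact k * K)"
        by (rule mult_left_mono) simp
      then show ?thesis unfolding weighted_sum_entry[OF *] True norm_of_real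
        by (simp add: abs_mult power_abs mult_ac)
    next
      case False
      then show ?thesis using zero[OF *] K by simp
    qed
  qed (use zero K in auto)
qed

lemma admissible_weighted_sum:
  assumes "K \<ge> 0" and "\<And>n w. n \<ge> 1 \<Longrightarrow> w \<in> tuples n k \<Longrightarrow> \<bar>c n w\<bar> \<le> K"
  shows "admissible (\<lambda>n. weighted_sum \<epsilon> n k (c n))"
  using decays_weighted_sum[of K k c] assms by (simp add: admissible_def equivariant_weighted_sum)

lemma X_op_carrier [simp]: "X_op \<epsilon> n k \<in> carrier_mat (2 ^ n) (2 ^ n)"
  and Y_op_carrier [simp]: "Y_op \<epsilon> q n k \<in> carrier_mat (2 ^ n) (2 ^ n)"
  by (simp_all add: X_op_def Y_op_def)

lemma admissible_X_op: "admissible (\<lambda>n. X_op \<epsilon> n k)"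
  unfolding X_op_def by (rule admissible_weighted_sum[of 1]) auto

text \<open>
  \<open>[k+1]\<^sub>q Y\<^sub>n\<^sub>,\<^sub>k\<close>, the part of \<open>X\<^sub>n\<^sub>,\<^sub>k\<^sub>+\<^sub>1 X\<^sub>n\<^sub>,\<^sub>1\<close> in which two generators have cancelled. In this form it does
  not depend on \<open>q\<close>, and it makes sense if \<open>[k+1]\<^sub>q = 0\<close>.
\<close>

definition contraction_op :: "nat \<Rightarrow> nat \<Rightarrow> complex mat" where
  "contraction_op n k = weighted_sum \<epsilon> n k (Z_coeff \<epsilon> n)"

lemma contraction_op_carrier [simp]: "contraction_op n k \<in> carrier_mat (2 ^ n) (2 ^ n)"
  by (simp add: contraction_op_def)

lemma X_contraction_op_dims [simp]:
  "dim_row (X_op \<epsilon> n k) = 2 ^ n" "dim_col (X_op \<epsilon> n k) = 2 ^ n"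
  "dim_row (contraction_op n k) = 2 ^ n" "dim_col (contraction_op n k) = 2 ^ n"
  by (simp_all add: X_op_def contraction_op_def weighted_sum_def)

lemma abs_Z_coeff:
  assumes n: "n \<ge> 1" and w: "w \<in> tuples n k"
  shows "\<bar>Z_coeff \<epsilon> n w\<bar> \<le> real (k + 1)"
proof -
  have prod: "\<bar>prod_list (map (\<epsilon> i) v)\<bar> = 1" if "i \<ge> 1" "set v \<subseteq> {1..n}" for i v
    using that
  proof (induction v)
    case (Cons j v)
    then show ?case using eps_cases[of i j] by (auto simp: abs_mult)
  qed simp
  have "\<bar>\<Sum>i\<in>{1..n} - set w. \<Sum>j\<le>length w. prod_list (map (\<epsilon> i) (drop j w))\<bar>
    \<le> (\<Sum>i\<in>{1..n} - set w. \<Sum>j\<le>length w. 1)"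
  proof (rule order.trans[OF sum_abs], rule sum_mono, rule order.trans[OF sum_abs], rule sum_mono)
    fix i j assume "i \<in> {1..n} - set w"
    then show "\<bar>prod_list (map (\<epsilon> i) (drop j w))\<bar> \<le> 1"
      using prod[of i "drop j w"] set_drop_subset[of j w] tuplesD(3)[OF w] by auto
  qed
  also have "\<dots> = real (card ({1..n} - set w)) * real (k + 1)" using tuplesD(1)[OF w] by simp
  also have "\<dots> \<le> real n * real (k + 1)"
    using card_mono[of "{1..n}" "{1..n} - set w"] by (intro mult_right_mono) auto
  finally show ?thesis using n by (simp add: Z_coeff_def abs_mult field_simps)
qed

lemma admissible_contraction_op: "admissible (\<lambda>n. contraction_op n k)"
  unfolding contraction_op_def by (rule admissible_weighted_sum[of "real (k + 1)"]) (auto intro: abs_Z_coeff[simplified])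

lemma Y_op_eq_contraction_op: "Y_op \<epsilon> q n k = complex_of_real (inverse (q_number q (k + 1))) \<cdot>\<^sub>m contraction_op n k"
  unfolding Y_op_def contraction_op_def weighted_sum_def
  by (rule eq_matI) (auto simp: sum_distrib_left mult_ac)

lemma word_sign_contract:
  assumes "finite B" "B \<subseteq> {1..}" "i \<ge> 1" "set v \<subseteq> {1..}" "i \<notin> set v"
  shows "word_sign \<epsilon> (u @ i # v @ [i]) B = prod_list (map (\<epsilon> i) v) * word_sign \<epsilon> (u @ v) B"
  using assms(4,5)
proof (induction v arbitrary: u)
  case Nil
  then show ?case using word_sign_cancel[of "[]" B i u] assms by simp
next
  case (Cons l v)
  have "word_sign \<epsilon> (u @ i # l # (v @ [i])) B = \<epsilon> i l * word_sign \<epsilon> (u @ l # i # (v @ [i])) B"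
    using Cons.prems assms by (intro word_sign_swap) auto
  also have "word_sign \<epsilon> (u @ l # i # (v @ [i])) B = prod_list (map (\<epsilon> i) v) * word_sign \<epsilon> (u @ l # v) B"
    using Cons.IH[of "u @ [l]"] Cons.prems by simp
  finally show ?case by simp
qed

text \<open>
  The last generator moves to the left past the letters of \<open>v\<close> and cancels its first occurrence.
\<close>

lemma gamma_prod_contract:
  assumes "a < 2 ^ n" "b < 2 ^ n" "i \<in> {1..n}" "set u \<subseteq> {1..n}" "set v \<subseteq> {1..n}" "i \<notin> set v"
  shows "gamma_prod \<epsilon> n (u @ i # v @ [i]) $$ (a, b)
    = complex_of_real (prod_list (map (\<epsilon> i) v)) * gamma_prod \<epsilon> n (u @ v) $$ (a, b)"
proof -
  have "word_sign \<epsilon> (u @ i # v @ [i]) (bits n b) = prod_list (map (\<epsilon> i) v) * word_sign \<epsilon> (u @ v) (bits n b)"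
    using assms bits_subset[of n b] by (intro word_sign_contract) auto
  moreover have "act (u @ i # v @ [i]) (bits n b) = act (u @ v) (bits n b)"
    by (simp add: act_append act_toggle)
  ultimately show ?thesis using assms by (simp add: gamma_prod_index)
qed

lemma sum_tuples_snoc:
  fixes F :: "nat list \<Rightarrow> complex"
  shows "(\<Sum>w\<in>tuples n k. \<Sum>i\<in>{1..n} - set w. F (w @ [i])) = (\<Sum>v\<in>tuples n (Suc k). F v)"
proof -
  have "(\<Sum>w\<in>tuples n k. \<Sum>i\<in>{1..n} - set w. F (w @ [i]))
      = (\<Sum>(w, i)\<in>(SIGMA w:tuples n k. {1..n} - set w). F (w @ [i]))"
    by (rule sum.Sigma) auto
  also have "\<dots> = (\<Sum>v\<in>tuples n (Suc k). F v)"
  proof (rule sum.reindex_bij_witness[of _ "\<lambda>v. (butlast v, last v)" "\<lambda>(w, i). w @ [i]"], goal_cases)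
    case (4 v)
    then have "v \<noteq> []" by (auto simp: tuples_def)
    then obtain w i where "v = w @ [i]" by (metis rev_exhaust)
    then show ?case using 4 by (auto simp: tuples_def)
  next
    case (3 v)
    then have "v \<noteq> []" by (auto simp: tuples_def)
    then show ?case by simp
  qed (auto simp: tuples_def)
  finally show ?thesis .
qed

text \<open>
  A tuple with a marked letter is a shorter tuple together with the letter and the position at which
  it is inserted.
\<close>

lemma sum_tuples_insert:
  fixes G :: "nat list \<Rightarrow> nat \<Rightarrow> complex"
  shows "(\<Sum>w\<in>tuples n (Suc m). \<Sum>i\<in>set w. G w i)
    = (\<Sum>v\<in>tuples n m. \<Sum>i\<in>{1..n} - set v. \<Sum>j\<le>m. G (take j v @ i # drop j v) i)"
proof -
  have split: "takeWhile (\<lambda>x. x \<noteq> i) (xs @ i # ys) = xs" "remove1 i (xs @ i # ys) = xs @ ys"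
    if "i \<notin> set xs" for i :: nat and xs ys
    using that by (induction xs) auto
  have "(\<Sum>w\<in>tuples n (Suc m). \<Sum>i\<in>set w. G w i)
      = (\<Sum>(w, i)\<in>(SIGMA w:tuples n (Suc m). set w). G w i)"
    by (rule sum.Sigma) auto
  also have "\<dots> = (\<Sum>(v, i, j)\<in>(SIGMA v:tuples n m. ({1..n} - set v) \<times> {..m}). G (take j v @ i # drop j v) i)"
  proof (rule sum.reindex_bij_witness[of _ "\<lambda>(v, i, j). (take j v @ i # drop j v, i)"
      "\<lambda>(w, i). (remove1 i w, i, length (takeWhile (\<lambda>x. x \<noteq> i) w))"], goal_cases)
    case (1 p)
    then obtain w i where p: "p = (w, i)" "w \<in> tuples n (Suc m)" "i \<in> set w" by auto
    then obtain xs ys where w: "w = xs @ i # ys" by (meson split_list)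
    then have "i \<notin> set xs" "i \<notin> set ys" using p by (auto simp: tuples_def)
    then show ?case using p w by (simp add: split)
  next
    case (2 p)
    then obtain w i where p: "p = (w, i)" "w \<in> tuples n (Suc m)" "i \<in> set w" by auto
    then obtain xs ys where w: "w = xs @ i # ys" by (meson split_list)
    then have "i \<notin> set xs" "i \<notin> set ys" using p by (auto simp: tuples_def)
    then show ?case using p w by (auto simp: split tuples_def)
  next
    case (3 p)
    then obtain v i j where p: "p = (v, i, j)" "v \<in> tuples n m" "i \<in> {1..n}" "i \<notin> set v" "j \<le> m" by auto
    then have "i \<notin> set (take j v)" "i \<notin> set (drop j v)"
      using set_take_subset[of j v] set_drop_subset[of j v] by auto
    then show ?case using p tuplesD(1)[OF p(2)] by (simp add: split)
  next
    case (4 p)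
    then obtain v i j where p: "p = (v, i, j)" "v \<in> tuples n m" "i \<in> {1..n}" "i \<notin> set v" "j \<le> m" by auto
    obtain xs ys where xy: "take j v = xs" "drop j v = ys" "v = xs @ ys" by (metis append_take_drop_id)
    have "xs @ i # ys \<in> tuples n (Suc m)" using p(2-4) xy(3) by (auto simp: tuples_def)
    then show ?case using p(1) xy(1,2) by simp
  next
    case (5 p)
    then obtain w i where p: "p = (w, i)" "w \<in> tuples n (Suc m)" "i \<in> set w" by auto
    then obtain xs ys where w: "w = xs @ i # ys" by (meson split_list)
    then have "i \<notin> set xs" using p by (auto simp: tuples_def)
    then show ?case using p w by (simp add: split)
  qed
  also have "\<dots> = (\<Sum>v\<in>tuples n m. \<Sum>p\<in>({1..n} - set v) \<times> {..m}. case p of (i, j) \<Rightarrow> G (take j v @ i # drop j v) i)"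
    by (rule sum.Sigma[of "tuples n m" "\<lambda>v. ({1..n} - set v) \<times> {..m}"
        "\<lambda>v p. case p of (i, j) \<Rightarrow> G (take j v @ i # drop j v) i", symmetric]) auto
  also have "\<dots> = (\<Sum>v\<in>tuples n m. \<Sum>i\<in>{1..n} - set v. \<Sum>j\<le>m. G (take j v @ i # drop j v) i)"
    by (simp only: sum.cartesian_product)
  finally show ?thesis .
qed

lemma tuples_1: "tuples n 1 = (\<lambda>i. [i]) ` {1..n}"
  by (auto simp: tuples_def length_Suc_conv)

text \<open>
  The new index either extends the tuple or repeats one of its letters. In the second case, deleting
  the letter from position \<open>j\<close> leaves a tuple \<open>v\<close> with the sign \<open>\<Prod>\<epsilon>(i,l)\<close> over the letters \<open>l\<close> from
  position \<open>j\<close> on. The sum over \<open>i\<close> and \<open>j\<close> of these signs is \<open>n Z(v)\<close>, and the factor \<open>n\<close> is absorbed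
  by the normalization.
\<close>

lemma X_op_mult_X_op_1:
  assumes n: "n \<ge> 1"
  shows "X_op \<epsilon> n (Suc m) * X_op \<epsilon> n 1 = X_op \<epsilon> n (Suc (Suc m)) + contraction_op n m"
proof (rule eq_matI, goal_cases)
  case (1 a b)
  then have ab: "a < 2 ^ n" "b < 2 ^ n"
    using carrier_matD[OF X_op_carrier[of n "Suc (Suc m)"]] carrier_matD[OF contraction_op_carrier[of n m]] by auto
  define c where "c = complex_of_real (1 / sqrt (real n))"
  have ws: "weighted_sum \<epsilon> n k f $$ (a, b) = c ^ k *
      (\<Sum>w\<in>tuples n k. complex_of_real (f w) * gamma_prod \<epsilon> n w $$ (a, b))"
    if "a < 2 ^ n" "b < 2 ^ n" for k f a b
    using weighted_sum_index[OF n that] by (simp add: c_def)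
  define F where "F w = gamma_prod \<epsilon> n w $$ (a, b)" for w
  have r2: "c ^ 2 = complex_of_real (1 / real n)"
    by (simp add: c_def power_divide flip: of_real_power)
  have X: "X_op \<epsilon> n k $$ (a, b) = c ^ k * (\<Sum>w\<in>tuples n k. gamma_prod \<epsilon> n w $$ (a, b))"
    if "a < 2 ^ n" "b < 2 ^ n" for k a b
    unfolding X_op_def ws[OF that] by simp
  have X1: "X_op \<epsilon> n 1 $$ (d, b) = c * (\<Sum>i\<in>{1..n}. gamma_prod \<epsilon> n [i] $$ (d, b))" if "d < 2 ^ n" for d
    unfolding X[OF that ab(2)] tuples_1 by (subst sum.reindex) (auto simp: inj_on_def)
  have "(X_op \<epsilon> n (Suc m) * X_op \<epsilon> n 1) $$ (a, b)
      = (\<Sum>d<2 ^ n. X_op \<epsilon> n (Suc m) $$ (a, d) * X_op \<epsilon> n 1 $$ (d, b))"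
    by (rule mult_index_sum[OF X_op_carrier X_op_carrier ab])
  also have "\<dots> = (\<Sum>d<2 ^ n. c ^ Suc (Suc m) * (\<Sum>w\<in>tuples n (Suc m). \<Sum>i\<in>{1..n}.
      gamma_prod \<epsilon> n w $$ (a, d) * gamma_prod \<epsilon> n [i] $$ (d, b)))"
  proof (rule sum.cong[OF refl])
    fix d :: nat assume "d \<in> {..<2 ^ n}"
    then have d: "d < 2 ^ n" by simp
    show "X_op \<epsilon> n (Suc m) $$ (a, d) * X_op \<epsilon> n 1 $$ (d, b)
      = c ^ Suc (Suc m) * (\<Sum>w\<in>tuples n (Suc m). \<Sum>i\<in>{1..n}.
          gamma_prod \<epsilon> n w $$ (a, d) * gamma_prod \<epsilon> n [i] $$ (d, b))"
      unfolding X[OF ab(1) d] X1[OF d] sum_product[symmetric] by (simp only: power_Suc mult_ac)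
  qed
  also have "\<dots> = c ^ Suc (Suc m) * (\<Sum>d<2 ^ n. \<Sum>w\<in>tuples n (Suc m). \<Sum>i\<in>{1..n}.
      gamma_prod \<epsilon> n w $$ (a, d) * gamma_prod \<epsilon> n [i] $$ (d, b))"
    by (rule sum_distrib_left[symmetric])
  also have "(\<Sum>d<2 ^ n. \<Sum>w\<in>tuples n (Suc m). \<Sum>i\<in>{1..n}.
      gamma_prod \<epsilon> n w $$ (a, d) * gamma_prod \<epsilon> n [i] $$ (d, b))
    = (\<Sum>w\<in>tuples n (Suc m). \<Sum>i\<in>{1..n}. \<Sum>d<2 ^ n. gamma_prod \<epsilon> n w $$ (a, d) * gamma_prod \<epsilon> n [i] $$ (d, b))"
    by (subst sum.swap, rule sum.cong[OF refl], rule sum.swap)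
  also have "\<dots> = (\<Sum>w\<in>tuples n (Suc m). \<Sum>i\<in>{1..n}. F (w @ [i]))"
    unfolding F_def gamma_prod_append mult_index_sum[OF gamma_prod_carrier gamma_prod_carrier ab] ..
  also have "\<dots> = (\<Sum>w\<in>tuples n (Suc m). (\<Sum>i\<in>{1..n} - set w. F (w @ [i])) + (\<Sum>i\<in>set w. F (w @ [i])))"
    by (rule sum.cong[OF refl], rule sum.subset_diff) (auto simp: tuples_def)
  also have "\<dots> = (\<Sum>v\<in>tuples n (Suc (Suc m)). F v)
      + (\<Sum>v\<in>tuples n m. \<Sum>i\<in>{1..n} - set v. \<Sum>j\<le>m. F ((take j v @ i # drop j v) @ [i]))"
    unfolding sum.distrib sum_tuples_snoc sum_tuples_insert ..
  also have "(\<Sum>v\<in>tuples n m. \<Sum>i\<in>{1..n} - set v. \<Sum>j\<le>m. F ((take j v @ i # drop j v) @ [i]))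
      = (\<Sum>v\<in>tuples n m. \<Sum>i\<in>{1..n} - set v. \<Sum>j\<le>m.
          complex_of_real (prod_list (map (\<epsilon> i) (drop j v))) * F v)"
  proof (intro sum.cong refl)
    fix v i j assume v: "v \<in> tuples n m" and i: "i \<in> {1..n} - set v"
    have "gamma_prod \<epsilon> n (take j v @ i # drop j v @ [i]) $$ (a, b)
      = complex_of_real (prod_list (map (\<epsilon> i) (drop j v))) * gamma_prod \<epsilon> n (take j v @ drop j v) $$ (a, b)"
      using i tuplesD(3)[OF v] set_take_subset[of j v] set_drop_subset[of j v]
      by (intro gamma_prod_contract[OF ab]) auto
    then show "F ((take j v @ i # drop j v) @ [i]) = complex_of_real (prod_list (map (\<epsilon> i) (drop j v))) * F v"
      by (simp add: F_def del: gamma_prod_Cons)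
  qed
  also have "\<dots> = complex_of_real (real n) * (\<Sum>v\<in>tuples n m. complex_of_real (Z_coeff \<epsilon> n v) * F v)"
    unfolding sum_distrib_left
  proof (rule sum.cong[OF refl])
    fix v assume v: "v \<in> tuples n m"
    have "real n * Z_coeff \<epsilon> n v = (\<Sum>i\<in>{1..n} - set v. \<Sum>j\<le>m. prod_list (map (\<epsilon> i) (drop j v)))"
      using n by (simp add: Z_coeff_def tuplesD(1)[OF v])
    then have "complex_of_real (real n) * complex_of_real (Z_coeff \<epsilon> n v)
      = (\<Sum>i\<in>{1..n} - set v. \<Sum>j\<le>m. complex_of_real (prod_list (map (\<epsilon> i) (drop j v))))"
      by (simp only: of_real_mult[symmetric] of_real_sum[symmetric])
    then show "(\<Sum>i\<in>{1..n} - set v. \<Sum>j\<le>m. complex_of_real (prod_list (map (\<epsilon> i) (drop j v))) * F v)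
      = complex_of_real (real n) * (complex_of_real (Z_coeff \<epsilon> n v) * F v)"
      by (simp only: sum_distrib_right[symmetric] mult.assoc[symmetric])
  qed
  also have "c ^ Suc (Suc m) * ((\<Sum>v\<in>tuples n (Suc (Suc m)). F v)
      + complex_of_real (real n) * (\<Sum>v\<in>tuples n m. complex_of_real (Z_coeff \<epsilon> n v) * F v))
    = X_op \<epsilon> n (Suc (Suc m)) $$ (a, b)
      + (c ^ 2 * complex_of_real (real n)) * (c ^ m * (\<Sum>v\<in>tuples n m. complex_of_real (Z_coeff \<epsilon> n v) * F v))"
    unfolding X[OF ab] F_def by (simp only: distrib_left power2_eq_square power_Suc mult_ac)
  also have "c ^ 2 * complex_of_real (real n) = 1" unfolding r2 using n by (simp flip: of_real_mult)
  also have "c ^ m * (\<Sum>v\<in>tuples n m. complex_of_real (Z_coeff \<epsilon> n v) * F v) = contraction_op n m $$ (a, b)"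
    unfolding contraction_op_def ws[OF ab] F_def ..
  finally show ?case
    using ab carrier_matD[OF contraction_op_carrier[of n m]] by simp
qed simp_all

lemma X_op_0:
  assumes "n \<ge> 1" shows "X_op \<epsilon> n 0 = 1\<^sub>m (2 ^ n)" "contraction_op n 0 = 1\<^sub>m (2 ^ n)"
proof -
  have t: "tuples n 0 = {[]}" by (auto simp: tuples_def)
  have Z: "Z_coeff \<epsilon> n [] = 1" using assms by (simp add: Z_coeff_def)
  show "X_op \<epsilon> n 0 = 1\<^sub>m (2 ^ n)"
    by (rule eq_matI) (simp_all add: X_op_def weighted_sum_index[OF assms] t carrier_matD[OF weighted_sum_carrier])
  show "contraction_op n 0 = 1\<^sub>m (2 ^ n)"
    by (rule eq_matI) (simp_all add: contraction_op_def weighted_sum_index[OF assms] t Z carrier_matD[OF weighted_sum_carrier])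
qed

definition hermite_poly :: "real \<Rightarrow> nat \<Rightarrow> complex poly" where
  "hermite_poly q k = map_poly complex_of_real (q_hermite q k)"

lemma hermite_poly_simps:
  "hermite_poly q 0 = 1" "hermite_poly q (Suc 0) = [:0, 1:]"
  "hermite_poly q (Suc (Suc k)) = hermite_poly q (Suc k) * [:0, 1:]
     + Polynomial.smult (- complex_of_real (q_number q (Suc k))) (hermite_poly q k)"
proof -
  show "hermite_poly q 0 = 1" by (simp add: hermite_poly_def)
  show "hermite_poly q (Suc 0) = [:0, 1:]" by (simp add: hermite_poly_def map_poly_pCons)
  show "hermite_poly q (Suc (Suc k)) = hermite_poly q (Suc k) * [:0, 1:]
     + Polynomial.smult (- complex_of_real (q_number q (Suc k))) (hermite_poly q k)"
    unfolding hermite_poly_def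
    by (rule poly_eqI) (auto simp: coeff_map_poly coeff_pCons split: nat.splits)
qed

text \<open>
  With \<open>D\<^sub>k = X\<^sub>k - H\<^sub>k(X\<^sub>1)\<close> the product formula and the recursion of the Hermite polynomials give
  \<open>D\<^sub>m\<^sub>+\<^sub>2 = D\<^sub>m\<^sub>+\<^sub>1 X\<^sub>1 - [m+1]\<^sub>q D\<^sub>m + [m+1]\<^sub>q (X\<^sub>m - Y\<^sub>m)\<close>, and the negligible sequences form an ideal.
\<close>

lemma negligible_X_op_minus_hermite:
  assumes contraction: "\<And>m. m \<ge> 1 \<Longrightarrow> negligible (\<lambda>n. complex_of_real (q_number q (Suc m)) \<cdot>\<^sub>m X_op \<epsilon> n m - contraction_op n m)"
  shows "negligible (\<lambda>n. X_op \<epsilon> n k - poly_mat (hermite_poly q k) (X_op \<epsilon> n 1))"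
proof (induction k rule: induct_nat_012)
  note adm = admissible_minus[OF admissible_X_op admissible_poly_mat[OF admissible_X_op]]
  case 0
  then show ?case
    by (rule negligible_cong[OF negligible_zero adm])
      (auto simp: hermite_poly_simps poly_mat_1[OF X_op_carrier] X_op_0 intro!: eq_matI)
next
  note adm = admissible_minus[OF admissible_X_op admissible_poly_mat[OF admissible_X_op]]
  case 1
  then show ?case
    by (rule negligible_cong[OF negligible_zero adm])
      (use carrier_matD[OF X_op_carrier] in \<open>auto simp: hermite_poly_simps poly_mat_X[OF X_op_carrier] intro!: eq_matI\<close>)
next
  case (ge2 m)
  let ?q = "complex_of_real (q_number q (Suc m))"
  let ?D = "\<lambda>k n. X_op \<epsilon> n k - poly_mat (hermite_poly q k) (X_op \<epsilon> n 1)"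
  have contr: "negligible (\<lambda>n. ?q \<cdot>\<^sub>m X_op \<epsilon> n m - contraction_op n m)"
  proof (cases m)
    case 0
    show ?thesis
      by (rule negligible_cong[OF negligible_zero admissible_minus[OF admissible_smult[OF admissible_X_op] admissible_contraction_op]])
        (auto simp: 0 X_op_0 q_number_def intro!: eq_matI)
  next
    case (Suc l)
    then show ?thesis using contraction[of m] by simp
  qed
  have "negligible (\<lambda>n. ?D (Suc m) n * X_op \<epsilon> n 1 + ((- ?q) \<cdot>\<^sub>m ?D m n + (?q \<cdot>\<^sub>m X_op \<epsilon> n m - contraction_op n m)))"
    by (intro negligible_add negligible_smult negligible_mult_right admissible_X_op ge2 contr)
  then show ?case
  proof (rule negligible_cong)
    fix n :: nat assume n: "n \<ge> 1"
    let ?N = "2 ^ n :: nat"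
    let ?X = "\<lambda>k. X_op \<epsilon> n k" and ?H = "\<lambda>k. poly_mat (hermite_poly q k) (X_op \<epsilon> n 1)"
    have c: "?X k \<in> carrier_mat ?N ?N" "?H k \<in> carrier_mat ?N ?N" "contraction_op n m \<in> carrier_mat ?N ?N" for k by auto
    have X: "?X (Suc (Suc m)) = ?X (Suc m) * ?X 1 - contraction_op n m"
      unfolding X_op_mult_X_op_1[OF n]
      using carrier_matD[OF c(1)] carrier_matD[OF c(3)] by (intro eq_matI) auto
    have H: "?H (Suc (Suc m)) = ?H (Suc m) * ?X 1 + (- ?q) \<cdot>\<^sub>m ?H m"
      unfolding hermite_poly_simps poly_mat_add[OF c(1)] poly_mat_mult[OF c(1)] poly_mat_smult[OF c(1)]
        poly_mat_X[OF c(1)] ..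
    have "(?X (Suc m) - ?H (Suc m)) * ?X 1 = ?X (Suc m) * ?X 1 - ?H (Suc m) * ?X 1"
      by (rule minus_mult_distrib_mat[OF c(1,2,1)])
    then show "?D (Suc (Suc m)) n = ?D (Suc m) n * ?X 1 + ((- ?q) \<cdot>\<^sub>m ?D m n + (?q \<cdot>\<^sub>m ?X m - contraction_op n m))"
      unfolding X H using carrier_matD[OF c(1)] carrier_matD[OF c(2)] carrier_matD[OF c(3)]
      by (intro eq_matI) (auto simp: algebra_simps simp del: index_mult_mat(1))
  qed (intro admissible_minus admissible_X_op admissible_poly_mat)
qed

end

section \<open>The fermionic case\<close>

context signs
begin

lemma X_op_entry:
  assumes "n \<ge> 1" "a < 2 ^ n" "b < 2 ^ n"
  shows "X_op \<epsilon> n k $$ (a, b) = complex_of_real ((1 / sqrt (real n)) ^ k *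
    (\<Sum>w | w \<in> tuples n k \<and> set w = sym_difference (bits n a) (bits n b). word_sign \<epsilon> w (bits n b)))"
  using weighted_sum_entry[OF assms, of k "\<lambda>_. 1"] by (simp add: X_op_def)

text \<open>
  Reversing words is a bijection of the tuples that implements the adjoint.
\<close>

lemma X_op_symmetric:
  assumes n: "n \<ge> 1" and ab: "a < 2 ^ n" "b < 2 ^ n"
  shows "X_op \<epsilon> n k $$ (a, b) = X_op \<epsilon> n k $$ (b, a)"
proof -
  have comm: "sym_difference (bits n b) (bits n a) = sym_difference (bits n a) (bits n b)"
    by (auto simp: sym_difference_def)
  have "(\<Sum>w | w \<in> tuples n k \<and> set w = sym_difference (bits n a) (bits n b). word_sign \<epsilon> w (bits n b))
      = (\<Sum>w | w \<in> tuples n k \<and> set w = sym_difference (bits n a) (bits n b). word_sign \<epsilon> w (bits n a))"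
  proof (rule sum.reindex_bij_witness[of _ rev rev], goal_cases)
    case (5 w)
    then have w: "w \<in> tuples n k" "set w = sym_difference (bits n a) (bits n b)" by auto
    then have "act w (bits n b) = bits n a"
      unfolding act_distinct_sym_difference[OF tuplesD(2)[OF w(1)]] w(2)
      by (auto simp: sym_difference_def)
    moreover have "word_sign \<epsilon> (rev w) (act w (bits n b)) = word_sign \<epsilon> w (bits n b)"
      using tuplesD(3)[OF w(1)] bits_subset[of n b] by (intro word_sign_rev) auto
    ultimately show ?case by simp
  qed (auto simp: tuples_def)
  then show ?thesis unfolding X_op_entry[OF n ab] X_op_entry[OF n ab(2,1)] comm by simp
qed

lemma X_op_self_adjoint:
  assumes n: "n \<ge> 1"
  shows "mat_adjoint (X_op \<epsilon> n k) = X_op \<epsilon> n k"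
proof (rule eq_matI, goal_cases)
  case (1 a b)
  then have ab: "a < 2 ^ n" "b < 2 ^ n" by auto
  have "cnj (X_op \<epsilon> n k $$ (b, a)) = X_op \<epsilon> n k $$ (b, a)"
    unfolding X_op_entry[OF n ab(2,1)] by (rule complex_cnj_complex_of_real)
  then show ?case using ab X_op_symmetric[OF n ab] by simp
qed simp_all

text \<open>
  This is \<open>1\<close> if the first two generators of the word commute, and \<open>0\<close> if they anticommute.
\<close>

definition commuting_head :: "nat list \<Rightarrow> real" where
  "commuting_head w = (1 + \<epsilon> (w ! 0) (w ! 1)) / 2"

lemma tuple_head:
  assumes "w \<in> tuples n (Suc (Suc m))"
  obtains i j v where "w = i # j # v" "i \<in> {1..n}" "j \<in> {1..n}" "i \<noteq> j" "length v = m" "set v \<subseteq> {1..n}"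
  using assms by (auto simp: tuples_def length_Suc_conv)

lemma commuting_head_bounds:
  assumes "w \<in> tuples n (Suc (Suc m))"
  shows "0 \<le> commuting_head w" "commuting_head w \<le> 1"
proof -
  obtain i j v where "w = i # j # v" "i \<in> {1..n}" "j \<in> {1..n}" by (rule tuple_head[OF assms])
  then show "0 \<le> commuting_head w" "commuting_head w \<le> 1"
    using eps_cases[of i j] by (auto simp: commuting_head_def)
qed

text \<open>
  Average over the exchange of the first two letters: the products of tuples whose first
  two generators anticommute cancel in pairs.
\<close>

lemma sum_word_sign_symmetrize:
  assumes B: "B \<subseteq> {1..n}"
  shows "(\<Sum>w | w \<in> tuples n (Suc (Suc m)) \<and> set w = D. word_sign \<epsilon> w B)
    = (\<Sum>w | w \<in> tuples n (Suc (Suc m)) \<and> set w = D. commuting_head w * word_sign \<epsilon> w B)"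
proof -
  let ?T = "{w. w \<in> tuples n (Suc (Suc m)) \<and> set w = D}"
  let ?swap = "\<lambda>w. w ! 1 # w ! 0 # drop 2 w :: nat list"
  have key: "?swap (?swap w) = w" "?swap w \<in> ?T"
    "\<epsilon> (?swap w ! 0) (?swap w ! 1) * word_sign \<epsilon> (?swap w) B = word_sign \<epsilon> w B" if w: "w \<in> ?T" for w
  proof -
    from w obtain i j v where v: "w = i # j # v" "i \<in> {1..n}" "j \<in> {1..n}" "i \<noteq> j" "length v = m" "set v \<subseteq> {1..n}"
      using tuple_head by blast
    show "?swap (?swap w) = w" by (simp add: v(1))
    show "?swap w \<in> ?T" using w v by (auto simp: tuples_def)
    have fin: "finite B" using B by (rule finite_subset) simp
    have "word_sign \<epsilon> (i # j # v) B = \<epsilon> i j * word_sign \<epsilon> (j # i # v) B"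
      using word_sign_swap[OF fin, of i j "[]" v] v by simp
    then show "\<epsilon> (?swap w ! 0) (?swap w ! 1) * word_sign \<epsilon> (?swap w) B = word_sign \<epsilon> w B"
      using eps_sym[of i j] v by (simp del: word_sign.simps)
  qed
  have "(\<Sum>w\<in>?T. word_sign \<epsilon> w B) = (\<Sum>w\<in>?T. \<epsilon> (w ! 0) (w ! 1) * word_sign \<epsilon> w B)"
    by (rule sum.reindex_bij_witness[of ?T ?swap ?swap ?T]) (rule key, assumption)+
  moreover have "(\<Sum>w\<in>?T. commuting_head w * word_sign \<epsilon> w B)
      = ((\<Sum>w\<in>?T. word_sign \<epsilon> w B) + (\<Sum>w\<in>?T. \<epsilon> (w ! 0) (w ! 1) * word_sign \<epsilon> w B)) / 2"
    unfolding sum.distrib[symmetric] sum_divide_distrib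
    by (rule sum.cong) (auto simp: commuting_head_def field_simps)
  ultimately show ?thesis by simp
qed

lemma sum_fibres:
  fixes f :: "nat list \<Rightarrow> real"
  shows "(\<Sum>a<2 ^ n. \<Sum>w | w \<in> tuples n k \<and> set w = bits n a. f w) = (\<Sum>w\<in>tuples n k. f w)"
proof -
  have "(\<Sum>a<2 ^ n. \<Sum>w | w \<in> tuples n k \<and> set w = bits n a. f w)
      = (\<Sum>A\<in>Pow {1..n}. \<Sum>w | w \<in> tuples n k \<and> set w = A. f w)"
    by (rule sum.reindex_bij_betw[OF bij_betw_bits])
  also have "\<dots> = (\<Sum>w\<in>tuples n k. f w)"
  proof (rule sum.group)
    show "set ` tuples n k \<subseteq> Pow {1..n}" using tuplesD(3) by blast
  qed simp_all
  finally show ?thesis .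
qed

lemma vacuum_norm_X_op_sq:
  assumes n: "n \<ge> 1"
  shows "(vacuum_norm n (X_op \<epsilon> n k))\<^sup>2 = (1 / real n) ^ k *
    (\<Sum>a<2 ^ n. (\<Sum>w | w \<in> tuples n k \<and> set w = bits n a. word_sign \<epsilon> w {})\<^sup>2)"
proof -
  have r: "((1 / sqrt (real n)) ^ k)\<^sup>2 = (1 / real n) ^ k"
    by (simp add: power_mult[symmetric] mult.commute[of k 2]) (simp add: power_mult power_divide)
  have zero: "(0::nat) < 2 ^ n" by simp
  have sd: "sym_difference (bits n a) {} = bits n a" for a by (simp add: sym_difference_def)
  have "(cmod (X_op \<epsilon> n k $$ (a, 0)))\<^sup>2
      = (1 / real n) ^ k * (\<Sum>w | w \<in> tuples n k \<and> set w = bits n a. word_sign \<epsilon> w {})\<^sup>2" if "a < 2 ^ n" for a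
    unfolding X_op_entry[OF n that zero] bits_0 sd norm_of_real power2_abs power_mult_distrib r ..
  then show ?thesis unfolding vacuum_norm_sq sum_distrib_left by (intro sum.cong) auto
qed

text \<open>
  After symmetrization only the tuples with commuting first generators remain, and their share among
  all tuples is the share of the commuting pairs.
\<close>

lemma vacuum_norm_X_op_le:
  assumes n: "n \<ge> 1"
  shows "(vacuum_norm n (X_op \<epsilon> n (Suc (Suc m))))\<^sup>2
    \<le> fact (Suc (Suc m)) * ((1 / real n)\<^sup>2 * (\<Sum>w\<in>tuples n 2. commuting_head w))"
proof -
  let ?k = "Suc (Suc m)"
  let ?T = "\<lambda>a. {w. w \<in> tuples n ?k \<and> set w = bits n a}"
  have bound: "(\<Sum>w\<in>?T a. word_sign \<epsilon> w {})\<^sup>2 \<le> fact ?k * (\<Sum>w\<in>?T a. commuting_head w)" for a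
  proof -
    let ?c = "\<Sum>w\<in>?T a. commuting_head w"
    have c0: "0 \<le> ?c" using commuting_head_bounds by (intro sum_nonneg) auto
    have "\<bar>\<Sum>w\<in>?T a. word_sign \<epsilon> w {}\<bar> \<le> ?c"
      unfolding sum_word_sign_symmetrize[of "{}" n, simplified]
    proof (rule order.trans[OF sum_abs], rule sum_mono)
      fix w assume "w \<in> ?T a"
      then have w: "w \<in> tuples n ?k" by simp
      show "\<bar>commuting_head w * word_sign \<epsilon> w {}\<bar> \<le> commuting_head w"
        using commuting_head_bounds[OF w] abs_word_sign_tuple[OF w, of 0] by (simp add: abs_mult)
    qed
    then have "(\<Sum>w\<in>?T a. word_sign \<epsilon> w {})\<^sup>2 \<le> ?c\<^sup>2"
      using c0 by (simp add: abs_le_square_iff[symmetric])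
    also have "\<dots> \<le> fact ?k * ?c"
    proof -
      have "?c \<le> (\<Sum>w\<in>?T a. 1)" using commuting_head_bounds by (intro sum_mono) auto
      also have "\<dots> = real (card (?T a))" by simp
      also have "\<dots> \<le> fact ?k" using card_tuples_same_set[of n ?k "bits n a"] by (metis of_nat_fact of_nat_le_iff)
      finally show ?thesis unfolding power2_eq_square using c0 by (rule mult_right_mono)
    qed
    finally show ?thesis .
  qed
  have "(vacuum_norm n (X_op \<epsilon> n ?k))\<^sup>2
      \<le> (1 / real n) ^ ?k * (\<Sum>a<2 ^ n. fact ?k * (\<Sum>w\<in>?T a. commuting_head w))"
    unfolding vacuum_norm_X_op_sq[OF n] by (intro mult_left_mono sum_mono bound) simp
  also have "\<dots> = fact ?k * (1 / real n) ^ ?k * (\<Sum>w\<in>tuples n ?k. commuting_head w)"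
    unfolding sum_distrib_left[symmetric] sum_fibres by simp
  also have "\<dots> \<le> fact ?k * (1 / real n) ^ ?k * (real n ^ m * (\<Sum>w\<in>tuples n 2. commuting_head w))"
  proof (rule mult_left_mono)
    \<comment> \<open>split a tuple into its first two letters and the rest, for which there are at most \<open>n\<^sup>m\<close> choices\<close>
    let ?L = "{v. set v \<subseteq> {1..n} \<and> length v = m}"
    let ?g = "\<lambda>w :: nat list. ([w ! 0, w ! 1], drop 2 w)"
    have inj: "inj_on ?g (tuples n ?k)"
    proof (rule inj_onI)
      fix w w' assume w: "w \<in> tuples n ?k" "w' \<in> tuples n ?k" and eq: "?g w = ?g w'"
      obtain i j v where "w = i # j # v" by (rule tuple_head[OF w(1)])
      moreover obtain i' j' v' where "w' = i' # j' # v'" by (rule tuple_head[OF w(2)])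
      ultimately show "w = w'" using eq by simp
    qed
    have img: "?g ` tuples n ?k \<subseteq> tuples n 2 \<times> ?L"
    proof
      fix p assume "p \<in> ?g ` tuples n ?k"
      then obtain w where w: "w \<in> tuples n ?k" "p = ?g w" by auto
      obtain i j v where "w = i # j # v" "i \<in> {1..n}" "j \<in> {1..n}" "i \<noteq> j" "length v = m" "set v \<subseteq> {1..n}"
        by (rule tuple_head[OF w(1)])
      then show "p \<in> tuples n 2 \<times> ?L" using w(2) by (auto simp: tuples_def)
    qed
    have finL: "finite ?L" by (rule finite_lists_length_eq) simp
    have "(\<Sum>w\<in>tuples n ?k. commuting_head w) = (\<Sum>p\<in>?g ` tuples n ?k. commuting_head (fst p))"
      unfolding sum.reindex[OF inj] by (simp add: commuting_head_def)
    also have "\<dots> \<le> (\<Sum>p\<in>tuples n 2 \<times> ?L. commuting_head (fst p))"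
      using finL img commuting_head_bounds(1)[of _ n 0]
      by (intro sum_mono2) (auto simp: numeral_2_eq_2)
    also have "\<dots> = (\<Sum>u\<in>tuples n 2. \<Sum>v\<in>?L. commuting_head u)"
      by (simp only: sum.cartesian_product split_def)
    also have "\<dots> = real n ^ m * (\<Sum>w\<in>tuples n 2. commuting_head w)"
      using card_lists_length_eq[of "{1..n}" m] by (simp add: sum_distrib_left)
    finally show "(\<Sum>w\<in>tuples n ?k. commuting_head w) \<le> real n ^ m * (\<Sum>w\<in>tuples n 2. commuting_head w)" .
  qed simp
  also have "fact ?k * (1 / real n) ^ ?k * (real n ^ m * (\<Sum>w\<in>tuples n 2. commuting_head w))
      = fact ?k * ((1 / real n)\<^sup>2 * (\<Sum>w\<in>tuples n 2. commuting_head w))"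
    using n by (simp add: power_divide power2_eq_square)
  finally show ?thesis .
qed

text \<open>
  Conversely, a commuting pair \<open>i, j\<close> contributes \<open>\<gamma>\<^sub>i \<gamma>\<^sub>j + \<gamma>\<^sub>j \<gamma>\<^sub>i = 2 \<gamma>\<^sub>i \<gamma>\<^sub>j\<close> to \<open>X\<^sub>n\<^sub>,\<^sub>2\<close>, so that the norm of
  \<open>X\<^sub>n\<^sub>,\<^sub>2\<close> controls the number of commuting pairs.
\<close>

lemma vacuum_norm_X_op_2_ge:
  assumes n: "n \<ge> 1"
  shows "2 * ((1 / real n)\<^sup>2 * (\<Sum>w\<in>tuples n 2. commuting_head w)) \<le> (vacuum_norm n (X_op \<epsilon> n 2))\<^sup>2"
proof -
  let ?T = "\<lambda>a. {w. w \<in> tuples n 2 \<and> set w = bits n a}"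
  have "2 * (\<Sum>w\<in>?T a. commuting_head w) \<le> (\<Sum>w\<in>?T a. word_sign \<epsilon> w {})\<^sup>2" for a
  proof (cases "?T a = {}")
    case True
    show ?thesis unfolding True by simp
  next
    case False
    then obtain w where w: "w \<in> tuples n (Suc (Suc 0))" "set w = bits n a" by (auto simp: numeral_2_eq_2)
    obtain i j v where v: "w = i # j # v" "i \<in> {1..n}" "j \<in> {1..n}" "i \<noteq> j" "length v = 0"
      by (rule tuple_head[OF w(1)])
    have T: "?T a = {[i, j], [j, i]}"
    proof -
      have ij: "bits n a = {i, j}" using w v by auto
      have "u = [i, j] \<or> u = [j, i]" if u: "u \<in> tuples n 2" "set u = {i, j}" for u
      proof -
        have "u \<in> tuples n (Suc (Suc 0))" using u by (simp add: numeral_2_eq_2)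
        then obtain i' j' v' where "u = i' # j' # v'" "i' \<noteq> j'" "length v' = 0" by (rule tuple_head)
        then show ?thesis using u(2) by (auto simp: doubleton_eq_iff)
      qed
      then show ?thesis using v unfolding ij by (auto simp: tuples_def)
    qed
    have sum2: "(\<Sum>w\<in>{[i, j], [j, i]}. f w) = f [i, j] + f [j, i]" for f :: "nat list \<Rightarrow> real"
      using v(4) by simp
    have s: "word_sign \<epsilon> [i, j] {} = \<epsilon> i j * word_sign \<epsilon> [j, i] {}"
      using word_sign_swap[of "{}" i j "[]" "[]"] v by simp
    have s2: "word_sign \<epsilon> [j, i] {} * word_sign \<epsilon> [j, i] {} = 1"
      using v by (intro word_sign_sq) auto
    have "(\<Sum>w\<in>?T a. word_sign \<epsilon> w {})\<^sup>2 = (1 + \<epsilon> i j)\<^sup>2 * (word_sign \<epsilon> [j, i] {} * word_sign \<epsilon> [j, i] {})"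
      unfolding T sum2 s by (simp add: power2_eq_square algebra_simps del: word_sign.simps)
    also have "\<dots> = 2 * (1 + \<epsilon> i j)" unfolding s2 using eps_cases[of i j] v by auto
    also have "\<dots> = 2 * (\<Sum>w\<in>?T a. commuting_head w)"
      unfolding T sum2 using eps_sym[of i j] v by (simp add: commuting_head_def)
    finally show ?thesis by simp
  qed
  then have "(\<Sum>a<2 ^ n. 2 * (\<Sum>w\<in>?T a. commuting_head w)) \<le> (\<Sum>a<2 ^ n. (\<Sum>w\<in>?T a. word_sign \<epsilon> w {})\<^sup>2)"
    by (intro sum_mono)
  then have "(1 / real n)\<^sup>2 * (\<Sum>a<2 ^ n. 2 * (\<Sum>w\<in>?T a. commuting_head w)) \<le> (vacuum_norm n (X_op \<epsilon> n 2))\<^sup>2"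
    unfolding vacuum_norm_X_op_sq[OF n] by (intro mult_left_mono) simp_all
  then show ?thesis unfolding sum_distrib_left[symmetric] sum_fibres by (simp add: mult_ac)
qed

lemma X_op_2_eq:
  assumes n: "n \<ge> 1"
  shows "X_op \<epsilon> n 2 = poly_mat (hermite_poly (-1) 2) (X_op \<epsilon> n 1)"
proof -
  let ?N = "2 ^ n :: nat"
  have h: "hermite_poly (-1) 2 = [:0, 1:] * [:0, 1:] + Polynomial.smult (-1) 1"
    by (simp only: numeral_2_eq_2 hermite_poly_simps) (simp add: q_number_def)
  have "poly_mat (hermite_poly (-1) 2) (X_op \<epsilon> n 1) = X_op \<epsilon> n 1 * X_op \<epsilon> n 1 + (-1) \<cdot>\<^sub>m 1\<^sub>m ?N"
    unfolding h poly_mat_add[OF X_op_carrier] poly_mat_mult[OF X_op_carrier] poly_mat_smult[OF X_op_carrier]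
      poly_mat_X[OF X_op_carrier] poly_mat_1[OF X_op_carrier] ..
  also have "X_op \<epsilon> n 1 * X_op \<epsilon> n 1 = X_op \<epsilon> n 2 + 1\<^sub>m ?N"
    using X_op_mult_X_op_1[OF n, of 0] X_op_0[OF n] by (simp add: numeral_2_eq_2)
  also have "X_op \<epsilon> n 2 + 1\<^sub>m ?N + (-1) \<cdot>\<^sub>m 1\<^sub>m ?N = X_op \<epsilon> n 2"
    by (rule eq_matI) auto
  finally show ?thesis ..
qed

text \<open>
  The limit of \<open>X\<^sub>n\<^sub>,\<^sub>1\<close> takes the values \<open>1\<close> and \<open>-1\<close>, the roots of \<open>H\<^sub>2\<close>. So
  \<open>\<parallel>X\<^sub>n\<^sub>,\<^sub>2 1\<parallel>\<^sup>2 = \<tau>(H\<^sub>2(X\<^sub>n\<^sub>,\<^sub>1)\<^sup>2)\<close> tends to \<open>0\<close>, and this norm dominates those of the higher \<open>X\<^sub>n\<^sub>,\<^sub>k\<close>.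
\<close>

lemma negligible_X_op_fermionic:
  assumes lim: "\<And>Q. (\<lambda>n. tau n (poly_mat Q (X_op \<epsilon> n 1))) \<longlonglongrightarrow> q_gaussian_moment (-1) h Q"
  shows "negligible (\<lambda>n. X_op \<epsilon> n (Suc (Suc m)))"
proof -
  let ?P = "hermite_poly (-1) 2"
  have P: "?P = [:-1, 0, 1:]"
    by (simp only: numeral_2_eq_2 hermite_poly_simps) (simp add: q_number_def one_pCons)
  have "q_gaussian_moment (-1) h (?P * ?P)
      = measure_pmf.expectation (pmf_of_set {1, -1 :: real}) (\<lambda>x. poly (?P * ?P) (complex_of_real x))"
    by (simp add: q_gaussian_moment_def)
  also have "\<dots> = (\<Sum>x\<in>{1, -1}. pmf (pmf_of_set {1, -1}) x *\<^sub>R poly (?P * ?P) (complex_of_real x))"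
    by (rule integral_measure_pmf) auto
  also have "\<dots> = 0" by (simp add: P)
  finally have "(\<lambda>n. tau n (poly_mat (?P * ?P) (X_op \<epsilon> n 1))) \<longlonglongrightarrow> 0"
    using lim[of "?P * ?P"] by simp
  then have "(\<lambda>n. complex_of_real ((vacuum_norm n (X_op \<epsilon> n 2))\<^sup>2)) \<longlonglongrightarrow> 0"
  proof (rule Lim_transform_eventually)
    show "\<forall>\<^sub>F n in sequentially. tau n (poly_mat (?P * ?P) (X_op \<epsilon> n 1))
        = complex_of_real ((vacuum_norm n (X_op \<epsilon> n 2))\<^sup>2)"
      using eventually_ge_at_top[of 1]
    proof eventually_elim
      case (elim n)
      have "poly_mat (?P * ?P) (X_op \<epsilon> n 1) = mat_adjoint (X_op \<epsilon> n 2) * X_op \<epsilon> n 2"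
        by (simp only: X_op_self_adjoint[OF elim] poly_mat_mult[OF X_op_carrier] X_op_2_eq[OF elim, symmetric])
      then show ?case by (simp add: tau_adjoint_self del: of_real_power)
    qed
  qed
  then have "(\<lambda>n. (vacuum_norm n (X_op \<epsilon> n 2))\<^sup>2) \<longlonglongrightarrow> 0"
    using tendsto_of_real_iff[where 'a = complex, of "\<lambda>n. (vacuum_norm n (X_op \<epsilon> n 2))\<^sup>2" 0] by simp
  then have lim2: "(\<lambda>n. fact (Suc (Suc m)) / 2 * (vacuum_norm n (X_op \<epsilon> n 2))\<^sup>2) \<longlonglongrightarrow> 0"
    by (rule tendsto_mult_right_zero)
  have "\<forall>\<^sub>F n in sequentially. (vacuum_norm n (X_op \<epsilon> n (Suc (Suc m))))\<^sup>2
      \<le> fact (Suc (Suc m)) / 2 * (vacuum_norm n (X_op \<epsilon> n 2))\<^sup>2"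
    using eventually_ge_at_top[of 1]
  proof eventually_elim
    case (elim n)
    let ?K = "(1 / real n)\<^sup>2 * (\<Sum>w\<in>tuples n 2. commuting_head w)"
    have "?K \<le> (vacuum_norm n (X_op \<epsilon> n 2))\<^sup>2 / 2" using vacuum_norm_X_op_2_ge[OF elim] by simp
    then have "fact (Suc (Suc m)) * ?K \<le> fact (Suc (Suc m)) * ((vacuum_norm n (X_op \<epsilon> n 2))\<^sup>2 / 2)"
      by (rule mult_left_mono) (rule fact_ge_zero)
    then show ?case using vacuum_norm_X_op_le[OF elim, of m] by linarith
  qed
  then have "(\<lambda>n. (vacuum_norm n (X_op \<epsilon> n (Suc (Suc m))))\<^sup>2) \<longlonglongrightarrow> 0"
    by (intro tendsto_sandwich[OF _ _ tendsto_const lim2]) auto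
  then have "(\<lambda>n. sqrt ((vacuum_norm n (X_op \<epsilon> n (Suc (Suc m))))\<^sup>2)) \<longlonglongrightarrow> sqrt 0"
    by (rule tendsto_real_sqrt)
  then show ?thesis using admissible_X_op by (simp add: negligible_def)
qed

text \<open>
  Since \<open>[2]\<^sub>q = 0\<close>, we have \<open>H\<^sub>3 = x H\<^sub>2\<close>, and from there on the recursion stays in the ideal generated by \<open>H\<^sub>2\<close>.
\<close>

lemma negligible_hermite_fermionic:
  assumes X2: "negligible (\<lambda>n. X_op \<epsilon> n 2)"
  shows "negligible (\<lambda>n. poly_mat (hermite_poly (-1) (Suc (Suc m))) (X_op \<epsilon> n 1))"
proof (induction m rule: induct_nat_012)
  case 0
  show ?case
    by (rule negligible_cong[OF X2 admissible_poly_mat[OF admissible_X_op]])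
      (simp only: numeral_2_eq_2[symmetric] X_op_2_eq)
next
  case 1
  have 2: "negligible (\<lambda>n. poly_mat (hermite_poly (-1) 2) (X_op \<epsilon> n 1))"
    by (rule negligible_cong[OF X2 admissible_poly_mat[OF admissible_X_op]]) (simp add: X_op_2_eq)
  have "q_number (-1) (Suc (Suc 0)) = 0" by (simp add: q_number_def)
  then have "hermite_poly (-1) (Suc (Suc (Suc 0))) = hermite_poly (-1) 2 * [:0, 1:]"
    by (simp only: hermite_poly_simps(3)[of _ "Suc 0"] numeral_2_eq_2) simp
  then show ?case
    using negligible_mult_right[OF admissible_X_op[of 1] 2]
    by (simp only: poly_mat_mult[OF X_op_carrier] poly_mat_X[OF X_op_carrier])
next
  case (ge2 m)
  show ?case
    unfolding hermite_poly_simps(3)[of _ "Suc (Suc m)"] poly_mat_add[OF X_op_carrier]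
      poly_mat_mult[OF X_op_carrier] poly_mat_smult[OF X_op_carrier] poly_mat_X[OF X_op_carrier]
    by (intro negligible_add negligible_smult negligible_mult_right admissible_X_op ge2)
qed

lemma negligible_X_op_1_minus_hermite:
  "negligible (\<lambda>n. X_op \<epsilon> n 1 - poly_mat (hermite_poly q 1) (X_op \<epsilon> n 1))"
  by (rule negligible_cong[OF negligible_zero admissible_minus[OF admissible_X_op admissible_poly_mat[OF admissible_X_op]]])
    (auto simp: hermite_poly_simps poly_mat_X[OF X_op_carrier] intro!: eq_matI)

lemma negligible_X_op_minus_hermite_fermionic:
  assumes lim: "\<And>Q. (\<lambda>n. tau n (poly_mat Q (X_op \<epsilon> n 1))) \<longlonglongrightarrow> q_gaussian_moment (-1) h Q"
    and k: "k \<ge> 1"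
  shows "negligible (\<lambda>n. X_op \<epsilon> n k - poly_mat (hermite_poly (-1) k) (X_op \<epsilon> n 1))"
proof (cases "k = 1")
  case True
  then show ?thesis using negligible_X_op_1_minus_hermite by simp
next
  case False
  then obtain m where m: "k = Suc (Suc m)" using k by (metis One_nat_def not0_implies_Suc not_one_le_zero)
  have "negligible (\<lambda>n. X_op \<epsilon> n 2)"
    using negligible_X_op_fermionic[OF lim, of 0] by (simp add: numeral_2_eq_2)
  then show ?thesis unfolding m
    by (intro negligible_minus negligible_X_op_fermionic[OF lim] negligible_hermite_fermionic)
qed

end

section \<open>Convergence of the moments\<close>

lemma q_number_Suc_nonzero:
  assumes "-1 < q" "q \<le> 1"
  shows "q_number q (Suc k) \<noteq> 0"
proof (cases "q = 1")
  case False
  then have "\<bar>q\<bar> < 1" using assms by auto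
  then have "\<bar>q\<bar> ^ Suc k \<le> \<bar>q\<bar> ^ 1" by (intro power_decreasing) auto
  then have "\<bar>q ^ Suc k\<bar> < 1" using \<open>\<bar>q\<bar> < 1\<close> by (simp only: power_abs) simp
  then show ?thesis using False by (auto simp: q_number_def)
qed (simp add: q_number_def)

context signs
begin

text \<open>
  For \<open>p = 2\<close> the noncommutative \<open>p\<close>-norm is the vacuum norm, and
  \<open>[m+1]\<^sub>q X\<^sub>m - [m+1]\<^sub>q Y\<^sub>m\<close> is a multiple of \<open>X\<^sub>m - Y\<^sub>m\<close>.
\<close>

lemma negligible_contraction:
  assumes lim: "(\<lambda>n. p_norm n 2 (X_op \<epsilon> n m - Y_op \<epsilon> q n m)) \<longlonglongrightarrow> 0"
    and q: "q_number q (Suc m) \<noteq> 0"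
  shows "negligible (\<lambda>n. complex_of_real (q_number q (Suc m)) \<cdot>\<^sub>m X_op \<epsilon> n m - contraction_op n m)"
proof -
  let ?c = "complex_of_real (q_number q (Suc m))"
  have "admissible (\<lambda>n. X_op \<epsilon> n m - Y_op \<epsilon> q n m)"
    unfolding Y_op_eq_contraction_op by (intro admissible_minus admissible_X_op admissible_smult admissible_contraction_op)
  moreover have "p_norm n 2 (X_op \<epsilon> n m - Y_op \<epsilon> q n m) = vacuum_norm n (X_op \<epsilon> n m - Y_op \<epsilon> q n m)" for n
    by (rule p_norm_2) (intro minus_carrier_mat Y_op_carrier)
  ultimately have "negligible (\<lambda>n. X_op \<epsilon> n m - Y_op \<epsilon> q n m)"
    using lim by (simp add: negligible_def)
  then have "negligible (\<lambda>n. ?c \<cdot>\<^sub>m (X_op \<epsilon> n m - Y_op \<epsilon> q n m))" by (rule negligible_smult)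
  moreover have "?c \<cdot>\<^sub>m (X_op \<epsilon> n m - Y_op \<epsilon> q n m) = ?c \<cdot>\<^sub>m X_op \<epsilon> n m - contraction_op n m" for n
    unfolding Y_op_eq_contraction_op using q
    by (intro eq_matI) (auto simp: algebra_simps simp flip: of_real_mult)
  ultimately show ?thesis by simp
qed

lemma moments_X_op:
  assumes D: "negligible (\<lambda>n. X_op \<epsilon> n k - poly_mat (hermite_poly q k) (X_op \<epsilon> n 1))"
    and lim: "\<And>Q. (\<lambda>n. tau n (poly_mat Q (X_op \<epsilon> n 1))) \<longlonglongrightarrow> q_gaussian_moment q h Q"
  shows "(\<lambda>n. tau n (poly_mat Q (X_op \<epsilon> n k))) \<longlonglongrightarrow> hermite_moment q h k Q"
proof -
  let ?H = "\<lambda>n. poly_mat (hermite_poly q k) (X_op \<epsilon> n 1)"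
  have "(\<lambda>n. tau n (poly_mat Q (X_op \<epsilon> n k) - poly_mat Q (?H n))) \<longlonglongrightarrow> 0"
    by (intro tau_negligible negligible_poly_mat_diff D admissible_X_op admissible_poly_mat)
  moreover have "tau n (poly_mat Q (X_op \<epsilon> n k) - poly_mat Q (?H n))
      = tau n (poly_mat Q (X_op \<epsilon> n k)) - tau n (poly_mat Q (?H n))" for n
    by (subst (1 2 3) tau_index[of _ n]) (auto intro!: poly_mat_carrier minus_carrier_mat)
  ultimately have "(\<lambda>n. tau n (poly_mat Q (X_op \<epsilon> n k)) - tau n (poly_mat Q (?H n))) \<longlonglongrightarrow> 0" by simp
  moreover have "(\<lambda>n. tau n (poly_mat Q (?H n))) \<longlonglongrightarrow> hermite_moment q h k Q"
    using lim[of "pcompose Q (hermite_poly q k)"]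
    by (simp only: poly_mat_pcompose[OF X_op_carrier] hermite_moment_def hermite_poly_def)
  ultimately have "(\<lambda>n. (tau n (poly_mat Q (X_op \<epsilon> n k)) - tau n (poly_mat Q (?H n))) + tau n (poly_mat Q (?H n)))
      \<longlonglongrightarrow> 0 + hermite_moment q h k Q"
    by (rule tendsto_add)
  then show ?thesis by simp
qed

end

section \<open>Weighted graphs on the cube\<close>

lemma card_differing_coordinates:
  "card {i \<in> {1..n}. vertex n a i \<noteq> vertex n b i} = hamming n a b"
proof -
  have "vertex n a i \<noteq> vertex n b i \<longleftrightarrow> i \<in> sym_difference (bits n a) (bits n b)" if "i \<in> {1..n}" for i
    using that by (auto simp: vertex_def bits_iff sym_difference_def bit_iff_odd odd_iff_mod_2_eq_one)
  moreover have "sym_difference (bits n a) (bits n b) \<subseteq> {1..n}"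
    using bits_subset by (auto simp: sym_difference_def)
  ultimately have "{i \<in> {1..n}. vertex n a i \<noteq> vertex n b i} = sym_difference (bits n a) (bits n b)"
    by blast
  then show ?thesis by (simp add: hamming_def)
qed

lemma vertex_in_cube: "vertex n a \<in> cube n"
  by (auto simp: vertex_def cube_def)

lemma vertex_inj: "a < 2 ^ n \<Longrightarrow> b < 2 ^ n \<Longrightarrow> vertex n a = vertex n b \<Longrightarrow> a = b"
  using bits_inj[of a n b] by (simp add: bits_def)

context signs
begin

text \<open>
  The weight of an edge is the matrix entry at its two end points, in either order by symmetry.
\<close>

lemma X_op_weighted_graph:
  assumes k: "k \<ge> 1" and n: "n \<ge> k"
  shows "is_weighted_graph_on n (distance_edges n k) (X_op \<epsilon> n k)"
proof -
  have n1: "n \<ge> 1" using k n by simp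
  let ?X = "X_op \<epsilon> n k"
  define w where "w e = (SOME x. \<exists>a<2 ^ n. \<exists>b<2 ^ n. e = {vertex n a, vertex n b} \<and> x = Re (?X $$ (a, b)))" for e
  have w: "w {vertex n a, vertex n b} = Re (?X $$ (a, b))" if ab: "a < 2 ^ n" "b < 2 ^ n" for a b
  proof -
    have "x = Re (?X $$ (a, b))"
      if "\<exists>a'<2 ^ n. \<exists>b'<2 ^ n. {vertex n a, vertex n b} = {vertex n a', vertex n b'} \<and> x = Re (?X $$ (a', b'))" for x
    proof -
      from that obtain a' b' where *: "a' < 2 ^ n" "b' < 2 ^ n"
        "{vertex n a, vertex n b} = {vertex n a', vertex n b'}" "x = Re (?X $$ (a', b'))" by blast
      then have "(a' = a \<and> b' = b) \<or> (a' = b \<and> b' = a)"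
        using ab vertex_inj by (metis doubleton_eq_iff)
      then show ?thesis using *(4) X_op_symmetric[OF n1 ab] by auto
    qed
    then show ?thesis unfolding w_def using ab by (intro some_equality) blast+
  qed
  have "?X = adjacency_mat n (distance_edges n k) w"
  proof (rule eq_matI, goal_cases)
    case (1 a b)
    then have ab: "a < 2 ^ n" "b < 2 ^ n" by (simp_all add: adjacency_mat_def)
    have real: "?X $$ (a, b) = complex_of_real (Re (?X $$ (a, b)))"
      unfolding X_op_entry[OF n1 ab] by (simp only: Re_complex_of_real)
    show ?case
    proof (cases "{vertex n a, vertex n b} \<in> distance_edges n k")
      case True
      then show ?thesis using real w[OF ab] ab by (simp add: adjacency_mat_def)
    next
      case False
      then have "hamming n a b \<noteq> k"
        unfolding distance_edges_def using vertex_in_cube card_differing_coordinates[of n a b] by blast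
      then have "{w. w \<in> tuples n k \<and> set w = sym_difference (bits n a) (bits n b)} = {}"
        using distinct_card by (fastforce simp: tuples_def hamming_def)
      then have "?X $$ (a, b) = 0" unfolding X_op_entry[OF n1 ab] by (simp only: sum.empty) simp
      then show ?thesis using False ab by (simp add: adjacency_mat_def)
    qed
  qed (simp_all add: adjacency_mat_def)
  then show ?thesis unfolding is_weighted_graph_on_def by blast
qed

end

section \<open>The limit theorem\<close>

theorem corollary4p2:
  fixes q :: real and \<epsilon> :: "nat \<Rightarrow> nat \<Rightarrow> real" and h :: "'h::{real_inner, complete_space}"
  assumes "-1 \<le> q" and "q \<le> 1"
    and "norm h = 1"
    and "sign_function \<epsilon>"
    and "\<forall>Q. (\<lambda>n. tau n (poly_mat Q (X_op \<epsilon> n 1))) \<longlonglongrightarrow> q_gaussian_moment q h Q"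
    and "\<forall>k\<ge>1. q_number q (k + 1) \<noteq> 0 \<longrightarrow>
           (\<forall>p\<ge>1. (\<lambda>n. p_norm n p (X_op \<epsilon> n k - Y_op \<epsilon> q n k)) \<longlonglongrightarrow> 0)"
  shows "(\<forall>k\<ge>1. \<forall>Q. (\<lambda>n. tau n (poly_mat Q (X_op \<epsilon> n k))) \<longlonglongrightarrow> hermite_moment q h k Q) \<and>
    (\<forall>k\<ge>1. \<exists>A. (\<forall>n\<ge>k. is_weighted_graph_on n (distance_edges n k) (A n)) \<and>
       (\<forall>Q. (\<lambda>n. (poly_mat Q (A n) *\<^sub>v delta_vec n (origin n)) \<bullet>c delta_vec n (origin n))
              \<longlonglongrightarrow> hermite_moment q h k Q) \<and>
       (\<forall>n\<ge>k. A n = X_op \<epsilon> n k))"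
proof -
  interpret signs \<epsilon> by unfold_locales (rule assms(4))
  have lim: "(\<lambda>n. tau n (poly_mat Q (X_op \<epsilon> n 1))) \<longlonglongrightarrow> q_gaussian_moment q h Q" for Q
    using assms(5) by blast
  have D: "negligible (\<lambda>n. X_op \<epsilon> n k - poly_mat (hermite_poly q k) (X_op \<epsilon> n 1))" if k: "k \<ge> 1" for k
  proof (cases "q = -1")
    case True
    then show ?thesis using negligible_X_op_minus_hermite_fermionic[OF _ k, of h] lim by simp
  next
    case False
    then have q: "-1 < q" using assms(1) by simp
    show ?thesis
    proof (rule negligible_X_op_minus_hermite)
      fix m :: nat assume m: "m \<ge> 1"
      have nz: "q_number q (Suc m) \<noteq> 0" using q assms(2) by (rule q_number_Suc_nonzero)
      then have "(\<lambda>n. p_norm n 2 (X_op \<epsilon> n m - Y_op \<epsilon> q n m)) \<longlonglongrightarrow> 0"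
        using assms(6) m by simp
      then show "negligible (\<lambda>n. complex_of_real (q_number q (Suc m)) \<cdot>\<^sub>m X_op \<epsilon> n m - contraction_op n m)"
        using nz by (rule negligible_contraction)
    qed
  qed
  have moments: "(\<lambda>n. tau n (poly_mat Q (X_op \<epsilon> n k))) \<longlonglongrightarrow> hermite_moment q h k Q" if "k \<ge> 1" for k Q
    using D[OF that] lim by (rule moments_X_op)
  show ?thesis
  proof (intro conjI allI impI)
    fix k :: nat and Q assume "k \<ge> 1"
    then show "(\<lambda>n. tau n (poly_mat Q (X_op \<epsilon> n k))) \<longlonglongrightarrow> hermite_moment q h k Q" by (rule moments)
  next
    fix k :: nat assume k: "k \<ge> 1"
    show "\<exists>A. (\<forall>n\<ge>k. is_weighted_graph_on n (distance_edges n k) (A n)) \<and>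
       (\<forall>Q. (\<lambda>n. (poly_mat Q (A n) *\<^sub>v delta_vec n (origin n)) \<bullet>c delta_vec n (origin n))
              \<longlonglongrightarrow> hermite_moment q h k Q) \<and>
       (\<forall>n\<ge>k. A n = X_op \<epsilon> n k)"
      using X_op_weighted_graph[OF k] moments[OF k]
      by (intro exI[of _ "\<lambda>n. X_op \<epsilon> n k"]) (simp add: tau_def)
  qed
qed

end
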